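(* Let $\psi:\mathbb R^+\to\mathbb R^+$ be a function, and let $$M(\psi):=\{x\in\mathbb I: M_n(x)\ge\psi(n)\ \text{for infinitely many } n\in\mathbb N\}.$$ Denote $$B_\psi:=\liminf_{n\to\infty}\exp\left(\frac{\log\psi(n)}n\right),\qquad b_\psi:=\liminf_{n\to\infty}\exp\left(\frac{\log\log\psi(n)}n\right).$$ Then $$\dim_{\rm H}M(\psi)=\begin{cases}1,& \text{if } B_\psi=1;\\ \theta(\log B_\psi),&\text{if } 1<B_\psi<\infty;\\ \dfrac1{b_\psi+1},&\text{if } B_\psi=\infty,\end{cases}$$ where, for $B>1$, $\theta(\log B)$ denotes the unique solution $\theta\in(1/2,\infty)$ of $\mathrm P(\theta)=\theta\log B$.
   Context: $\mathbb N=\{1,2,3,\dots\}$, $\mathbb R^+$ is the set of positive reals, and $\mathbb I:=[0,1)\setminus\mathbb Q$. For $x\in\mathbb I$, $a_1(x),a_2(x),\dots\in\mathbb N$ are the coefficients (partial quotients) of its continued fraction expansion $x=[a_1(x),a_2(x),\dots]=1/(a_1(x)+1/(a_2(x)+\cdots))$, and $M_n(x):=\max\{a_1(x),\dots,a_n(x)\}$. For positive integers $a_1,\dots,a_n$, $q_n(a_1,\dots,a_n)$ is the denominator (in lowest terms) of the rational number $[a_1,\dots,a_n]=1/(a_1+1/(a_2+\cdots+1/a_n))$. The Diophantine pressure function is $$\mathrm P(\theta):=\lim_{n\to\infty}\frac1n\log\sum_{a_1,\dots,a_n\in\mathbb N}q_n(a_1,\dots,a_n)^{-2\theta},\qquad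 \theta>\tfrac12.$$ $\dim_{\rm H}$ denotes Hausdorff dimension. The convention $1/\infty=0$ is used. The quantity $b_\psi$ is used only when $B_\psi=\infty$, in which case $\log\log\psi(n)$ is defined for all large $n$ and $b_\psi\in[1,\infty]$. *)

theory Defs
  imports "HOL-Analysis.Analysis"
begin

text \<open>Hausdorff measure and dimension. Covers are countable sequences of bounded sets; boundedness
  is required because \<^const>\<open>diameter\<close> has an arbitrary value on unbounded sets. The case split
  implements the convention \<open>diam(U)\<^sup>0 = 1\<close> for nonempty \<open>U\<close>, since \<open>0 powr 0 = 0\<close> in HOL.\<close>

definition diam_pow :: "real \<Rightarrow> 'a::metric_space set \<Rightarrow> ennreal" where
  "diam_pow s U = (if U = {} then 0 else if s = 0 then 1 else ennreal (diameter U powr s))"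

definition hausdorff_premeasure :: "real \<Rightarrow> real \<Rightarrow> 'a::metric_space set \<Rightarrow> ennreal" where
  "hausdorff_premeasure s \<delta> A =
     (INF U \<in> {U :: nat \<Rightarrow> 'a set. A \<subseteq> (\<Union>i. U i) \<and> (\<forall>i. bounded (U i) \<and> diameter (U i) \<le> \<delta>)}.
        (\<Sum>i. diam_pow s (U i)))"

definition hausdorff_measure :: "real \<Rightarrow> 'a::metric_space set \<Rightarrow> ennreal" where
  "hausdorff_measure s A = (SUP \<delta> \<in> {0<..}. hausdorff_premeasure s \<delta> A)"

definition hausdorff_dim :: "'a::metric_space set \<Rightarrow> ereal" where
  "hausdorff_dim A = Inf {ereal s | s. s \<ge> 0 \<and> hausdorff_measure s A = 0}"

text \<open>Finite continued fractions, rational-valued so that \<^const>\<open>quotient_of\<close> gives the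
  denominator in lowest terms.\<close>

fun cont_frac :: "nat list \<Rightarrow> rat" where
  "cont_frac [] = 0"
| "cont_frac (a # as) = 1 / (of_nat a + cont_frac as)"

definition cf_denom :: "nat list \<Rightarrow> int" where
  "cf_denom as = snd (quotient_of (cont_frac as))"

text \<open>Sequences are 0-based here, so \<open>a i\<close> is the coefficient with index \<open>i + 1\<close>;
  \<open>partial_quotient n x\<close> and \<open>max_quotient n x\<close> are meant for \<open>n \<ge> 1\<close> and irrational \<open>x\<close>
  in the unit interval.\<close>

definition is_cf_expansion :: "(nat \<Rightarrow> nat) \<Rightarrow> real \<Rightarrow> bool" where
  "is_cf_expansion a x \<longleftrightarrow>
     (\<forall>i. a i \<ge> 1) \<and> (\<lambda>n. of_rat (cont_frac (map a [0..<n]))) \<longlonglongrightarrow> x"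

definition partial_quotient :: "nat \<Rightarrow> real \<Rightarrow> nat" where
  "partial_quotient n x = (THE a. is_cf_expansion a x) (n - 1)"

definition max_quotient :: "nat \<Rightarrow> real \<Rightarrow> nat" where
  "max_quotient n x = Max ((\<lambda>k. partial_quotient k x) ` {1..n})"

definition irrationals01 :: "real set" where
  "irrationals01 = {0..<1} - \<rat>"

definition M_set :: "(real \<Rightarrow> real) \<Rightarrow> real set" where
  "M_set \<psi> = {x \<in> irrationals01.
     infinite {n::nat. n \<ge> 1 \<and> real (max_quotient n x) \<ge> \<psi> (real n)}}"

text \<open>Meant for \<open>\<theta> > 1/2\<close>, where the inner sums and the limit are finite.\<close>

definition pressure :: "real \<Rightarrow> real" where
  "pressure \<theta> = lim (\<lambda>n. 1 / real n *
     ln (\<Sum>\<^sub>\<infinity>as\<in>{as :: nat list. length as = n \<and> (\<forall>a\<in>set as. a \<ge> 1)}.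
           real_of_int (cf_denom as) powr (-2 * \<theta>)))"

definition pressure_root :: "real \<Rightarrow> real" where
  "pressure_root c = (THE \<theta>. \<theta> > 1/2 \<and> pressure \<theta> = \<theta> * c)"

definition B_lim :: "(real \<Rightarrow> real) \<Rightarrow> ereal" where
  "B_lim \<psi> = liminf (\<lambda>n. ereal (exp (ln (\<psi> (real n)) / real n)))"

text \<open>Meaningful only if \<open>\<psi>(n) > 1\<close> eventually, so that the iterated logarithm is defined; this is
  the case when \<open>B_lim \<psi> = \<infinity>\<close>.\<close>

definition b_lim :: "(real \<Rightarrow> real) \<Rightarrow> ereal" where
  "b_lim \<psi> = liminf (\<lambda>n. ereal (exp (ln (ln (\<psi> (real n))) / real n)))"

end

theory Submission
  imports Defs "HOL-Probability.Probability"
begin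

text \<open>Let \<open>q\<close> denote the denominator of a word of quotients. The numbers that start with a given word
  and continue with a quotient at least \<open>A\<close> lie in an interval of length at most \<open>1 / (q\<^sup>2 * A)\<close>.
  Covering by these intervals gives the upper bounds; for doubly exponential \<open>\<psi>\<close> one uses only the
  record times of \<open>ln (2 * a\<^sub>n) / d\<^sup>n\<close>, at which \<open>a\<^sub>n\<close> exceeds a power of the product of all earlier
  quotients.

  For the lower bounds, large quotients are prescribed at sparse positions, and the quotients in between
  are distributed in independent blocks of length \<open>m\<close>, with weights \<open>q powr (- 2 * s)\<close>. Two points that
  part at a large quotient \<open>A\<close> are far enough apart to make every set of diameter \<open>\<delta>\<close> have measure
  \<open>O(\<delta> powr s)\<close>, provided that \<open>s * ln B\<close> is less than the pressure at \<open>s\<close>. Since \<open>q\<close> is multiplicative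
  up to a factor 2, the pressure is approximated by finite blocks with an error of order \<open>1 / m\<close>, and it is
  convex, hence continuous.\<close>

section \<open>Continued fractions\<close>

text \<open>The condition on maxima is traded for one on single quotients. If \<open>\<psi>\<close>
  eventually exceeds an increasing unbounded function, every large maximum is attained at a quotient
  that is already large for its own index; if \<open>\<psi>\<close> is below a function at
  infinitely many indices, it is enough to make the quotients at those indices large. An arbitrary
  \<open>\<psi>\<close> can thus be compared with exponential or doubly exponential functions. The
  equation P(s) = s ln B is a balance of mass. The points with a prefix of denominator q whose next
  quotient lies in [A, 2A) occupy an interval of length about 1 / (q^2 A), but carry the entire mass
  of the prefix. Mass q^(-2s) on prefixes is then too large by A^s = B^(ns), which must have been
  saved earlier: the weights q^(-2s), normalised over words of length n, save about exp(n P(s)). For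
  doubly exponential \<open>\<psi>\<close> the critical exponent 1 / (b + 1) is at most 1/2, where
  the sum of q^(-2s) over words diverges. The record times repair this: there a further power of q
  is gained.\<close>

fun conv_num :: "nat list \<Rightarrow> nat" and conv_den :: "nat list \<Rightarrow> nat" where
  "conv_num [] = 0"
| "conv_num (a # u) = conv_den u"
| "conv_den [] = 1"
| "conv_den (a # u) = a * conv_den u + conv_num u"

text \<open>Image of the vector (1, 0) under the product of the matrices with rows (0, 1) and (1, a)
  over the letters a; \<open>conv_num\<close> and \<open>conv_den\<close> give the image of (0, 1).
  For a nonempty word these are the numerator and denominator of the word without its last
  letter.\<close>

fun prev_num :: "nat list \<Rightarrow> nat" and prev_den :: "nat list \<Rightarrow> nat" where
  "prev_num [] = 1"
| "prev_num (a # u) = prev_den u"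
| "prev_den [] = 0"
| "prev_den (a # u) = a * prev_den u + prev_num u"

text \<open>An inverse branch of an iterate of the Gauss map: a tail \<open>t\<close> in [0, 1] goes
  to the number whose expansion is \<open>u\<close> followed by that of \<open>t\<close>.\<close>

primrec cf_map :: "nat list \<Rightarrow> real \<Rightarrow> real" where
  "cf_map [] t = t"
| "cf_map (a # u) t = 1 / (real a + cf_map u t)"

definition words :: "nat \<Rightarrow> nat list set" where
  "words n = {u. length u = n \<and> (\<forall>a\<in>set u. a \<ge> 1)}"

definition pos_word :: "nat list \<Rightarrow> bool" where
  "pos_word u \<longleftrightarrow> (\<forall>a\<in>set u. a \<ge> 1)"

lemma pos_word_simps [simp]:
  "pos_word []" "pos_word (a # u) \<longleftrightarrow> a \<ge> 1 \<and> pos_word u"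
  "pos_word (u @ v) \<longleftrightarrow> pos_word u \<and> pos_word v"
  by (auto simp: pos_word_def)

lemma words_iff: "u \<in> words n \<longleftrightarrow> length u = n \<and> pos_word u"
  by (simp add: words_def pos_word_def)

lemma conv_den_pos: "pos_word u \<Longrightarrow> conv_den u \<ge> 1"
  by (induction u) (auto simp: Suc_le_eq)

lemma conv_num_le_den: "pos_word u \<Longrightarrow> conv_num u \<le> conv_den u"
  by (cases u) (auto intro: trans_le_add1)

text \<open>Numerators are carried along because the recursion of the denominators refers to them.
  At \<open>[]\<close> their inequality fails, as \<open>prev_num\<close> is 1 and
  \<open>conv_num\<close> is 0.\<close>

lemma prev_le_aux:
  "pos_word u \<Longrightarrow> u \<noteq> [] \<Longrightarrow> prev_den u \<le> conv_den u \<and> prev_num u \<le> conv_num u"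
proof (induction u)
  case (Cons a u)
  then show ?case
    by (cases u) (auto intro!: add_mono mult_le_mono)
qed simp

lemma prev_den_le: "pos_word u \<Longrightarrow> prev_den u \<le> conv_den u"
  using prev_le_aux[of u] by (cases "u = []") auto

text \<open>Determinant of the matrix product; every factor has determinant -1.\<close>

lemma conv_det:
  "int (conv_num u) * int (prev_den u) - int (prev_num u) * int (conv_den u) = - ((-1) ^ length u)"
  by (induction u) (auto simp: algebra_simps)

lemma conv_den_append:
  "conv_den (u @ v) = conv_den u * conv_den v + prev_den u * conv_num v"
  "conv_num (u @ v) = conv_num u * conv_den v + prev_num u * conv_num v"
  by (induction u) (auto simp: algebra_simps)

lemma prev_den_append:
  "prev_den (u @ v) = conv_den u * prev_den v + prev_den u * prev_num v"
  "prev_num (u @ v) = conv_num u * prev_den v + prev_num u * prev_num v"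
  by (induction u) (auto simp: algebra_simps)

lemma conv_den_append_ge: "conv_den u * conv_den v \<le> conv_den (u @ v)"
  by (simp add: conv_den_append)

text \<open>In the formula for \<open>conv_den (u @ v)\<close> the second product is at most the
  first. This 2 is the source of the error \<open>\<theta> * ln 4\<close> in the pressure
  estimates.\<close>

lemma conv_den_append_le:
  assumes "pos_word u" "pos_word v"
  shows "conv_den (u @ v) \<le> 2 * conv_den u * conv_den v"
  using mult_le_mono[OF prev_den_le[OF assms(1)] conv_num_le_den[OF assms(2)]]
  by (simp add: conv_den_append)

text \<open>Prepending two letters at least doubles the denominator, as for Fibonacci
  numbers.\<close>

lemma conv_den_ge_pow: "pos_word u \<Longrightarrow> 2 ^ (length u div 2) \<le> conv_den u"
proof (induction u rule: induct_list012)
  case (3 a b u)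
  then have IH: "2 ^ (length u div 2) \<le> conv_den u" by simp
  have "1 * (1 * conv_den u) \<le> a * (b * conv_den u)"
    using 3 by (intro mult_le_mono) auto
  moreover have "conv_den (a # b # u) = a * (b * conv_den u) + a * conv_num u + conv_den u"
    by (simp add: algebra_simps)
  ultimately have "2 * conv_den u \<le> conv_den (a # b # u)" by linarith
  then show ?case using IH by simp
qed auto

lemma conv_den_le_prod: "pos_word u \<Longrightarrow> conv_den u \<le> prod_list (map Suc u)"
proof (induction u)
  case (Cons a u)
  then have "conv_den (a # u) \<le> Suc a * conv_den u"
    using conv_num_le_den[of u] by simp
  also have "\<dots> \<le> Suc a * prod_list (map Suc u)"
    using Cons by (intro mult_le_mono) auto
  finally show ?case by simp
qed simp

lemma conv_coprime: "coprime (conv_num u) (conv_den u)"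
proof (induction u)
  case (Cons a u)
  then have "gcd (conv_den u) (a * conv_den u + conv_num u) = 1"
    by (metis add.commute coprime_commute coprime_iff_gcd_eq_1 gcd_add_mult mult.commute)
  then show ?case by (simp add: coprime_iff_gcd_eq_1)
qed simp

lemma cont_frac_conv:
  "pos_word u \<Longrightarrow> cont_frac u = of_nat (conv_num u) / of_nat (conv_den u)"
proof (induction u)
  case (Cons a u)
  then have "of_nat (conv_den u) > (0::rat)" using conv_den_pos[of u] by simp
  then have "of_nat a + of_nat (conv_num u) / of_nat (conv_den u) =
      (of_nat (conv_den (a # u)) / of_nat (conv_den u) :: rat)"
    by (simp add: field_simps)
  then show ?case using Cons by simp
qed simp

lemma cf_denom_eq: "pos_word u \<Longrightarrow> cf_denom u = int (conv_den u)"
proof -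
  assume u: "pos_word u"
  have "cont_frac u = Fract (int (conv_num u)) (int (conv_den u))"
    by (simp add: cont_frac_conv[OF u] Fract_of_int_quotient)
  moreover have "conv_den u > 0" using conv_den_pos[OF u] by simp
  ultimately show ?thesis
    by (simp add: cf_denom_def quotient_of_Fract normalize_stable conv_coprime)
qed

lemma cf_map_0: "of_rat (cont_frac u) = cf_map u 0"
  by (induction u) (auto simp: of_rat_divide of_rat_add)

lemma cf_map_append: "cf_map (u @ v) t = cf_map u (cf_map v t)"
  by (induction u) auto

lemma cf_map_nonneg: "t \<ge> 0 \<Longrightarrow> cf_map u t \<ge> 0"
  by (induction u) auto

lemma cf_map_le_1: "pos_word u \<Longrightarrow> 0 \<le> t \<Longrightarrow> t \<le> 1 \<Longrightarrow> cf_map u t \<le> 1"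
proof (cases u)
  case (Cons a v)
  moreover assume "pos_word u" "0 \<le> t"
  ultimately have "real a + cf_map v t \<ge> 1" using cf_map_nonneg[of t v] by auto
  then show ?thesis using Cons by simp
qed auto

lemma cf_map_den_pos: "pos_word u \<Longrightarrow> t \<ge> 0 \<Longrightarrow> real (conv_den u) + real (prev_den u) * t \<ge> 1"
  using conv_den_pos[of u] by (metis add_increasing2 mult_nonneg_nonneg of_nat_0_le_iff of_nat_1 of_nat_le_iff)

lemma cf_map_eq:
  assumes "pos_word u" "t \<ge> 0"
  shows "cf_map u t = (real (conv_num u) + real (prev_num u) * t) / (real (conv_den u) + real (prev_den u) * t)"
  using assms
proof (induction u)
  case (Cons a u)
  then have "real (conv_den u) + real (prev_den u) * t > 0" using cf_map_den_pos[of u t] by simp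
  then have "real a + (real (conv_num u) + real (prev_num u) * t) / (real (conv_den u) + real (prev_den u) * t)
    = (real (conv_den (a # u)) + real (prev_den (a # u)) * t) / (real (conv_den u) + real (prev_den u) * t)"
    by (simp add: field_simps)
  then show ?case using Cons by simp
qed simp

text \<open>\<open>cf_map u\<close> is a fractional linear map of determinant 1 or -1. The exact
  formula serves both the contraction in the upper bounds and the separation of points in the lower
  bounds.\<close>

lemma cf_map_diff:
  fixes s t :: real
  assumes u: "pos_word u" and "s \<ge> 0" "t \<ge> 0"
  shows "\<bar>cf_map u s - cf_map u t\<bar> = \<bar>s - t\<bar> /
    ((conv_den u + prev_den u * s) * (conv_den u + prev_den u * t))"
proof -
  define p q p' q' where "p = real (conv_num u)" "q = real (conv_den u)"
    "p' = real (prev_num u)" "q' = real (prev_den u)"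
  have "q + q' * s \<ge> 1" "q + q' * t \<ge> 1"
    using cf_map_den_pos assms by (auto simp: p_q_p'_q'_def)
  then have "cf_map u s - cf_map u t = (p * q' - p' * q) * (t - s) / ((q + q' * s) * (q + q' * t))"
    using assms by (simp add: cf_map_eq p_q_p'_q'_def[symmetric] field_simps)
  moreover have "\<bar>p * q' - p' * q\<bar> = 1"
  proof -
    have "p * q' - p' * q = of_int (- ((-1) ^ length u))"
      unfolding conv_det[symmetric] by (simp add: p_q_p'_q'_def)
    then show ?thesis by simp
  qed
  ultimately show ?thesis
    using \<open>q + q' * s \<ge> 1\<close> \<open>q + q' * t \<ge> 1\<close>
    by (simp add: abs_mult p_q_p'_q'_def[symmetric] abs_minus_commute)
qed

lemma cf_map_diff_le:
  fixes s t :: real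
  assumes u: "pos_word u" and "s \<ge> 0" "t \<ge> 0"
  shows "\<bar>cf_map u s - cf_map u t\<bar> \<le> \<bar>s - t\<bar> / (real (conv_den u))\<^sup>2"
  unfolding cf_map_diff[OF assms] power2_eq_square
  using conv_den_pos[OF u] cf_map_den_pos[OF u, of s] cf_map_den_pos[OF u, of t] assms
  by (intro divide_left_mono mult_mono mult_pos_pos) auto

section \<open>Infinite expansions: convergence, uniqueness, irrationality, existence\<close>

definition pos_seq :: "(nat \<Rightarrow> nat) \<Rightarrow> bool" where
  "pos_seq a \<longleftrightarrow> (\<forall>i. a i \<ge> 1)"

definition cf_val :: "(nat \<Rightarrow> nat) \<Rightarrow> real" where
  "cf_val a = lim (\<lambda>n. cf_map (map a [0..<n]) 0)"

abbreviation pref :: "(nat \<Rightarrow> nat) \<Rightarrow> nat \<Rightarrow> nat list" where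
  "pref a n \<equiv> map a [0..<n]"

lemma pos_word_pref: "pos_seq a \<Longrightarrow> pos_word (pref a n)"
  by (auto simp: pos_word_def pos_seq_def)

lemma pref_add: "pref a (n + k) = pref a n @ pref (\<lambda>i. a (n + i)) k"
  by (rule nth_equalityI) (auto simp: nth_append)

lemma cf_expansion_iff:
  "is_cf_expansion a x \<longleftrightarrow> pos_seq a \<and> (\<lambda>n. cf_map (pref a n) 0) \<longlonglongrightarrow> x"
  by (simp add: is_cf_expansion_def pos_seq_def cf_map_0)

lemma inverse_den_tendsto:
  assumes "pos_seq a"
  shows "(\<lambda>n. 1 / (real (conv_den (pref a n)))\<^sup>2) \<longlonglongrightarrow> 0"
proof (rule tendsto_sandwich[OF _ _ tendsto_const])
  show "\<forall>\<^sub>F n in sequentially. 0 \<le> 1 / (real (conv_den (pref a n)))\<^sup>2" by simp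
  show "\<forall>\<^sub>F n in sequentially. 1 / (real (conv_den (pref a n)))\<^sup>2 \<le> (1/2) ^ (n div 2)"
  proof (rule always_eventually, rule allI)
    fix n
    have "2 ^ (n div 2) \<le> conv_den (pref a n)"
      using conv_den_ge_pow[OF pos_word_pref[OF assms], of n] by simp
    then have d: "2 ^ (n div 2) \<le> real (conv_den (pref a n))"
      by (metis of_nat_le_iff of_nat_numeral of_nat_power)
    have "(1::real) \<le> 2 ^ (n div 2)" by simp
    then have "2 ^ (n div 2) * 1 \<le> real (conv_den (pref a n)) * real (conv_den (pref a n))"
      using d conv_den_pos[OF pos_word_pref[OF assms, of n]] by (intro mult_mono) auto
    then show "1 / (real (conv_den (pref a n)))\<^sup>2 \<le> (1/2) ^ (n div 2)"
      using conv_den_pos[OF pos_word_pref[OF assms, of n]]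
      by (simp add: power2_eq_square power_divide frac_le)
  qed
  have "(\<lambda>n. (1/2::real) ^ n) \<longlonglongrightarrow> 0" by (rule LIMSEQ_power_zero) simp
  moreover have "filterlim (\<lambda>n::nat. n div 2) at_top sequentially"
    by (rule filterlim_at_top_div_const_nat) simp
  ultimately show "(\<lambda>n. (1/2::real) ^ (n div 2)) \<longlonglongrightarrow> 0"
    by (rule filterlim_compose)
qed

text \<open>Every later convergent is the image of a point of [0, 1] under the branch of the first n
  letters, hence within q^(-2) of the n-th convergent.\<close>

lemma cf_map_pref_LIMSEQ:
  assumes "pos_seq a"
  shows "(\<lambda>n. cf_map (pref a n) 0) \<longlonglongrightarrow> cf_val a"
proof -
  have close: "dist (cf_map (pref a (n + k)) 0) (cf_map (pref a n) 0) \<le> 1 / (real (conv_den (pref a n)))\<^sup>2"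
    for n k
  proof -
    define t where "t = cf_map (pref (\<lambda>i. a (n + i)) k) 0"
    have pw: "pos_word (pref (\<lambda>i. a (n + i)) k)"
      using assms by (intro pos_word_pref) (auto simp: pos_seq_def)
    have t: "0 \<le> t" "t \<le> 1" unfolding t_def by (auto intro: cf_map_nonneg cf_map_le_1[OF pw])
    have "\<bar>cf_map (pref a n) t - cf_map (pref a n) 0\<bar> \<le> \<bar>t - 0\<bar> / (real (conv_den (pref a n)))\<^sup>2"
      using t by (intro cf_map_diff_le pos_word_pref assms) auto
    also have "\<dots> \<le> 1 / (real (conv_den (pref a n)))\<^sup>2"
      using t by (intro divide_right_mono) auto
    finally show ?thesis unfolding pref_add cf_map_append t_def[symmetric] by (simp add: dist_real_def)
  qed
  have "Cauchy (\<lambda>n. cf_map (pref a n) 0)"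
  proof (rule CauchyI)
    fix e :: real assume "e > 0"
    then have "\<forall>\<^sub>F n in sequentially. 1 / (real (conv_den (pref a n)))\<^sup>2 < e / 1"
      using order_tendstoD(2)[OF inverse_den_tendsto[OF assms]] by simp
    then obtain n where n: "\<And>m. m \<ge> n \<Longrightarrow> 1 / (real (conv_den (pref a m)))\<^sup>2 < e"
      by (auto simp: eventually_sequentially)
    show "\<exists>M. \<forall>m\<ge>M. \<forall>k\<ge>M. norm (cf_map (pref a m) 0 - cf_map (pref a k) 0) < e"
    proof (intro exI allI impI)
      fix m k assume mk: "m \<ge> n" "k \<ge> n"
      show "norm (cf_map (pref a m) 0 - cf_map (pref a k) 0) < e"
        using close[of m "k - m"] close[of k "m - k"] n[OF mk(1)] n[OF mk(2)]
        by (cases "m \<le> k") (auto simp: dist_norm norm_minus_commute)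
    qed
  qed
  then show ?thesis
    unfolding cf_val_def using Cauchy_convergent convergent_LIMSEQ_iff by blast
qed

lemma cf_expansion_eq: "is_cf_expansion a x \<longleftrightarrow> pos_seq a \<and> x = cf_val a"
  using cf_map_pref_LIMSEQ LIMSEQ_unique by (auto simp: cf_expansion_iff)

lemma cf_val_range: "pos_seq a \<Longrightarrow> 0 \<le> cf_val a \<and> cf_val a \<le> 1"
proof -
  assume a: "pos_seq a"
  have "0 \<le> cf_map (pref a n) 0" "cf_map (pref a n) 0 \<le> 1" for n
    by (auto intro!: cf_map_nonneg cf_map_le_1 pos_word_pref a)
  then show ?thesis
    using LIMSEQ_le_const[OF cf_map_pref_LIMSEQ[OF a], of 0]
      LIMSEQ_le_const2[OF cf_map_pref_LIMSEQ[OF a], of 1] by blast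
qed

lemma pos_seq_shift: "pos_seq a \<Longrightarrow> pos_seq (\<lambda>i. a (n + i))"
  by (auto simp: pos_seq_def)

text \<open>The identity \<open>cf_map_append\<close> passes to the limit, since
  \<open>cf_map\<close> is continuous in the tail: its denominator is at least 1.\<close>

lemma cf_val_split:
  assumes "pos_seq a"
  shows "cf_val a = cf_map (pref a n) (cf_val (\<lambda>i. a (n + i)))"
proof -
  note pw = pos_word_pref[OF assms, of n]
  note sh = pos_seq_shift[OF assms, of n]
  have lim: "(\<lambda>k. cf_map (pref (\<lambda>i. a (n + i)) k) 0) \<longlonglongrightarrow> cf_val (\<lambda>i. a (n + i))"
    by (rule cf_map_pref_LIMSEQ[OF sh])
  have "(\<lambda>k. (conv_num (pref a n) + prev_num (pref a n) * cf_map (pref (\<lambda>i. a (n + i)) k) 0) /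
         (conv_den (pref a n) + prev_den (pref a n) * cf_map (pref (\<lambda>i. a (n + i)) k) 0)) \<longlonglongrightarrow>
        (conv_num (pref a n) + prev_num (pref a n) * cf_val (\<lambda>i. a (n + i))) /
         (conv_den (pref a n) + prev_den (pref a n) * cf_val (\<lambda>i. a (n + i)))"
    using cf_map_den_pos[OF pw, of "cf_val (\<lambda>i. a (n + i))"] cf_val_range[OF sh]
    by (intro tendsto_intros lim) auto
  then have "(\<lambda>k. cf_map (pref a n) (cf_map (pref (\<lambda>i. a (n + i)) k) 0)) \<longlonglongrightarrow>
      cf_map (pref a n) (cf_val (\<lambda>i. a (n + i)))"
    using cf_val_range[OF sh] by (simp add: cf_map_eq[OF pw] cf_map_nonneg)
  then have "(\<lambda>k. cf_map (pref a (k + n)) 0) \<longlonglongrightarrow> cf_map (pref a n) (cf_val (\<lambda>i. a (n + i)))"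
    by (simp add: pref_add cf_map_append add.commute[of _ n])
  then have "(\<lambda>k. cf_map (pref a k) 0) \<longlonglongrightarrow> cf_map (pref a n) (cf_val (\<lambda>i. a (n + i)))"
    by (rule LIMSEQ_offset)
  then show ?thesis using cf_map_pref_LIMSEQ[OF assms] LIMSEQ_unique by blast
qed

lemma cf_val_step:
  assumes "pos_seq a"
  shows "cf_val a = 1 / (real (a 0) + cf_val (\<lambda>i. a (Suc i)))"
  using cf_val_split[OF assms, of 1] by simp

lemma cf_val_bounds:
  assumes "pos_seq a"
  shows "1 / (real (a 0) + 1) \<le> cf_val a" "cf_val a \<le> 1 / real (a 0)" "0 < cf_val a" "cf_val a < 1"
proof -
  have a0: "a i \<ge> 1" for i using assms by (simp add: pos_seq_def)
  \<comment> \<open>Proved for all sequences at once: for the shifted sequence it shows that the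
    tail is strictly positive, and this makes the value strictly less than 1.\<close>
  have lower: "1 / (real (b 0) + 1) \<le> cf_val b" if b: "pos_seq b" for b
  proof -
    have sh: "pos_seq (\<lambda>i. b (Suc i))" using pos_seq_shift[OF b, of 1] by simp
    have "b 0 \<ge> 1" using b by (simp add: pos_seq_def)
    then show ?thesis
      using cf_val_range[OF sh] by (auto simp: cf_val_step[OF b] intro!: divide_left_mono)
  qed
  show "1 / (real (a 0) + 1) \<le> cf_val a" by (rule lower[OF assms])
  have "0 < 1 / (real (a 0) + 1)" by simp
  then show "0 < cf_val a" using lower[OF assms] by linarith
  have sh: "pos_seq (\<lambda>i. a (Suc i))" using pos_seq_shift[OF assms, of 1] by simp
  have "0 < 1 / (real (a (Suc 0)) + 1)" by simp
  then have t: "0 < cf_val (\<lambda>i. a (Suc i))" using lower[OF sh] by linarith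
  then show "cf_val a \<le> 1 / real (a 0)"
    using a0[of 0] by (auto simp: cf_val_step[OF assms] intro!: divide_left_mono)
  show "cf_val a < 1"
    using a0[of 0] t by (auto simp: cf_val_step[OF assms])
qed

lemma floor_inverse_cf_val:
  assumes "pos_seq a"
  shows "\<lfloor>1 / cf_val a\<rfloor> = int (a 0)"
proof -
  have sh: "pos_seq (\<lambda>i. a (Suc i))" using pos_seq_shift[OF assms, of 1] by simp
  have "1 / cf_val a = real (a 0) + cf_val (\<lambda>i. a (Suc i))"
    by (simp add: cf_val_step[OF assms])
  then show ?thesis using cf_val_bounds[OF sh] by (simp add: floor_eq_iff)
qed

lemma cf_val_inj:
  assumes "pos_seq a" "pos_seq b" "cf_val a = cf_val b"
  shows "a = b"
proof
  fix n
  show "a n = b n" using assms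
  proof (induction n arbitrary: a b)
    case 0
    then show ?case using floor_inverse_cf_val[of a] floor_inverse_cf_val[of b] by simp
  next
    case (Suc n)
    have 0: "a 0 = b 0"
      using Suc.prems floor_inverse_cf_val[of a] floor_inverse_cf_val[of b] by simp
    have sh: "pos_seq (\<lambda>i. a (Suc i))" "pos_seq (\<lambda>i. b (Suc i))"
      using pos_seq_shift[of a 1] pos_seq_shift[of b 1] Suc.prems by simp_all
    have "1 / cf_val a = real (a 0) + cf_val (\<lambda>i. a (Suc i))"
         "1 / cf_val b = real (b 0) + cf_val (\<lambda>i. b (Suc i))"
      using Suc.prems by (simp_all add: cf_val_step[of a] cf_val_step[of b])
    then have "cf_val (\<lambda>i. a (Suc i)) = cf_val (\<lambda>i. b (Suc i))"
      using 0 Suc.prems(3) by simp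
    then show ?case using Suc.IH[OF sh] by simp
  qed
qed

lemma partial_quotient_cf_val:
  assumes "pos_seq a" "n \<ge> 1"
  shows "partial_quotient n (cf_val a) = a (n - 1)"
proof -
  have "(THE b. is_cf_expansion b (cf_val a)) = a"
    by (rule the_equality) (auto simp: cf_expansion_eq assms intro: cf_val_inj)
  then show ?thesis by (simp add: partial_quotient_def)
qed

text \<open>Infinite descent along the Euclidean algorithm: if the value is p / q, then the tail has
  denominator p < q.\<close>

lemma cf_val_irrational:
  assumes "pos_seq a"
  shows "cf_val a \<notin> \<rat>"
proof
  assume "cf_val a \<in> \<rat>"
  then obtain p q :: int where "q > 0" "cf_val a = of_int p / of_int q"
    by (metis Rats_cases' of_int_eq_iff)
  then show False using assms
  proof (induction "nat q" arbitrary: p q a rule: less_induct)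
    case less
    have sh: "pos_seq (\<lambda>i. a (Suc i))" using pos_seq_shift[OF less.prems(3), of 1] by simp
    have pos: "p > 0" and pq: "p < q"
      using cf_val_bounds[OF less.prems(3)] less.prems by (auto simp: field_simps)
    have "cf_val (\<lambda>i. a (Suc i)) = 1 / cf_val a - real (a 0)"
      by (simp add: cf_val_step[OF less.prems(3)])
    also have "\<dots> = of_int (q - int (a 0) * p) / of_int p"
    proof -
      have "1 / cf_val a = of_int q / of_int p" using less.prems by simp
      then show ?thesis using pos by (simp add: field_simps)
    qed
    finally show False
      using less.hyps[of p "\<lambda>i. a (Suc i)" "q - int (a 0) * p"] pos pq sh by simp
  qed
qed

lemma cf_val_irrationals01: "pos_seq a \<Longrightarrow> cf_val a \<in> irrationals01"
  using cf_val_bounds[of a] cf_val_irrational[of a] by (auto simp: irrationals01_def)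

lemma ex_cf_val:
  assumes "x \<in> irrationals01"
  shows "\<exists>a. pos_seq a \<and> x = cf_val a"
proof -
  \<comment> \<open>The Gauss map. It preserves irrationality, which keeps the orbit of
    \<open>x\<close> away from 0, so the expansion never stops.\<close>
  define T where "T y = 1 / y - of_int \<lfloor>1 / y\<rfloor>" for y :: real
  define y where "y n = (T ^^ n) x" for n
  define a where "a n = nat \<lfloor>1 / y n\<rfloor>" for n
  have T_irr: "T z \<in> irrationals01" if "z \<in> irrationals01" for z
  proof -
    have "z \<notin> \<rat>" using that by (simp add: irrationals01_def)
    have "1 / z \<notin> \<rat>"
    proof
      assume "1 / z \<in> \<rat>"
      then have "1 / (1 / z) \<in> \<rat>" using Rats_divide[of 1 "1 / z"] by simp
      then show False using \<open>z \<notin> \<rat>\<close> by simp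
    qed
    then have "T z \<notin> \<rat>"
      unfolding T_def by (metis Rats_add Rats_of_int diff_add_cancel)
    then show ?thesis
      unfolding irrationals01_def T_def by (auto simp: floor_less_iff) linarith
  qed
  have y: "y n \<in> irrationals01" for n
    by (induction n) (auto simp: y_def assms T_irr)
  have y01: "0 < y n" "y n < 1" for n
    using y[of n] by (auto simp: irrationals01_def less_le)
  have a: "a n \<ge> 1" for n
  proof -
    have "1 < 1 / y n" using y01[of n] by simp
    then have "\<lfloor>1 / y n\<rfloor> \<ge> 1" by linarith
    then show ?thesis unfolding a_def by linarith
  qed
  then have pa: "pos_seq a" by (simp add: pos_seq_def)
  have step: "y n = 1 / (real (a n) + y (Suc n))" for n
  proof -
    have "\<lfloor>1 / y n\<rfloor> \<ge> 0" using y01[of n] by simp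
    then have "real (a n) + y (Suc n) = 1 / y n"
      by (simp add: y_def T_def a_def)
    then show ?thesis by simp
  qed
  have x: "x = cf_map (pref a n) (y n)" for n
  proof (induction n)
    case (Suc n)
    then show ?case using step[of n] by (simp add: cf_map_append)
  qed (simp add: y_def)
  have "(\<lambda>n. cf_map (pref a n) 0 - x) \<longlonglongrightarrow> 0"
  proof (rule Lim_null_comparison[OF _ inverse_den_tendsto[OF pa]])
    show "\<forall>\<^sub>F n in sequentially. norm (cf_map (pref a n) 0 - x) \<le> 1 / (real (conv_den (pref a n)))\<^sup>2"
    proof (rule always_eventually, rule allI)
      fix n
      have "norm (cf_map (pref a n) 0 - x) \<le> \<bar>0 - y n\<bar> / (real (conv_den (pref a n)))\<^sup>2"
        using y01[of n] cf_map_diff_le[OF pos_word_pref[OF pa, of n], of 0 "y n"] x[of n] by simp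
      also have "\<dots> \<le> 1 / (real (conv_den (pref a n)))\<^sup>2"
        using y01[of n] by (intro divide_right_mono) auto
      finally show "norm (cf_map (pref a n) 0 - x) \<le> 1 / (real (conv_den (pref a n)))\<^sup>2" .
    qed
  qed
  then have "(\<lambda>n. cf_map (pref a n) 0) \<longlonglongrightarrow> x" by (simp add: LIM_zero_iff)
  then have "x = cf_val a" using cf_map_pref_LIMSEQ[OF pa] LIMSEQ_unique by blast
  then show ?thesis using pa by blast
qed

text \<open>A finite maximum reaches a bound as soon as one entry does, and the quotients with index
  1 to n are the entries with index below n. From here on, points of \<open>M_set\<close> are
  handled through their sequences.\<close>

lemma M_set_iff:
  assumes "pos_seq a"
  shows "cf_val a \<in> M_set \<psi> \<longleftrightarrow> infinite {n. n \<ge> 1 \<and> (\<exists>i<n. \<psi> (real n) \<le> real (a i))}"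
proof -
  have "\<psi> (real n) \<le> real (max_quotient n (cf_val a)) \<longleftrightarrow> (\<exists>i<n. \<psi> (real n) \<le> real (a i))"
    if n: "n \<ge> 1" for n
  proof -
    have "(\<lambda>k. partial_quotient k (cf_val a)) ` {1..n} = (\<lambda>k. a (k - 1)) ` {1..n}"
      by (intro image_cong) (auto simp: partial_quotient_cf_val assms)
    also have "\<dots> = a ` {..<n}"
    proof -
      have "(\<lambda>k. k - 1) ` {1..n} = {..<n}"
        unfolding image_Suc_lessThan[symmetric] image_image by simp
      then show ?thesis by (metis image_image)
    qed
    finally have m: "max_quotient n (cf_val a) = Max (a ` {..<n})"
      by (simp add: max_quotient_def)
    have "Max (a ` {..<n}) \<in> a ` {..<n}" using n by (intro Max_in) (auto simp: lessThan_empty_iff)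
    then obtain i where i: "i < n" "Max (a ` {..<n}) = a i" by auto
    have "a j \<le> Max (a ` {..<n})" if "j < n" for j using that by (intro Max_ge) auto
    then have "\<psi> (real n) \<le> real (a j) \<Longrightarrow> \<psi> (real n) \<le> real (Max (a ` {..<n}))" if "j < n" for j
      using that by (meson of_nat_mono order_trans)
    then show ?thesis using i m by auto
  qed
  then show ?thesis
    using cf_val_irrationals01[OF assms] unfolding M_set_def by (simp cong: conj_cong)
qed

section \<open>Hausdorff measure\<close>

lemma diam_pow_mono_exp:
  assumes "0 \<le> t" "t \<le> s" "bounded U" "diameter U \<le> 1"
  shows "diam_pow s U \<le> diam_pow t U"
proof -
  have d: "0 \<le> diameter U" using assms by (simp add: diameter_ge_0)
  consider "t = 0" "s = 0" | "t = 0" "s > 0" | "t > 0" using assms by linarith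
  then show ?thesis
  proof cases
    case 2
    have "diameter U powr s \<le> 1" using d assms 2 by (simp add: powr_le1)
    then show ?thesis using 2 by (simp add: diam_pow_def ennreal_le_1)
  next
    case 3
    then have "diameter U powr s \<le> diameter U powr t"
      using d assms by (cases "diameter U = 0") (auto intro: powr_mono')
    then show ?thesis using 3 assms by (auto simp: diam_pow_def intro: ennreal_leI)
  qed (simp add: diam_pow_def)
qed

lemma hausdorff_measure_eq_0_iff:
  "hausdorff_measure s A = 0 \<longleftrightarrow> (\<forall>\<delta>>0. hausdorff_premeasure s \<delta> A = 0)"
  by (simp only: hausdorff_measure_def bot_ennreal[symmetric] SUP_bot_conv Ball_def greaterThan_iff)

lemma hausdorff_premeasure_eq_0_iff:
  "hausdorff_premeasure s \<delta> A = 0 \<longleftrightarrow>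
   (\<forall>e>0. \<exists>U. A \<subseteq> (\<Union>i. U i) \<and> (\<forall>i. bounded (U i) \<and> diameter (U i) \<le> \<delta>) \<and> (\<Sum>i. diam_pow s (U i)) < e)"
  by (simp only: hausdorff_premeasure_def bot_ennreal[symmetric] INF_eq_bot_iff Bex_def
      mem_Collect_eq conj_assoc)

lemma hausdorff_measure_0_mono:
  assumes "0 \<le> t" "t \<le> s" "hausdorff_measure t A = 0"
  shows "hausdorff_measure s A = 0"
  unfolding hausdorff_measure_eq_0_iff hausdorff_premeasure_eq_0_iff
proof (intro allI impI)
  fix \<delta> :: real and e :: ennreal assume "\<delta> > 0" "e > 0"
  \<comment> \<open>The cap 1 on diameters makes every term of the cover decrease when the exponent
    is raised.\<close>
  then have "hausdorff_premeasure t (min \<delta> 1) A = 0"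
    using assms by (simp add: hausdorff_measure_eq_0_iff)
  from this[unfolded hausdorff_premeasure_eq_0_iff, rule_format, OF \<open>e > 0\<close>]
  obtain U where U: "A \<subseteq> (\<Union>i. U i)" "\<And>i. bounded (U i)" "\<And>i. diameter (U i) \<le> min \<delta> 1"
    "(\<Sum>i. diam_pow t (U i)) < e"
    by auto
  have "(\<Sum>i. diam_pow s (U i)) \<le> (\<Sum>i. diam_pow t (U i))"
    using U assms by (intro suminf_le diam_pow_mono_exp) auto
  then have "(\<Sum>i. diam_pow s (U i)) < e" using U(4) by (rule le_less_trans)
  then show "\<exists>U. A \<subseteq> (\<Union>i. U i) \<and> (\<forall>i. bounded (U i) \<and> diameter (U i) \<le> \<delta>) \<and> (\<Sum>i. diam_pow s (U i)) < e"
    using U by (intro exI[of _ U]) auto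
qed

lemma hausdorff_dim_leI:
  assumes "s \<ge> 0" "hausdorff_measure s A = 0"
  shows "hausdorff_dim A \<le> ereal s"
  unfolding hausdorff_dim_def by (rule Inf_lower) (use assms in auto)

lemma hausdorff_dim_geI:
  assumes "hausdorff_measure s A \<noteq> 0"
  shows "ereal s \<le> hausdorff_dim A"
  unfolding hausdorff_dim_def
proof (rule Inf_greatest, safe)
  fix t :: real assume "t \<ge> 0" "hausdorff_measure t A = 0"
  then show "ereal s \<le> ereal t"
    using hausdorff_measure_0_mono[of t s A] assms by (cases "t \<le> s") auto
qed

lemma hausdorff_dim_nonneg: "0 \<le> hausdorff_dim A"
  unfolding hausdorff_dim_def by (rule Inf_greatest) auto

text \<open>Borel-Cantelli for covers: a point in infinitely many \<open>U i\<close> is covered by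
  each tail of the family, and the tails of a convergent series are small.\<close>

lemma hausdorff_cantelli:
  fixes U :: "nat \<Rightarrow> 'a::metric_space set"
  assumes s: "s > 0" and bdd: "\<And>i. bounded (U i)"
    and f: "\<And>i. diameter (U i) powr s \<le> f i" "summable f"
    and A: "\<And>x. x \<in> A \<Longrightarrow> infinite {i. x \<in> U i}"
  shows "hausdorff_measure s A = 0"
  unfolding hausdorff_measure_eq_0_iff hausdorff_premeasure_eq_0_iff
proof (intro allI impI)
  fix \<delta> :: real and e :: ennreal assume \<delta>: "\<delta> > 0" and e: "e > 0"
  obtain \<epsilon> where \<epsilon>: "\<epsilon> > 0" "ennreal \<epsilon> < e"
  proof -
    obtain z where z: "0 < z" "z < e" using dense e by blast
    then have "z < top" by (meson order_less_le_trans top_greatest)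
    then obtain r where "z = ennreal r" "r \<ge> 0" by (cases z) auto
    then show ?thesis using z that[of r] by simp
  qed
  have f0: "f i \<ge> 0" for i using f(1)[of i] by (rule order_trans[rotated]) simp
  \<comment> \<open>Since \<open>s > 0\<close>, small terms \<open>f n\<close> force small
    diameters, so late sets respect the bound \<delta>.\<close>
  have ev1: "\<forall>\<^sub>F n in sequentially. f n < \<delta> powr s"
    using order_tendstoD(2)[OF summable_LIMSEQ_zero[OF f(2)], of "\<delta> powr s"] \<delta> by simp
  have "(\<lambda>n. \<Sum>i. f (i + n)) \<longlonglongrightarrow> 0" by (rule suminf_exist_split2[OF f(2)])
  then have ev2: "\<forall>\<^sub>F n in sequentially. (\<Sum>i. f (i + n)) < \<epsilon>"
    using order_tendstoD(2) \<epsilon> by blast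
  obtain N1 where N1: "\<And>n. n \<ge> N1 \<Longrightarrow> f n < \<delta> powr s"
    using ev1 by (auto simp: eventually_sequentially)
  obtain N2 where N2: "\<And>n. n \<ge> N2 \<Longrightarrow> (\<Sum>i. f (i + n)) < \<epsilon>"
    using ev2 by (auto simp: eventually_sequentially)
  define N where "N = max N1 N2"
  define V where "V i = U (i + N)" for i
  show "\<exists>V. A \<subseteq> (\<Union>i. V i) \<and> (\<forall>i. bounded (V i) \<and> diameter (V i) \<le> \<delta>) \<and> (\<Sum>i. diam_pow s (V i)) < e"
  proof (intro exI[of _ V] conjI allI)
    show "A \<subseteq> (\<Union>i. V i)"
    proof
      fix x assume "x \<in> A"
      then obtain i where "i \<ge> N" "x \<in> U i"
        using A[of x] unfolding infinite_nat_iff_unbounded_le by blast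
      then show "x \<in> (\<Union>i. V i)" unfolding V_def by (auto intro!: exI[of _ "i - N"])
    qed
    show "bounded (V i)" for i by (simp add: V_def bdd)
    show "diameter (V i) \<le> \<delta>" for i
    proof (rule ccontr)
      assume "\<not> ?thesis"
      then have "\<delta> powr s \<le> diameter (V i) powr s" using \<delta> s by (intro powr_mono2) auto
      also have "\<dots> \<le> f (i + N)" by (simp add: V_def f)
      also have "\<dots> < \<delta> powr s" by (rule N1) (simp add: N_def)
      finally show False by simp
    qed
    have "(\<Sum>i. diam_pow s (V i)) \<le> (\<Sum>i. ennreal (f (i + N)))"
      using s f by (intro suminf_le) (auto simp: diam_pow_def V_def intro: ennreal_leI)
    also have "\<dots> = ennreal (\<Sum>i. f (i + N))"
      using f(2) f0 by (intro suminf_ennreal2) (auto simp: summable_iff_shift)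
    also have "\<dots> \<le> ennreal \<epsilon>" using N2[of N] by (intro ennreal_leI) (simp add: N_def)
    finally show "(\<Sum>i. diam_pow s (V i)) < e" using \<epsilon>(2) by (rule le_less_trans)
  qed
qed

lemma hausdorff_cantelli_countable:
  fixes U :: "'i \<Rightarrow> 'a::metric_space set"
  assumes "countable I" "infinite I" and s: "s > 0" and bdd: "\<And>i. i \<in> I \<Longrightarrow> bounded (U i)"
    and f: "\<And>i. i \<in> I \<Longrightarrow> diameter (U i) powr s \<le> f i" "f summable_on I"
    and A: "\<And>x. x \<in> A \<Longrightarrow> infinite {i \<in> I. x \<in> U i}"
  shows "hausdorff_measure s A = 0"
proof (rule hausdorff_cantelli[OF s, of "\<lambda>n. U (from_nat_into I n)" "\<lambda>n. f (from_nat_into I n)"])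
  note bij = bij_betw_from_nat_into[OF assms(1,2)]
  have in_I: "from_nat_into I n \<in> I" for n using bij by (auto simp: bij_betw_def)
  show "bounded (U (from_nat_into I n))" "diameter (U (from_nat_into I n)) powr s \<le> f (from_nat_into I n)" for n
    by (auto intro: bdd f in_I)
  have "(\<lambda>n. f (from_nat_into I n)) summable_on UNIV"
    using f(2) summable_on_reindex_bij_betw[OF bij, of f] by simp
  then show "summable (\<lambda>n. f (from_nat_into I n))" by (rule summable_on_imp_summable)
  fix x assume "x \<in> A"
  then have "infinite {i \<in> I. x \<in> U i}" by (rule A)
  moreover have "{i \<in> I. x \<in> U i} \<subseteq> from_nat_into I ` {n. x \<in> U (from_nat_into I n)}"
    using bij by (force simp: bij_betw_def)
  ultimately show "infinite {n. x \<in> U (from_nat_into I n)}"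
    using finite_surj by blast
qed

text \<open>Covering by n intervals of length 1 / n costs n^(1 - s).\<close>

lemma hausdorff_measure_unit_interval:
  assumes "s > 1" "A \<subseteq> {0..1::real}"
  shows "hausdorff_measure s A = 0"
  unfolding hausdorff_measure_eq_0_iff hausdorff_premeasure_eq_0_iff
proof (intro allI impI)
  fix \<delta> :: real and e :: ennreal assume \<delta>: "\<delta> > 0" and e: "e > 0"
  have "(\<lambda>n. real n powr (1 - s)) \<longlonglongrightarrow> 0"
    using assms by (intro tendsto_neg_powr filterlim_real_sequentially) auto
  then have "(\<lambda>n. ennreal (real n powr (1 - s))) \<longlonglongrightarrow> ennreal 0" by (rule tendsto_ennrealI)
  then have "\<forall>\<^sub>F n in sequentially. ennreal (real n powr (1 - s)) < e"
    by (rule order_tendstoD(2)) (simp add: e)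
  moreover have "\<forall>\<^sub>F n in sequentially. 1 / real n < \<delta>"
    using order_tendstoD(2)[OF lim_1_over_n \<delta>] .
  ultimately have "\<forall>\<^sub>F n in sequentially. ennreal (real n powr (1 - s)) < e \<and> 1 / real n < \<delta> \<and> n > 0"
    using eventually_gt_at_top[of 0] by eventually_elim auto
  then obtain n where n: "ennreal (real n powr (1 - s)) < e" "1 / real n < \<delta>" "n > 0"
    using eventually_happens'[OF sequentially_bot] by blast
  define U where "U i = (if i < n then {real i / real n..(real i + 1) / real n} else {})" for i
  have diam: "diameter (U i) = (if i < n then 1 / real n else 0)" for i
  proof -
    have "real i / real n \<le> (real i + 1) / real n" by (intro divide_right_mono) auto
    then show ?thesis
      by (simp add: U_def diameter_closed_interval diff_divide_distrib[symmetric])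
  qed
  show "\<exists>U. A \<subseteq> (\<Union>i. U i) \<and> (\<forall>i. bounded (U i) \<and> diameter (U i) \<le> \<delta>) \<and> (\<Sum>i. diam_pow s (U i)) < e"
  proof (intro exI[of _ U] conjI allI)
    show "A \<subseteq> (\<Union>i. U i)"
    proof
      fix x assume "x \<in> A"
      then have x: "0 \<le> x" "x \<le> 1" using assms by auto
      \<comment> \<open>The minimum matters only at \<open>x = 1\<close>, where the floor equals
        \<open>n\<close>.\<close>
      define i where "i = min (nat \<lfloor>x * real n\<rfloor>) (n - 1)"
      have "x \<in> U i"
      proof (cases "x = 1")
        case True
        then have "i = n - 1" using n by (simp add: i_def)
        then show ?thesis using n True by (simp add: U_def of_nat_diff)
      next
        case False
        then have "x * real n < real n" "0 \<le> x * real n" using x n by auto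
        then have "\<lfloor>x * real n\<rfloor> < int n" "\<lfloor>x * real n\<rfloor> \<ge> 0" by (auto simp: floor_less_iff)
        then have "i = nat \<lfloor>x * real n\<rfloor>" "i < n" "real i = of_int \<lfloor>x * real n\<rfloor>"
          using n unfolding i_def by auto
        moreover have "real i \<le> x * real n" "x * real n \<le> real i + 1"
          using \<open>real i = _\<close> by linarith+
        ultimately show ?thesis using n by (simp add: U_def pos_divide_le_eq pos_le_divide_eq)
      qed
      then show "x \<in> (\<Union>i. U i)" by blast
    qed
    show "bounded (U i)" for i by (simp add: U_def)
    show "diameter (U i) \<le> \<delta>" for i using diam[of i] n \<delta> by auto
    have "(\<Sum>i. diam_pow s (U i)) = (\<Sum>i<n. diam_pow s (U i))"
      by (rule suminf_finite) (auto simp: U_def diam_pow_def)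
    also have "\<dots> \<le> (\<Sum>i<n. ennreal ((1 / real n) powr s))"
      using assms diam by (intro sum_mono) (auto simp: diam_pow_def)
    also have "\<dots> = ennreal (real n * (1 / real n) powr s)"
      by (simp add: ennreal_mult'' mult.commute ennreal_mult flip: ennreal_of_nat_eq_real_of_nat)
    also have "real n * (1 / real n) powr s = real n powr (1 - s)"
      using n by (simp add: powr_diff powr_divide)
    also have "ennreal \<dots> < e" by (rule n)
    finally show "(\<Sum>i. diam_pow s (U i)) < e" .
  qed
qed

section \<open>The pressure function\<close>

lemma summable_on_le_real:
  fixes f g :: "'a \<Rightarrow> real"
  assumes "g summable_on A" "\<And>x. x \<in> A \<Longrightarrow> 0 \<le> f x" "\<And>x. x \<in> A \<Longrightarrow> f x \<le> g x"
  shows "f summable_on A"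
proof -
  have "(\<lambda>x. norm (g x)) summable_on A"
    using assms(1) by (rule summable_on_iff_abs_summable_on_real[THEN iffD1])
  then have "(\<lambda>x. norm (f x)) summable_on A"
  proof (rule Infinite_Sum.abs_summable_on_comparison_test)
    fix x assume "x \<in> A"
    then show "norm (f x) \<le> norm (g x)" using assms(2)[of x] assms(3)[of x] by simp
  qed
  then show ?thesis by (rule summable_on_iff_abs_summable_on_real[THEN iffD2])
qed

lemma has_sum_product_nonneg:
  fixes f :: "'a \<Rightarrow> real" and g :: "'b \<Rightarrow> real"
  assumes f: "(f has_sum a) A" "\<And>x. x \<in> A \<Longrightarrow> f x \<ge> 0"
    and g: "(g has_sum b) B" "\<And>x. x \<in> B \<Longrightarrow> g x \<ge> 0"
  shows "((\<lambda>(x, y). f x * g y) has_sum (a * b)) (A \<times> B)"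
proof (rule has_sum_SigmaI)
  show inner: "((\<lambda>y. (\<lambda>(x, y). f x * g y) (x, y)) has_sum f x * b) B" for x
    using has_sum_cmult_right[OF g(1)] by simp
  show "((\<lambda>x. f x * b) has_sum a * b) A"
    by (rule has_sum_cmult_left[OF f(1)])
  then have "(\<lambda>x. f x * b) summable_on A" by (rule has_sum_imp_summable)
  then show "(\<lambda>(x, y). f x * g y) summable_on A \<times> B"
    by (rule summable_on_SigmaI[OF inner]) (use f g in auto)
qed

lemma bij_betw_words_append:
  "bij_betw (\<lambda>(u, v). u @ v) (words n \<times> words m) (words (n + m))"
proof (rule bij_betw_byWitness[where f' = "\<lambda>w. (take n w, drop n w)"])
  show "(\<lambda>w. (take n w, drop n w)) ` words (n + m) \<subseteq> words n \<times> words m"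
    by (auto simp: words_def dest: in_set_takeD in_set_dropD)
qed (auto simp: words_def)

lemma bij_betw_words_1: "bij_betw (\<lambda>a. [a]) {1..} (words 1)"
  by (auto simp: bij_betw_def inj_on_def words_def length_Suc_conv image_iff)

lemma bij_betw_words_snoc: "bij_betw (\<lambda>(u, a). u @ [a]) (words n \<times> {1..}) (words (Suc n))"
proof (rule bij_betw_byWitness[where f' = "\<lambda>w. (butlast w, last w)"])
  show "(\<lambda>w. (butlast w, last w)) ` words (Suc n) \<subseteq> words n \<times> {1..}"
    by (auto simp: words_def dest: in_set_butlastD) (metis last_in_set length_0_conv nat.distinct(1))
  show "\<forall>w\<in>words (Suc n). (\<lambda>(u, a). u @ [a]) (butlast w, last w) = w"
    by (auto simp: words_def) (metis append_butlast_last_id length_0_conv nat.distinct(1))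
qed (auto simp: words_def)

definition part_fun :: "nat \<Rightarrow> real \<Rightarrow> real" where
  "part_fun n \<theta> = (\<Sum>\<^sub>\<infinity>u\<in>words n. real (conv_den u) powr (- 2 * \<theta>))"

lemma part_term_append:
  assumes "pos_word u" "pos_word v" "\<theta> > 0"
  shows "real (conv_den (u @ v)) powr (- 2 * \<theta>)
      \<le> real (conv_den u) powr (- 2 * \<theta>) * real (conv_den v) powr (- 2 * \<theta>)"
    and "4 powr (- \<theta>) * (real (conv_den u) powr (- 2 * \<theta>) * real (conv_den v) powr (- 2 * \<theta>))
      \<le> real (conv_den (u @ v)) powr (- 2 * \<theta>)"
proof -
  have pos: "real (conv_den u) > 0" "real (conv_den v) > 0" "real (conv_den (u @ v)) > 0"
    using conv_den_pos[of u] conv_den_pos[of v] conv_den_pos[of "u @ v"] assms by (auto simp: Suc_le_eq)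
  have "real (conv_den u) * real (conv_den v) \<le> real (conv_den (u @ v))"
    using conv_den_append_ge[of u v] by (metis of_nat_le_iff of_nat_mult)
  then have "real (conv_den (u @ v)) powr (- 2 * \<theta>) \<le> (real (conv_den u) * real (conv_den v)) powr (- 2 * \<theta>)"
    using pos assms by (intro powr_mono2') auto
  then show "real (conv_den (u @ v)) powr (- 2 * \<theta>)
      \<le> real (conv_den u) powr (- 2 * \<theta>) * real (conv_den v) powr (- 2 * \<theta>)"
    by (simp add: powr_mult)
  have "real (conv_den (u @ v)) \<le> 2 * (real (conv_den u) * real (conv_den v))"
    using conv_den_append_le[OF assms(1,2)]
    by (metis mult.assoc of_nat_le_iff of_nat_mult of_nat_numeral)
  then have "(2 * (real (conv_den u) * real (conv_den v))) powr (- 2 * \<theta>)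
      \<le> real (conv_den (u @ v)) powr (- 2 * \<theta>)"
    using pos assms by (intro powr_mono2') auto
  moreover have "(2::real) powr (- 2 * \<theta>) = 4 powr (- \<theta>)"
    using powr_powr[of "2::real" 2 "- \<theta>"] by simp
  ultimately show "4 powr (- \<theta>) * (real (conv_den u) powr (- 2 * \<theta>) * real (conv_den v) powr (- 2 * \<theta>))
      \<le> real (conv_den (u @ v)) powr (- 2 * \<theta>)"
    by (simp add: powr_mult)
qed

text \<open>Submultiplicativity reduces this to words of one letter, where the sum is that of
  n^(-2\<theta>).\<close>

lemma part_fun_summable:
  assumes "\<theta> > 1/2"
  shows "(\<lambda>u. real (conv_den u) powr (- 2 * \<theta>)) summable_on words n"
proof (induction n)
  case 0
  have "words 0 = {[]}" by (auto simp: words_def)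
  then show ?case by simp
next
  case (Suc n)
  have "summable (\<lambda>n. real n powr (- 2 * \<theta>))"
    using assms by (simp add: summable_real_powr_iff)
  then have "(\<lambda>n. real n powr (- 2 * \<theta>)) summable_on UNIV"
    by (intro norm_summable_imp_summable_on) simp
  then have "(\<lambda>n. real n powr (- 2 * \<theta>)) summable_on {1..}"
    by (rule summable_on_subset_banach) simp
  then have "(\<lambda>a. real (conv_den [a]) powr (- 2 * \<theta>)) summable_on {1..}"
    by simp
  then have 1: "(\<lambda>u. real (conv_den u) powr (- 2 * \<theta>)) summable_on words 1"
    using summable_on_reindex_bij_betw[OF bij_betw_words_1, of "\<lambda>u. real (conv_den u) powr (- 2 * \<theta>)"]
    by simp
  have "(\<lambda>(u, v). real (conv_den u) powr (- 2 * \<theta>) * real (conv_den v) powr (- 2 * \<theta>))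
     summable_on (words n \<times> words 1)"
    by (rule has_sum_imp_summable, rule has_sum_product_nonneg; (rule has_sum_infsum)?)
       (use Suc 1 in auto)
  then have "(\<lambda>p. real (conv_den (case p of (u, v) \<Rightarrow> u @ v)) powr (- 2 * \<theta>)) summable_on (words n \<times> words 1)"
    by (rule summable_on_le_real) (use assms part_term_append(1) in \<open>auto simp: words_iff\<close>)
  then show ?case
    using summable_on_reindex_bij_betw[OF bij_betw_words_append[of n 1],
      of "\<lambda>u. real (conv_den u) powr (- 2 * \<theta>)"]
    by simp
qed

lemma part_fun_has_sum:
  "\<theta> > 1/2 \<Longrightarrow> ((\<lambda>u. real (conv_den u) powr (- 2 * \<theta>)) has_sum part_fun n \<theta>) (words n)"
  unfolding part_fun_def by (rule has_sum_infsum[OF part_fun_summable])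

lemma part_fun_ge_finite:
  assumes "\<theta> > 1/2" "finite F" "F \<subseteq> words n"
  shows "(\<Sum>u\<in>F. real (conv_den u) powr (- 2 * \<theta>)) \<le> part_fun n \<theta>"
  unfolding part_fun_def by (rule finite_sum_le_infsum) (use assms part_fun_summable in auto)

lemma part_fun_pos:
  assumes "\<theta> > 1/2"
  shows "part_fun n \<theta> > 0"
proof -
  have u: "replicate n 1 \<in> words n" by (auto simp: words_def)
  then have "conv_den (replicate n 1) \<ge> 1" by (intro conv_den_pos) (simp add: words_iff)
  then have "0 < real (conv_den (replicate n 1)) powr (- 2 * \<theta>)" by simp
  also have "\<dots> \<le> part_fun n \<theta>"
    using part_fun_ge_finite[OF assms, of "{replicate n 1}" n] u by simp
  finally show ?thesis .
qed

lemma part_fun_add: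
  assumes "\<theta> > 1/2"
  shows "part_fun (n + m) \<theta> \<le> part_fun n \<theta> * part_fun m \<theta>"
    and "4 powr (- \<theta>) * (part_fun n \<theta> * part_fun m \<theta>) \<le> part_fun (n + m) \<theta>"
proof -
  have prod: "((\<lambda>(u, v). real (conv_den u) powr (- 2 * \<theta>) * real (conv_den v) powr (- 2 * \<theta>))
     has_sum (part_fun n \<theta> * part_fun m \<theta>)) (words n \<times> words m)"
    by (rule has_sum_product_nonneg) (use part_fun_has_sum[OF assms] in auto)
  have app: "((\<lambda>p. real (conv_den (case p of (u, v) \<Rightarrow> u @ v)) powr (- 2 * \<theta>)) has_sum part_fun (n + m) \<theta>)
      (words n \<times> words m)"
    using has_sum_reindex_bij_betw[OF bij_betw_words_append[of n m],
        of "\<lambda>u. real (conv_den u) powr (- 2 * \<theta>)"]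
      part_fun_has_sum[OF assms, of "n + m"] by simp
  show "part_fun (n + m) \<theta> \<le> part_fun n \<theta> * part_fun m \<theta>"
    by (rule has_sum_mono[OF app prod]) (use assms part_term_append(1) in \<open>auto simp: words_iff\<close>)
  show "4 powr (- \<theta>) * (part_fun n \<theta> * part_fun m \<theta>) \<le> part_fun (n + m) \<theta>"
    by (rule has_sum_mono[OF has_sum_cmult_right[OF prod] app])
       (use assms part_term_append(2) in \<open>auto simp: words_iff\<close>)
qed

text \<open>Crude, but sufficient next to factors that decay doubly exponentially in
  \<open>n\<close>.\<close>

lemma part_fun_le_power:
  assumes "\<theta> > 1/2"
  shows "part_fun n \<theta> \<le> part_fun 1 \<theta> ^ n"
proof (induction n)
  case 0
  have "words 0 = {[]}" by (auto simp: words_def)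
  then show ?case by (simp add: part_fun_def)
next
  case (Suc n)
  have "part_fun (Suc n) \<theta> \<le> part_fun n \<theta> * part_fun 1 \<theta>"
    using part_fun_add(1)[OF assms, of n 1] by simp
  also have "\<dots> \<le> part_fun 1 \<theta> ^ n * part_fun 1 \<theta>"
    using Suc part_fun_pos[OF assms, of 1] by (intro mult_right_mono) auto
  finally show ?case by (simp add: mult.commute)
qed

text \<open>Comparing \<open>z (n * m)\<close> with both \<open>n * z m\<close> and
  \<open>m * z n\<close> shows that the averages at \<open>n\<close> and \<open>m\<close> differ by
  at most c / m + c / n. They are therefore Cauchy, and letting one index grow gives the
  rate.\<close>

lemma almost_additive_limit:
  fixes z :: "nat \<Rightarrow> real"
  assumes add: "\<And>n m. \<bar>z (n + m) - (z n + z m)\<bar> \<le> c"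
  obtains L where "(\<lambda>n. z n / real n) \<longlonglongrightarrow> L" "\<And>n. n \<ge> 1 \<Longrightarrow> \<bar>L - z n / real n\<bar> \<le> c / real n"
proof -
  have c: "c \<ge> 0" using add[of 0 0] by linarith
  have mult: "\<bar>z (Suc k * m) - real (Suc k) * z m\<bar> \<le> real k * c" for k m
  proof (induction k)
    case (Suc k)
    have "z (Suc (Suc k) * m) - real (Suc (Suc k)) * z m =
        (z (Suc k * m + m) - (z (Suc k * m) + z m)) + (z (Suc k * m) - real (Suc k) * z m)"
      by (simp add: algebra_simps)
    also have "\<bar>\<dots>\<bar> \<le> c + real k * c"
      using add[of "Suc k * m" m] Suc.IH by linarith
    finally show ?case by (simp add: algebra_simps)
  qed simp
  have one: "\<bar>z (n * m) / real (n * m) - z m / real m\<bar> \<le> c / real m" if "n \<ge> 1" "m \<ge> 1" for n m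
  proof -
    have "\<bar>z (n * m) - real n * z m\<bar> \<le> real n * c"
    proof (cases n)
      case (Suc k)
      then show ?thesis using mult[of k m] c by (simp add: algebra_simps)
    qed (use that in simp)
    then have "\<bar>z (n * m) - real n * z m\<bar> / real (n * m) \<le> real n * c / real (n * m)"
      by (rule divide_right_mono) simp
    moreover have "\<bar>z (n * m) - real n * z m\<bar> / real (n * m) = \<bar>z (n * m) / real (n * m) - z m / real m\<bar>"
    proof -
      have "z (n * m) / real (n * m) - z m / real m = (z (n * m) - real n * z m) / real (n * m)"
        using that by (simp add: field_simps)
      then show ?thesis by (simp add: abs_divide)
    qed
    ultimately show ?thesis using that by simp
  qed
  have two: "\<bar>z n / real n - z m / real m\<bar> \<le> c / real m + c / real n" if "n \<ge> 1" "m \<ge> 1" for n m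
    using one[OF that] one[OF that(2) that(1)]
      abs_triangle_ineq4[of "z (n * m) / real (n * m) - z m / real m" "z (n * m) / real (n * m) - z n / real n"]
    by (simp add: mult.commute[of m n] abs_minus_commute)
  have "Cauchy (\<lambda>n. z n / real n)"
  proof (rule CauchyI)
    fix e :: real assume "e > 0"
    have "(\<lambda>n. c / real n) \<longlonglongrightarrow> 0" by (rule lim_const_over_n)
    then have "\<forall>\<^sub>F n in sequentially. c / real n < e / 2"
      using \<open>e > 0\<close> by (intro order_tendstoD(2)) auto
    then have "\<forall>\<^sub>F n in sequentially. c / real n < e / 2 \<and> n \<ge> 1"
      using eventually_ge_at_top[of 1] by (rule eventually_conj)
    then obtain M where M: "\<And>n. n \<ge> M \<Longrightarrow> c / real n < e / 2 \<and> n \<ge> 1"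
      by (auto simp: eventually_sequentially)
    show "\<exists>M. \<forall>m\<ge>M. \<forall>n\<ge>M. norm (z m / real m - z n / real n) < e"
    proof (intro exI allI impI)
      fix m n assume "m \<ge> M" "n \<ge> M"
      then have m: "c / real m < e / 2 \<and> m \<ge> 1" and n: "c / real n < e / 2 \<and> n \<ge> 1"
        using M by blast+
      have "\<bar>z m / real m - z n / real n\<bar> \<le> c / real n + c / real m"
        using m n two by blast
      also have "\<dots> < e / 2 + e / 2" using m n by (intro add_strict_mono) auto
      finally show "norm (z m / real m - z n / real n) < e" by simp
    qed
  qed
  then obtain L where L: "(\<lambda>n. z n / real n) \<longlonglongrightarrow> L"
    using Cauchy_convergent_iff convergent_def by blast
  have "\<bar>L - z n / real n\<bar> \<le> c / real n" if "n \<ge> 1" for n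
  proof (rule LIMSEQ_le)
    show "(\<lambda>m. \<bar>z m / real m - z n / real n\<bar>) \<longlonglongrightarrow> \<bar>L - z n / real n\<bar>"
      by (intro tendsto_intros L)
    have "(\<lambda>m. c / real n + c / real m) \<longlonglongrightarrow> c / real n + 0"
      by (intro tendsto_intros lim_const_over_n)
    then show "(\<lambda>m. c / real n + c / real m) \<longlonglongrightarrow> c / real n" by simp
    show "\<exists>N. \<forall>m\<ge>N. \<bar>z m / real m - z n / real n\<bar> \<le> c / real n + c / real m"
      using two that by blast
  qed
  then show ?thesis using that[OF L] by blast
qed

lemma ln_part_fun_almost_additive:
  assumes "\<theta> > 1/2"
  shows "\<bar>ln (part_fun (n + m) \<theta>) - (ln (part_fun n \<theta>) + ln (part_fun m \<theta>))\<bar> \<le> \<theta> * ln 4"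
proof -
  note pos = part_fun_pos[OF assms]
  have "ln (part_fun (n + m) \<theta>) \<le> ln (part_fun n \<theta> * part_fun m \<theta>)"
    using part_fun_add(1)[OF assms] pos by simp
  moreover have "ln (4 powr (- \<theta>) * (part_fun n \<theta> * part_fun m \<theta>)) \<le> ln (part_fun (n + m) \<theta>)"
    using part_fun_add(2)[OF assms] pos by simp
  moreover have "0 \<le> \<theta> * ln 4" using assms by simp
  ultimately show ?thesis
    using pos[of n] pos[of m] pos[of "n + m"] by (simp add: ln_mult ln_powr)
qed

lemma pressure_eq_lim:
  "pressure \<theta> = lim (\<lambda>n. ln (part_fun n \<theta>) / real n)"
proof -
  have "(\<Sum>\<^sub>\<infinity>as\<in>{as :: nat list. length as = n \<and> (\<forall>a\<in>set as. a \<ge> 1)}.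
      real_of_int (cf_denom as) powr (-2 * \<theta>)) = part_fun n \<theta>" for n
    unfolding part_fun_def words_def[symmetric]
    by (rule infsum_cong) (simp add: cf_denom_eq words_iff)
  then show ?thesis by (simp add: pressure_def)
qed

lemma
  assumes "\<theta> > 1/2"
  shows pressure_LIMSEQ: "(\<lambda>n. ln (part_fun n \<theta>) / real n) \<longlonglongrightarrow> pressure \<theta>"
    and pressure_approx: "n \<ge> 1 \<Longrightarrow> \<bar>pressure \<theta> - ln (part_fun n \<theta>) / real n\<bar> \<le> \<theta> * ln 4 / real n"
proof -
  obtain L where L: "(\<lambda>n. ln (part_fun n \<theta>) / real n) \<longlonglongrightarrow> L"
      "\<And>n. n \<ge> 1 \<Longrightarrow> \<bar>L - ln (part_fun n \<theta>) / real n\<bar> \<le> \<theta> * ln 4 / real n"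
    using almost_additive_limit[OF ln_part_fun_almost_additive[OF assms]] by blast
  have "pressure \<theta> = L" unfolding pressure_eq_lim by (rule limI[OF L(1)])
  then show "(\<lambda>n. ln (part_fun n \<theta>) / real n) \<longlonglongrightarrow> pressure \<theta>"
    "n \<ge> 1 \<Longrightarrow> \<bar>pressure \<theta> - ln (part_fun n \<theta>) / real n\<bar> \<le> \<theta> * ln 4 / real n"
    using L by auto
qed

lemma part_fun_antimono:
  assumes "\<theta> > 1/2" "\<theta> \<le> \<theta>'"
  shows "part_fun n \<theta>' \<le> part_fun n \<theta>"
proof (rule has_sum_mono[OF part_fun_has_sum part_fun_has_sum])
  fix u assume "u \<in> words n"
  then have "1 \<le> real (conv_den u)" using conv_den_pos[of u] by (simp add: words_iff)
  then show "real (conv_den u) powr (- 2 * \<theta>') \<le> real (conv_den u) powr (- 2 * \<theta>)"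
    using assms by (intro powr_mono) auto
qed (use assms in auto)

lemma pressure_antimono:
  assumes "\<theta> > 1/2" "\<theta> \<le> \<theta>'"
  shows "pressure \<theta>' \<le> pressure \<theta>"
proof (rule LIMSEQ_le[OF pressure_LIMSEQ pressure_LIMSEQ])
  have "ln (part_fun n \<theta>') / real n \<le> ln (part_fun n \<theta>) / real n" for n
    using part_fun_antimono[OF assms, of n] part_fun_pos[of \<theta>' n] assms
    by (intro divide_right_mono) auto
  then show "\<exists>N. \<forall>n\<ge>N. ln (part_fun n \<theta>') / real n \<le> ln (part_fun n \<theta>) / real n" by blast
qed (use assms in auto)

text \<open>Hoelder's inequality, by weighted arithmetic-geometric means of the normalised summands.\<close>

lemma ln_part_fun_convex:
  assumes xy: "x > 1/2" "y > 1/2" and ab: "a \<ge> 0" "b \<ge> 0" "a + b = 1"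
  shows "ln (part_fun n (a * x + b * y)) \<le> a * ln (part_fun n x) + b * ln (part_fun n y)"
proof -
  define X Y where "X = part_fun n x" "Y = part_fun n y"
  have pos: "X > 0" "Y > 0" using xy by (auto simp: X_Y_def part_fun_pos)
  have m: "a * x + b * y > 1/2"
  proof -
    have "a * x + b * y \<ge> a * min x y + b * min x y"
      using ab by (intro add_mono mult_left_mono) auto
    also have "a * min x y + b * min x y = min x y" using ab by (simp add: distrib_right[symmetric])
    finally show ?thesis using xy by linarith
  qed
  have "part_fun n (a * x + b * y) \<le> X powr a * Y powr b * (a * (X / X) + b * (Y / Y))"
  proof (rule has_sum_mono[OF part_fun_has_sum[OF m]])
    show "((\<lambda>u. X powr a * Y powr b * (a * (real (conv_den u) powr (- 2 * x) / X) +
        b * (real (conv_den u) powr (- 2 * y) / Y))) has_sum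
        (X powr a * Y powr b * (a * (X / X) + b * (Y / Y)))) (words n)"
      unfolding divide_inverse
      using part_fun_has_sum[OF xy(1), of n] part_fun_has_sum[OF xy(2), of n]
      by (intro has_sum_cmult_right has_sum_add has_sum_cmult_left) (simp_all add: X_Y_def)
    fix u assume u: "u \<in> words n"
    then have q: "real (conv_den u) > 0" using conv_den_pos[of u] by (simp add: words_iff)
    define p r where "p = real (conv_den u) powr (- 2 * x) / X" "r = real (conv_den u) powr (- 2 * y) / Y"
    have pr: "p > 0" "r > 0" using q pos by (auto simp: p_r_def)
    have "real (conv_den u) powr (- 2 * (a * x + b * y)) = (X * p) powr a * (Y * r) powr b"
      using q pos by (simp add: p_r_def powr_powr powr_add[symmetric] algebra_simps)
    also have "\<dots> = X powr a * Y powr b * (p powr a * r powr b)"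
      using pos pr by (simp add: powr_mult)
    also have "\<dots> \<le> X powr a * Y powr b * (a * p + b * r)"
      using Youngs_inequality_0[OF ab pr] by (intro mult_left_mono) auto
    finally show "real (conv_den u) powr (- 2 * (a * x + b * y)) \<le> X powr a * Y powr b *
        (a * (real (conv_den u) powr (- 2 * x) / X) + b * (real (conv_den u) powr (- 2 * y) / Y))"
      by (simp add: p_r_def)
  qed
  also have "\<dots> = X powr a * Y powr b" using pos ab by simp
  finally have "ln (part_fun n (a * x + b * y)) \<le> ln (X powr a * Y powr b)"
    using part_fun_pos[OF m, of n] pos by (subst ln_le_cancel_iff) auto
  then show ?thesis using pos by (simp add: ln_mult ln_powr X_Y_def)
qed

lemma pressure_convex: "convex_on {1/2<..} pressure"
  unfolding convex_on_def
proof (intro conjI ballI allI impI)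
  fix x y a b :: real
  assume xy: "x \<in> {1/2<..}" "y \<in> {1/2<..}" and ab: "a \<ge> 0" "b \<ge> 0" "a + b = 1"
  have m: "a * x + b * y \<in> {1/2<..}"
    using convexD[OF convex_real_interval(3)[of "1/2"] xy ab] by simp
  have "pressure (a * x + b * y) \<le> a * pressure x + b * pressure y"
  proof (rule LIMSEQ_le[OF pressure_LIMSEQ])
    show "1/2 < a * x + b * y" using m by simp
    show "(\<lambda>n. a * (ln (part_fun n x) / real n) + b * (ln (part_fun n y) / real n))
        \<longlonglongrightarrow> a * pressure x + b * pressure y"
      using xy by (intro tendsto_intros pressure_LIMSEQ) auto
    have "ln (part_fun n (a * x + b * y)) / real n
        \<le> (a * ln (part_fun n x) + b * ln (part_fun n y)) / real n" for n
      using ln_part_fun_convex[of x y a b n] xy ab by (intro divide_right_mono) auto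
    then show "\<exists>N. \<forall>n\<ge>N. ln (part_fun n (a * x + b * y)) / real n
        \<le> a * (ln (part_fun n x) / real n) + b * (ln (part_fun n y) / real n)"
      by (simp add: add_divide_distrib)
  qed
  then show "pressure (a *\<^sub>R x + b *\<^sub>R y) \<le> a * pressure x + b * pressure y" by simp
qed (rule convex_real_interval(3))

lemma pressure_continuous: "continuous_on {1/2<..} pressure"
  by (rule convex_on_continuous[OF open_greaterThan pressure_convex])

text \<open>The summand is the length of the interval of numbers whose expansion starts with \<open>u\<close>.\<close>

lemma has_sum_cylinder_lengths:
  "((\<lambda>u. 1 / (real (conv_den u) * (real (conv_den u) + real (prev_den u)))) has_sum 1) (words n)"
proof (induction n)
  case 0
  have "words 0 = {[]}" by (auto simp: words_def)
  then show ?case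
    using has_sum_finite[of "{[]}" "\<lambda>u. 1 / (real (conv_den u) * (real (conv_den u) + real (prev_den u)))"]
    by simp
next
  case (Suc n)
  let ?f = "\<lambda>u. 1 / (real (conv_den u) * (real (conv_den u) + real (prev_den u)))"
  have inner: "((\<lambda>a. ?f (case (u, a) of (u, a) \<Rightarrow> u @ [a])) has_sum ?f u) {1..}" if u: "u \<in> words n" for u
  proof -
    define q q' where "q = real (conv_den u)" "q' = real (prev_den u)"
    have q: "q > 0" "q' \<ge> 0" using conv_den_pos[of u] u by (auto simp: words_iff q_q'_def)
    have den: "(real a + 1) * q + q' > 0" for a using q by (simp add: add_pos_nonneg)
    \<comment> \<open>Cylinder lengths telescope: appending \<open>Suc a\<close> gives the
      denominator (a + 1) q + q' with previous denominator q, and the length is a difference of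
      consecutive terms.\<close>
    have "(\<lambda>a. 1 / q * (1 / ((real a + 1) * q + q') - 1 / ((real (Suc a) + 1) * q + q'))) sums
        (1 / q * (1 / ((real 0 + 1) * q + q') - 0))"
    proof (rule sums_mult, rule telescope_sums')
      have "filterlim (\<lambda>a. (q + q') + real a * q) at_top sequentially"
        using q by (intro filterlim_tendsto_add_at_top[OF tendsto_const] filterlim_at_top_mult_tendsto_pos[OF tendsto_const]
            filterlim_real_sequentially) auto
      then have "(\<lambda>a. 1 / ((q + q') + real a * q)) \<longlonglongrightarrow> 0"
        by (intro tendsto_divide_0[OF tendsto_const] filterlim_at_top_imp_at_infinity)
      then show "(\<lambda>a. 1 / ((real a + 1) * q + q')) \<longlonglongrightarrow> 0" by (simp add: algebra_simps)
    qed
    moreover have "1 / q * (1 / ((real a + 1) * q + q') - 1 / ((real (Suc a) + 1) * q + q')) = ?f (u @ [Suc a])" for a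
    proof -
      have "real (conv_den (u @ [Suc a])) = (real a + 1) * q + q'" "real (prev_den (u @ [Suc a])) = q"
        by (simp_all add: conv_den_append prev_den_append q_q'_def algebra_simps)
      moreover have "1 / q * (1 / ((real a + 1) * q + q') - 1 / ((real (Suc a) + 1) * q + q')) =
          1 / (((real a + 1) * q + q') * (((real a + 1) * q + q') + q))"
        using den[of a] den[of "Suc a"] q by (simp add: divide_simps) (simp add: algebra_simps)
      ultimately show ?thesis by simp
    qed
    ultimately have "(\<lambda>a. ?f (u @ [Suc a])) sums ?f u"
      by (simp add: q_q'_def)
    then have "((\<lambda>a. ?f (u @ [Suc a])) has_sum ?f u) UNIV"
      by (rule sums_nonneg_imp_has_sum) simp
    moreover have "bij_betw Suc UNIV {1..}"
      by (rule bij_betw_byWitness[where f' = "\<lambda>n. n - 1"]) auto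
    ultimately have "((\<lambda>a. ?f (u @ [a])) has_sum ?f u) {1..}"
      using has_sum_reindex_bij_betw[of Suc UNIV "{1..}" "\<lambda>a. ?f (u @ [a])"] by simp
    then show ?thesis by simp
  qed
  have "((\<lambda>p. ?f (case p of (u, a) \<Rightarrow> u @ [a])) has_sum 1) (words n \<times> {1..})"
  proof (rule has_sum_SigmaI[where g = ?f])
    show "(\<lambda>p. ?f (case p of (u, a) \<Rightarrow> u @ [a])) summable_on (words n \<times> {1..})"
      by (rule summable_on_SigmaI[where g = ?f]) (use inner has_sum_imp_summable[OF Suc] in auto)
  qed (use inner Suc in auto)
  then show ?case
    using has_sum_reindex_bij_betw[OF bij_betw_words_snoc[of n], of ?f] by simp
qed

text \<open>Because q' <= q, the summand q^(-2) lies between the cylinder length 1 / (q (q + q'))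
  and twice that length, and the cylinder lengths sum to 1. This is why \<open>pressure 1\<close> is
  0.\<close>

lemma part_fun_1_bounds: "1 \<le> part_fun n 1" "part_fun n 1 \<le> 2"
proof -
  have sum: "((\<lambda>u. real (conv_den u) powr (- 2 * 1)) has_sum part_fun n 1) (words n)"
    by (rule part_fun_has_sum) simp
  have *: "1 / (real (conv_den u) * (real (conv_den u) + real (prev_den u))) \<le> real (conv_den u) powr (- 2 * 1)"
    "real (conv_den u) powr (- 2 * 1) \<le> 2 * (1 / (real (conv_den u) * (real (conv_den u) + real (prev_den u))))"
    if "u \<in> words n" for u
  proof -
    define q q' where "q = real (conv_den u)" "q' = real (prev_den u)"
    have q: "q > 0" "q' \<ge> 0" "q' \<le> q"
      using conv_den_pos[of u] prev_den_le[of u] that by (auto simp: words_iff q_q'_def)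
    have e: "q powr (- 2 * 1) = 1 / (q * q)"
      using q by (simp add: powr_minus_divide powr_numeral power2_eq_square)
    have "1 / (q * (q + q')) \<le> 1 / (q * q)" using q by (intro divide_left_mono mult_left_mono) auto
    then show "1 / (real (conv_den u) * (real (conv_den u) + real (prev_den u))) \<le> real (conv_den u) powr (- 2 * 1)"
      unfolding e[unfolded q_q'_def] by (simp add: q_q'_def)
    have "2 / (q * (2 * q)) \<le> 2 / (q * (q + q'))" using q by (intro divide_left_mono mult_left_mono) auto
    then show "real (conv_den u) powr (- 2 * 1) \<le> 2 * (1 / (real (conv_den u) * (real (conv_den u) + real (prev_den u))))"
      unfolding e[unfolded q_q'_def] by (simp add: q_q'_def)
  qed
  show "1 \<le> part_fun n 1" by (rule has_sum_mono[OF has_sum_cylinder_lengths sum *(1)])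
  show "part_fun n 1 \<le> 2"
    using has_sum_mono[OF sum has_sum_cmult_right[OF has_sum_cylinder_lengths, of 2] *(2)] by simp
qed

lemma pressure_1: "pressure 1 = 0"
proof -
  have "(\<lambda>n. ln (part_fun n 1) / real n) \<longlonglongrightarrow> 0"
  proof (rule tendsto_sandwich[OF _ _ tendsto_const lim_const_over_n[of "ln 2"]])
    have "0 \<le> ln (part_fun n 1)" "ln (part_fun n 1) \<le> ln 2" for n
      using part_fun_1_bounds[of n] by auto
    then show "\<forall>\<^sub>F n in sequentially. 0 \<le> ln (part_fun n 1) / real n"
      "\<forall>\<^sub>F n in sequentially. ln (part_fun n 1) / real n \<le> ln 2 / real n"
      by (auto intro!: always_eventually divide_right_mono)
  qed
  then show ?thesis using pressure_LIMSEQ[of 1] LIMSEQ_unique by fastforce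
qed

section \<open>Sign and growth of the pressure; the dimension equation\<close>

lemma pressure_ge:
  assumes "\<theta> > 1/2" "n \<ge> 1"
  shows "(ln (part_fun n \<theta>) - \<theta> * ln 4) / real n \<le> pressure \<theta>"
  using pressure_approx[OF assms] by (simp add: diff_divide_distrib)

lemma pressure_le:
  assumes "\<theta> > 1/2" "n \<ge> 1"
  shows "real n * pressure \<theta> \<le> ln (part_fun n \<theta>) + \<theta> * ln 4"
proof -
  have "pressure \<theta> \<le> (ln (part_fun n \<theta>) + \<theta> * ln 4) / real n"
    using pressure_approx[OF assms] by (simp add: add_divide_distrib)
  then show ?thesis using assms by (simp add: field_simps)
qed

text \<open>Words of length 2k have denominator at least 2^k, so lowering the exponent from 1 to
  \<theta> multiplies every summand by at least 2^(2 (1 - \<theta>) k), and for large k this beats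
  the bounded error in \<open>pressure_ge\<close>. It is the condition s ln B < P(s) for B = 1,
  valid on all of (1/2, 1).\<close>

lemma pressure_pos:
  assumes "1/2 < \<theta>" "\<theta> < 1"
  shows "pressure \<theta> > 0"
proof -
  obtain k :: nat where k: "real k * (2 * (1 - \<theta>) * ln 2) > \<theta> * ln 4"
    using reals_Archimedean3[of "2 * (1 - \<theta>) * ln 2"] assms by (auto simp: mult_pos_pos)
  have "\<theta> * ln 4 > 0" using assms by simp
  then have "k \<noteq> 0" using k by (intro notI) simp
  define n where "n = 2 * k"
  have "2 powr (2 * (1 - \<theta>) * real k) * part_fun n 1 \<le> part_fun n \<theta>"
  proof (rule has_sum_mono[OF has_sum_cmult_right[OF part_fun_has_sum] part_fun_has_sum])
    fix u assume "u \<in> words n"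
    then have pu: "pos_word u" "length u = 2 * k" by (auto simp: words_iff n_def)
    then have "2 ^ k \<le> conv_den u" using conv_den_ge_pow[of u] by simp
    then have "2 ^ k \<le> real (conv_den u)" by (metis of_nat_le_iff of_nat_numeral of_nat_power)
    then have ge: "2 powr real k \<le> real (conv_den u)" by (simp add: powr_realpow)
    have "2 powr (2 * (1 - \<theta>) * real k) = (2 powr real k) powr (2 * (1 - \<theta>))"
      by (simp add: powr_powr mult.commute)
    also have "\<dots> \<le> real (conv_den u) powr (2 * (1 - \<theta>))"
      using assms ge by (intro powr_mono2) auto
    finally have "2 powr (2 * (1 - \<theta>) * real k) * real (conv_den u) powr (- 2 * 1) \<le>
        real (conv_den u) powr (2 * (1 - \<theta>)) * real (conv_den u) powr (- 2 * 1)"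
      by (rule mult_right_mono) simp
    also have "\<dots> = real (conv_den u) powr (- 2 * \<theta>)"
      by (simp add: powr_add[symmetric] algebra_simps)
    finally show "2 powr (2 * (1 - \<theta>) * real k) * real (conv_den u) powr (- 2 * 1) \<le> real (conv_den u) powr (- 2 * \<theta>)" .
  qed (use assms in auto)
  moreover have "2 powr (2 * (1 - \<theta>) * real k) * 1 \<le> 2 powr (2 * (1 - \<theta>) * real k) * part_fun n 1"
    using part_fun_1_bounds(1)[of n] by (intro mult_left_mono) auto
  ultimately have le: "2 powr (2 * (1 - \<theta>) * real k) \<le> part_fun n \<theta>" by linarith
  have "2 * (1 - \<theta>) * real k * ln 2 = ln (2 powr (2 * (1 - \<theta>) * real k))"
    by (simp add: ln_powr)
  also have "\<dots> \<le> ln (part_fun n \<theta>)"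
    by (rule ln_mono[OF le]) simp
  finally have "real k * (2 * (1 - \<theta>) * ln 2) \<le> ln (part_fun n \<theta>)"
    by (simp add: mult.commute mult.left_commute)
  then have "0 < (ln (part_fun n \<theta>) - \<theta> * ln 4) / real n"
    using k \<open>k \<noteq> 0\<close> by (intro divide_pos_pos) (auto simp: n_def)
  also have "\<dots> \<le> pressure \<theta>" using assms \<open>k \<noteq> 0\<close> by (intro pressure_ge) (auto simp: n_def)
  finally show ?thesis .
qed

text \<open>One-letter words already suffice: a finite piece of the harmonic series is as large as
  desired, and by continuity so is the same piece of the sum of n^(-2\<theta>) for some \<theta>
  slightly above 1/2.\<close>

lemma pressure_unbounded: "\<exists>\<theta>. 1/2 < \<theta> \<and> \<theta> < 1 \<and> pressure \<theta> > c"
proof -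
  have "\<not> summable (\<lambda>n. real n powr (-1))" using summable_real_powr_iff[of "-1"] by simp
  moreover have "summable (\<lambda>n. real n powr (-1))" if "\<And>N. (\<Sum>n<N. real n powr (-1)) \<le> exp (c + ln 4)"
    by (rule summableI_nonneg_bounded[OF _ that]) simp
  ultimately have "\<exists>N. \<not> (\<Sum>n<N. real n powr (-1)) \<le> exp (c + ln 4)" by blast
  then obtain N where N: "(\<Sum>n<N. real n powr (-1)) > exp (c + ln 4)" by (auto simp: not_le)
  have lim: "((\<lambda>\<theta>. \<Sum>n\<in>{1..<N}. real n powr (- 2 * \<theta>)) \<longlongrightarrow> (\<Sum>n\<in>{1..<N}. real n powr (- 2 * (1/2))))
      (at_right (1/2))"
    by (intro tendsto_intros) auto
  have sum0: "(\<Sum>n\<in>{1..<N}. real n powr (- 2 * (1/2))) = (\<Sum>n<N. real n powr (-1))"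
    by (intro sum.mono_neutral_cong_left) (auto simp: Suc_le_eq)
  have "\<forall>\<^sub>F \<theta> in at_right (1/2). (\<Sum>n\<in>{1..<N}. real n powr (- 2 * \<theta>)) > exp (c + ln 4)"
    by (rule order_tendstoD(1)[OF lim]) (use N sum0 in simp)
  moreover have "\<forall>\<^sub>F \<theta> in at_right (1/2::real). \<theta> < 1" "\<forall>\<^sub>F \<theta> in at_right (1/2::real). \<theta> > 1/2"
    by (auto intro: eventually_at_rightI[of "1/2" 1])
  ultimately have "\<forall>\<^sub>F \<theta> in at_right (1/2).
      (\<Sum>n\<in>{1..<N}. real n powr (- 2 * \<theta>)) > exp (c + ln 4) \<and> \<theta> < 1 \<and> \<theta> > 1/2"
    by (intro eventually_conj)
  then obtain \<theta> where \<theta>: "(\<Sum>n\<in>{1..<N}. real n powr (- 2 * \<theta>)) > exp (c + ln 4)" "\<theta> < 1" "\<theta> > 1/2"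
    using eventually_happens[of _ "at_right (1/2::real)"] by auto
  have "(\<Sum>n\<in>{1..<N}. real n powr (- 2 * \<theta>)) = (\<Sum>u\<in>(\<lambda>a. [a]) ` {1..<N}. real (conv_den u) powr (- 2 * \<theta>))"
    by (subst sum.reindex) (auto simp: inj_on_def)
  also have "\<dots> \<le> part_fun 1 \<theta>"
    using \<theta> by (intro part_fun_ge_finite) (auto simp: words_def)
  finally have "ln (exp (c + ln 4)) < ln (part_fun 1 \<theta>)"
    using \<theta> by (subst ln_less_cancel_iff) (auto intro: part_fun_pos)
  moreover have "\<theta> * ln 4 \<le> 1 * ln 4" using \<theta> by (intro mult_right_mono) auto
  ultimately have "c < (ln (part_fun 1 \<theta>) - \<theta> * ln 4) / real 1"
    by (simp only: ln_exp of_nat_1 div_by_1)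
  also have "\<dots> \<le> pressure \<theta>" using \<theta> by (intro pressure_ge) auto
  finally show ?thesis using \<theta> by blast
qed

text \<open>The pressure enters only as a nonincreasing function; strictness comes from the linear
  term, as ln B > 0.\<close>

lemma pressure_sub_strict_antimono:
  assumes "B > 1" "1/2 < x" "x < y"
  shows "pressure y - y * ln B < pressure x - x * ln B"
proof -
  have "pressure y \<le> pressure x" using assms by (intro pressure_antimono) auto
  moreover have "x * ln B < y * ln B" using assms by (intro mult_strict_right_mono) auto
  ultimately show ?thesis by linarith
qed

lemma pressure_root_exists:
  assumes B: "B > (1::real)"
  shows "\<exists>!\<theta>. \<theta> > 1/2 \<and> pressure \<theta> = \<theta> * ln B"
proof -
  obtain a where a: "1/2 < a" "a < 1" "pressure a > ln B" using pressure_unbounded by blast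
  \<comment> \<open>A sign change on [a, 1]: at \<open>a\<close> the pressure exceeds ln B >= a ln
    B, while at 1 it vanishes.\<close>
  have "a * ln B \<le> 1 * ln B" using a B by (intro mult_right_mono) auto
  then have 1: "pressure a - a * ln B \<ge> 0" using a by simp
  have 2: "pressure 1 - 1 * ln B \<le> 0" using B by (simp add: pressure_1)
  have "continuous_on {a..1} (\<lambda>x. pressure x - x * ln B)"
    by (intro continuous_intros continuous_on_subset[OF pressure_continuous]) (use a in auto)
  then obtain x where x: "x \<ge> a" "x \<le> 1" "pressure x - x * ln B = 0"
    using IVT2'[of "\<lambda>x. pressure x - x * ln B" 1 0 a] 1 2 a by auto
  show ?thesis
  proof (rule ex1I[of _ x])
    show "1/2 < x \<and> pressure x = x * ln B" using x a by simp
    fix y assume "1/2 < y \<and> pressure y = y * ln B"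
    then show "y = x"
      using pressure_sub_strict_antimono[OF B, of x y] pressure_sub_strict_antimono[OF B, of y x] x a
      by (cases x y rule: linorder_cases) auto
  qed
qed

lemma pressure_root:
  assumes B: "B > (1::real)"
  shows "1/2 < pressure_root (ln B)" "pressure_root (ln B) < 1"
    and pressure_root_less: "\<And>s. pressure_root (ln B) < s \<Longrightarrow> pressure s < s * ln B"
    and pressure_root_greater: "\<And>s. 1/2 < s \<Longrightarrow> s < pressure_root (ln B) \<Longrightarrow> s * ln B < pressure s"
proof -
  have r: "1/2 < pressure_root (ln B) \<and> pressure (pressure_root (ln B)) = pressure_root (ln B) * ln B"
    unfolding pressure_root_def by (rule theI'[OF pressure_root_exists[OF B]])
  then show gt: "1/2 < pressure_root (ln B)" by simp
  show "pressure_root (ln B) < 1"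
  proof (rule ccontr)
    assume "\<not> ?thesis"
    then have "pressure (pressure_root (ln B)) \<le> pressure 1" by (intro pressure_antimono) auto
    then have "pressure_root (ln B) * ln B \<le> 0" using r by (simp add: pressure_1)
    moreover have "pressure_root (ln B) * ln B > 0" using gt B by (intro mult_pos_pos) auto
    ultimately show False by simp
  qed
  show "pressure s < s * ln B" if "pressure_root (ln B) < s" for s
    using pressure_sub_strict_antimono[OF B gt that] r by simp
  show "s * ln B < pressure s" if "1/2 < s" "s < pressure_root (ln B)" for s
    using pressure_sub_strict_antimono[OF B that] r by simp
qed

section \<open>Mass distribution and separation of points\<close>

text \<open>A cover of cost below 1 / (2 C) would leave total mass at most 1/2. Measurable events
  \<open>Z\<close> that contain the preimages of the covering sets replace an image measure, so
  arbitrary bounded sets \<open>U\<close> can be treated.\<close>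

lemma mass_distribution:
  fixes X :: "'w \<Rightarrow> 'a::metric_space"
  assumes "prob_space Pr" and AE: "AE \<omega> in Pr. \<omega> \<in> \<Omega>" and C: "C > 0"
    and E: "\<And>\<omega>. \<omega> \<in> \<Omega> \<Longrightarrow> X \<omega> \<in> E"
    and cover: "\<And>U. bounded U \<Longrightarrow>
      \<exists>Z\<in>sets Pr. (\<forall>\<omega>\<in>\<Omega>. X \<omega> \<in> U \<longrightarrow> \<omega> \<in> Z) \<and> emeasure Pr Z \<le> ennreal C * diam_pow s U"
  shows "hausdorff_measure s E \<noteq> 0"
proof
  interpret prob_space Pr by fact
  assume "hausdorff_measure s E = 0"
  then have "hausdorff_premeasure s 1 E = 0" by (simp add: hausdorff_measure_eq_0_iff)
  moreover have "(0::ennreal) < ennreal (1 / (2 * C))" using C by simp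
  ultimately obtain U where U: "E \<subseteq> (\<Union>i. U i)" "\<forall>i. bounded (U i) \<and> diameter (U i) \<le> 1"
    "(\<Sum>i. diam_pow s (U i)) < ennreal (1 / (2 * C))"
    unfolding hausdorff_premeasure_eq_0_iff by blast
  have "\<forall>i. \<exists>Z\<in>sets Pr. (\<forall>\<omega>\<in>\<Omega>. X \<omega> \<in> U i \<longrightarrow> \<omega> \<in> Z) \<and> emeasure Pr Z \<le> ennreal C * diam_pow s (U i)"
    using U(2) cover by blast
  then obtain Z where Z: "\<And>i. Z i \<in> sets Pr" "\<And>i \<omega>. \<omega> \<in> \<Omega> \<Longrightarrow> X \<omega> \<in> U i \<Longrightarrow> \<omega> \<in> Z i"
    "\<And>i. emeasure Pr (Z i) \<le> ennreal C * diam_pow s (U i)"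
    by metis
  have "AE \<omega> in Pr. \<omega> \<in> (\<Union>i. Z i)"
    using AE
  proof (rule AE_mp, intro AE_I2 impI)
    fix \<omega> assume "\<omega> \<in> \<Omega>"
    then obtain i where "X \<omega> \<in> U i" using E U(1) by blast
    then show "\<omega> \<in> (\<Union>i. Z i)" using Z(2) \<open>\<omega> \<in> \<Omega>\<close> by blast
  qed
  moreover have "(\<Union>i. Z i) \<in> sets Pr" using Z(1) by blast
  ultimately have "1 = emeasure Pr (\<Union>i. Z i)" using emeasure_eq_1_AE by simp
  also have "\<dots> \<le> (\<Sum>i. emeasure Pr (Z i))"
    using Z(1) by (intro emeasure_subadditive_countably) auto
  also have "\<dots> \<le> (\<Sum>i. ennreal C * diam_pow s (U i))"
    by (intro suminf_le Z(3)) auto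
  also have "\<dots> = ennreal C * (\<Sum>i. diam_pow s (U i))" by (rule ennreal_suminf_cmult)
  also have "\<dots> \<le> ennreal C * ennreal (1 / (2 * C))"
    using U(3) by (intro mult_left_mono) auto
  also have "\<dots> = ennreal (1 / 2)" using C by (simp add: ennreal_mult[symmetric])
  finally have "ennreal 1 \<le> ennreal (1/2)" by simp
  then show False by (subst (asm) ennreal_le_iff) auto
qed

text \<open>Two tails in (0, 1) can nearly cancel a difference of 1 between the quotients, when one
  is close to 1 and the other to 0. If both next quotients are at least 2, the tails lie below 1/2;
  if both are at most \<open>M\<close>, the tails lie above 1 / (M + 1). Either way the cancellation
  is at most 1 - \<kappa>.\<close>

lemma cf_val_dist_ge:
  assumes a: "pos_seq a" and b: "pos_seq b" and eq: "\<And>i. i < n \<Longrightarrow> a i = b i" and ne: "a n \<noteq> b n"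
    and next_digit: "2 \<le> a (Suc n) \<and> 2 \<le> b (Suc n) \<or> a (Suc n) \<le> M \<and> b (Suc n) \<le> M"
    and M: "M \<ge> 1"
  shows "\<bar>real (a n) - real (b n)\<bar> /
      (real (M + 1) * (real (conv_den (pref a n)))\<^sup>2 * ((real (a n) + 2) * (real (b n) + 2)))
    \<le> \<bar>cf_val a - cf_val b\<bar>"
proof -
  define \<tau> \<tau>' where "\<tau> = cf_val (\<lambda>i. a (Suc n + i))" "\<tau>' = cf_val (\<lambda>i. b (Suc n + i))"
  define q q' where "q = real (conv_den (pref a n))" "q' = real (prev_den (pref a n))"
  define t t' where "t = real (a n) + \<tau>" "t' = real (b n) + \<tau>'"
  define \<kappa> where "\<kappa> = 1 / real (M + 1)"
  define D where "D = \<bar>real (a n) - real (b n)\<bar>"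
  note pw = pos_word_pref[OF a, of n]
  have pref: "pref b n = pref a n" using eq by simp
  have q: "q \<ge> 1" "0 \<le> q'" "q' \<le> q"
    using conv_den_pos[OF pw] prev_den_le[OF pw] by (auto simp: q_q'_def)
  note tb = cf_val_bounds[OF pos_seq_shift[OF a, of "Suc n"]] cf_val_bounds[OF pos_seq_shift[OF b, of "Suc n"]]
  have \<tau>: "0 < \<tau>" "\<tau> < 1" "0 < \<tau>'" "\<tau>' < 1"
    "1 / (real (a (Suc n)) + 1) \<le> \<tau>" "\<tau> \<le> 1 / real (a (Suc n))"
    "1 / (real (b (Suc n)) + 1) \<le> \<tau>'" "\<tau>' \<le> 1 / real (b (Suc n))"
    using tb by (simp_all add: \<tau>_\<tau>'_def)
  have ab: "real (a n) \<ge> 1" "real (b n) \<ge> 1" using a b by (auto simp: pos_seq_def)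
  have D: "D \<ge> 1" using ne by (auto simp: D_def)
  have \<kappa>: "0 < \<kappa>" "\<kappa> \<le> 1/2" using M by (auto simp: \<kappa>_def field_simps)
  have tail: "\<bar>\<tau> - \<tau>'\<bar> \<le> 1 - \<kappa>"
    using next_digit
  proof
    assume *: "2 \<le> a (Suc n) \<and> 2 \<le> b (Suc n)"
    then have "1 / real (a (Suc n)) \<le> 1/2" "1 / real (b (Suc n)) \<le> 1/2" by (auto simp: field_simps)
    then show ?thesis using \<tau> \<kappa> by linarith
  next
    assume *: "a (Suc n) \<le> M \<and> b (Suc n) \<le> M"
    then have "\<kappa> \<le> 1 / (real (a (Suc n)) + 1)" "\<kappa> \<le> 1 / (real (b (Suc n)) + 1)"
      unfolding \<kappa>_def by (auto intro!: divide_left_mono)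
    then show ?thesis using \<tau> by linarith
  qed
  \<comment> \<open>The worst case is \<open>D = 1\<close>, with equality.\<close>
  have "\<kappa> * D \<le> D - (1 - \<kappa>)"
  proof -
    have "0 \<le> (1 - \<kappa>) * (D - 1)" using D \<kappa> by simp
    then show ?thesis by (simp add: algebra_simps)
  qed
  also have "\<dots> \<le> \<bar>t - t'\<bar>" using tail by (simp add: t_t'_def D_def)
  finally have tt: "\<kappa> * D \<le> \<bar>t - t'\<bar>" .
  have tpos: "t > 0" "t' > 0" using ab \<tau> by (auto simp: t_t'_def)
  have "cf_val a = cf_map (pref a (Suc n)) \<tau>" "cf_val b = cf_map (pref b (Suc n)) \<tau>'"
    using cf_val_split[OF a, of "Suc n"] cf_val_split[OF b, of "Suc n"] by (simp_all add: \<tau>_\<tau>'_def)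
  then have "cf_val a = cf_map (pref a n) (1 / t)" "cf_val b = cf_map (pref a n) (1 / t')"
    by (simp_all add: cf_map_append t_t'_def pref)
  then have "\<bar>cf_val a - cf_val b\<bar> = \<bar>1 / t - 1 / t'\<bar> / ((q + q' * (1 / t)) * (q + q' * (1 / t')))"
    using cf_map_diff[OF pw, of "1 / t" "1 / t'"] tpos by (simp add: q_q'_def)
  also have "\<bar>1 / t - 1 / t'\<bar> = \<bar>t - t'\<bar> / (t * t')"
  proof -
    have "1 / t - 1 / t' = (t' - t) / (t * t')" using tpos by (simp add: field_simps)
    then show ?thesis using tpos by (simp add: abs_divide abs_mult abs_minus_commute)
  qed
  also have "\<bar>t - t'\<bar> / (t * t') / ((q + q' * (1 / t)) * (q + q' * (1 / t'))) =
      \<bar>t - t'\<bar> / ((q * t + q') * (q * t' + q'))"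
    using tpos q by (simp add: field_simps)
  finally have eq': "\<bar>cf_val a - cf_val b\<bar> = \<bar>t - t'\<bar> / ((q * t + q') * (q * t' + q'))" .
  have q\<tau>: "q * \<tau> \<le> q * 1" "q * \<tau>' \<le> q * 1" using q \<tau> by (auto intro!: mult_left_mono simp del: mult_1_right)
  have "q * t + q' \<le> q * (real (a n) + 2)"
    using q q\<tau> unfolding t_t'_def distrib_left by linarith
  moreover have "q * t' + q' \<le> q * (real (b n) + 2)"
    using q q\<tau> unfolding t_t'_def distrib_left by linarith
  ultimately have "(q * t + q') * (q * t' + q') \<le> (q * (real (a n) + 2)) * (q * (real (b n) + 2))"
    using q tpos by (intro mult_mono) auto
  moreover have "0 < (q * t + q') * (q * t' + q')"
    using q tpos by (intro mult_pos_pos add_pos_nonneg) auto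
  ultimately have "\<kappa> * D / ((q * (real (a n) + 2)) * (q * (real (b n) + 2))) \<le> \<bar>cf_val a - cf_val b\<bar>"
    unfolding eq' using tt \<kappa> D by (intro frac_le) auto
  then show ?thesis
    by (simp add: \<kappa>_def D_def q_q'_def power2_eq_square mult_ac)
qed

lemma conv_den_le_power:
  assumes "\<And>d. d \<in> set v \<Longrightarrow> 1 \<le> d \<and> d \<le> M"
  shows "conv_den v \<le> (M + 1) ^ length v"
proof -
  have "prod_list (map Suc v) \<le> (M + 1) ^ length v"
    using assms
  proof (induction v)
    case (Cons d v)
    then have "Suc d * prod_list (map Suc v) \<le> (M + 1) * (M + 1) ^ length v"
      by (intro mult_le_mono) auto
    then show ?case by simp
  qed simp
  moreover have "pos_word v" using assms by (auto simp: pos_word_def)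
  ultimately show ?thesis using conv_den_le_prod[of v] by linarith
qed

text \<open>The denominator at the place of disagreement is replaced by the one at the start
  \<open>k\<close> of the block: at most \<open>m\<close> quotients bounded by \<open>M\<close> lie
  in between and cost a factor 2 (M + 1)^m, which is then squared.\<close>

lemma dist_cf_val_ge_prefix:
  assumes a: "pos_seq a" and b: "pos_seq b" and eq: "\<And>i. i < k + t \<Longrightarrow> a i = b i"
    and ne: "a (k + t) \<noteq> b (k + t)"
    and next_digit: "2 \<le> a (Suc (k + t)) \<and> 2 \<le> b (Suc (k + t)) \<or> a (Suc (k + t)) \<le> M \<and> b (Suc (k + t)) \<le> M"
    and M: "M \<ge> 1" and t: "t \<le> m" and small: "\<And>i. i < t \<Longrightarrow> a (k + i) \<le> M"
  shows "\<bar>real (a (k + t)) - real (b (k + t))\<bar> /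
      (4 * real (M + 1) ^ (2 * m + 1) * (real (conv_den (pref a k)))\<^sup>2 *
        ((real (a (k + t)) + 2) * (real (b (k + t)) + 2)))
    \<le> \<bar>cf_val a - cf_val b\<bar>"
proof -
  define v where "v = pref (\<lambda>i. a (k + i)) t"
  have pv: "pos_word v" unfolding v_def by (intro pos_word_pref pos_seq_shift a)
  have "conv_den (pref a (k + t)) \<le> 2 * conv_den (pref a k) * conv_den v"
    unfolding pref_add v_def[symmetric] by (intro conv_den_append_le pos_word_pref a pv)
  also have "conv_den v \<le> (M + 1) ^ length v"
    using small a by (intro conv_den_le_power) (auto simp: v_def pos_seq_def)
  also have "(M + 1) ^ length v \<le> (M + 1) ^ m"
    using t by (intro power_increasing) (auto simp: v_def)
  finally have "conv_den (pref a (k + t)) \<le> 2 * conv_den (pref a k) * (M + 1) ^ m"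
    by simp
  then have "real (conv_den (pref a (k + t))) \<le> real (2 * conv_den (pref a k) * (M + 1) ^ m)"
    by (rule of_nat_mono)
  then have "(real (conv_den (pref a (k + t))))\<^sup>2 \<le> (2 * real (conv_den (pref a k)) * real (M + 1) ^ m)\<^sup>2"
    by (intro power_mono) auto
  also have "\<dots> = 4 * real (M + 1) ^ (2 * m) * (real (conv_den (pref a k)))\<^sup>2"
    by (simp add: power_mult_distrib power_mult[symmetric] mult.commute)
  finally have le: "real (M + 1) * (real (conv_den (pref a (k + t))))\<^sup>2 *
        ((real (a (k + t)) + 2) * (real (b (k + t)) + 2))
      \<le> real (M + 1) * (4 * real (M + 1) ^ (2 * m) * (real (conv_den (pref a k)))\<^sup>2) *
        ((real (a (k + t)) + 2) * (real (b (k + t)) + 2))"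
    by (intro mult_right_mono mult_left_mono) auto
  have "conv_den (pref a (k + t)) \<ge> 1" by (intro conv_den_pos pos_word_pref a)
  then have pos: "0 < real (M + 1) * (real (conv_den (pref a (k + t))))\<^sup>2 *
        ((real (a (k + t)) + 2) * (real (b (k + t)) + 2))" by (simp add: add_pos_nonneg)
  have "\<bar>real (a (k + t)) - real (b (k + t))\<bar> / (real (M + 1) *
      (4 * real (M + 1) ^ (2 * m) * (real (conv_den (pref a k)))\<^sup>2) *
        ((real (a (k + t)) + 2) * (real (b (k + t)) + 2))) \<le>
      \<bar>real (a (k + t)) - real (b (k + t))\<bar> / (real (M + 1) * (real (conv_den (pref a (k + t))))\<^sup>2 *
        ((real (a (k + t)) + 2) * (real (b (k + t)) + 2)))"
    by (rule divide_left_mono[OF le]) (use pos less_le_trans[OF pos le] in auto)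
  also have "\<dots> \<le> \<bar>cf_val a - cf_val b\<bar>"
    by (rule cf_val_dist_ge[OF a b eq ne next_digit M])
  finally show ?thesis by (simp add: mult_ac)
qed

section \<open>Cantor sets of continued fractions\<close>

lemma power2_powr: "x > 0 \<Longrightarrow> x\<^sup>2 powr s = x powr (2 * s)" for x :: real
  using powr_powr[of x 2 s] by simp

definition small_words :: "nat \<Rightarrow> nat \<Rightarrow> nat list set" where
  "small_words m M = {u \<in> words m. set u \<subseteq> {..M}}"

definition small_sum :: "real \<Rightarrow> nat \<Rightarrow> nat \<Rightarrow> real" where
  "small_sum s m M = (\<Sum>u\<in>small_words m M. real (conv_den u) powr (- 2 * s))"

text \<open>Bound for the factor by which block \<open>j\<close> changes mass times q^(2s), each
  block being charged the 2 from concatenation. A special block has weight 1 / A and denominator at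
  most 2^m A, whence A^(2s - 1) and (2^(m + 1))^(2s). In an ordinary block the weight cancels the
  denominator and leaves 4^s over the normalising sum.\<close>

definition cantor_ratio :: "real \<Rightarrow> nat \<Rightarrow> nat \<Rightarrow> (nat \<Rightarrow> bool) \<Rightarrow> (nat \<Rightarrow> nat) \<Rightarrow> nat \<Rightarrow> real" where
  "cantor_ratio s m M sp A j =
     (if sp j then real (A j) powr (2 * s - 1) * 4 powr (s * (real m + 1))
      else 4 powr s / small_sum s m M)"

lemma finite_small_words: "finite (small_words m M)"
  by (rule finite_subset[OF _ finite_lists_length_eq[of "{..M}" m]]) (auto simp: small_words_def words_def)

lemma small_sum_pos:
  assumes "M \<ge> 1"
  shows "small_sum s m M > 0"
proof -
  have u: "replicate m 1 \<in> small_words m M" using assms by (auto simp: small_words_def words_def)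
  then have "conv_den (replicate m 1) \<ge> 1" by (intro conv_den_pos) (auto simp: small_words_def words_iff)
  then have "0 < real (conv_den (replicate m 1)) powr (- 2 * s)" by simp
  also have "\<dots> \<le> small_sum s m M"
    unfolding small_sum_def using u by (intro member_le_sum finite_small_words) auto
  finally show ?thesis .
qed

text \<open>Blocks of \<open>m\<close> digits are chosen independently. In a special block all digits but the one at
  position \<open>r j\<close> are \<open>1\<close>, and that one is uniform in \<open>{A j..<2 * A j}\<close>; otherwise the block is a word
  \<open>u\<close> over \<open>{1..M}\<close>, with probability proportional to \<open>conv_den u powr (- 2 * s)\<close>.\<close>

locale cf_cantor =
  fixes s C :: real and m M :: nat and sp :: "nat \<Rightarrow> bool" and r A :: "nat \<Rightarrow> nat"
  assumes s: "0 < s" "s \<le> 1" and m: "m \<ge> 1" and M: "M \<ge> 1"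
    and r: "\<And>j. sp j \<Longrightarrow> r j < m" and A: "\<And>j. sp j \<Longrightarrow> A j \<ge> 2"
    and bound: "\<And>j. (\<Prod>i<j. cantor_ratio s m M sp A i) \<le> C"
    and bound_special: "\<And>j. sp j \<Longrightarrow> (\<Prod>i<j. cantor_ratio s m M sp A i) \<le> C * real (A j) powr (- s)"
begin

section \<open>Block distributions and the product measure\<close>

definition special_block :: "nat \<Rightarrow> nat \<Rightarrow> nat list" where
  "special_block j a = replicate (r j) 1 @ a # replicate (m - 1 - r j) 1"

definition blocks :: "nat \<Rightarrow> nat list set" where
  "blocks j = (if sp j then special_block j ` {A j..<2 * A j} else small_words m M)"

definition weight :: "nat \<Rightarrow> nat list \<Rightarrow> real" where
  "weight j u = (if u \<in> blocks j then
     (if sp j then 1 / real (A j) else real (conv_den u) powr (- 2 * s) / small_sum s m M) else 0)"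

definition law :: "nat \<Rightarrow> nat list pmf" where
  "law j = embed_pmf (weight j)"

definition digit :: "(nat \<Rightarrow> nat list) \<Rightarrow> nat \<Rightarrow> nat" where
  "digit \<omega> i = \<omega> (i div m) ! (i mod m)"

text \<open>The product space consists of arbitrary sequences of lists; on this event of probability
  one, \<open>digit\<close> is a sequence of partial quotients.\<close>

definition good :: "(nat \<Rightarrow> nat list) set" where
  "good = {\<omega>. \<forall>j. \<omega> j \<in> blocks j}"

abbreviation "point \<omega> \<equiv> cf_val (digit \<omega>)"
abbreviation "Pr \<equiv> Pi\<^sub>M UNIV (\<lambda>j. measure_pmf (law j))"

lemma special_block_nth:
  assumes "sp j" "i < m"
  shows "special_block j a ! i = (if i = r j then a else 1)"
  using assms r[OF assms(1)] by (auto simp: special_block_def nth_append nth_Cons')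

lemma special_block_length: "sp j \<Longrightarrow> length (special_block j a) = m"
  using r by (force simp: special_block_def)

lemma special_block_inj: "sp j \<Longrightarrow> inj (special_block j)"
  by (auto simp: inj_def special_block_def)

lemma finite_blocks: "finite (blocks j)"
  by (simp add: blocks_def finite_small_words)

lemma blocks_words: "blocks j \<subseteq> words m"
proof (cases "sp j")
  case True
  then show ?thesis using A[OF True] special_block_length[OF True]
    by (auto simp: blocks_def words_def) (auto simp: special_block_def)
qed (auto simp: blocks_def small_words_def)

lemma weight_nonneg: "weight j u \<ge> 0"
  using small_sum_pos[OF M, of s m] by (auto simp: weight_def)

lemma weight_sum: "(\<Sum>u\<in>blocks j. weight j u) = 1"
proof (cases "sp j")
  case True
  then have "(\<Sum>u\<in>blocks j. weight j u) = real (card (blocks j)) / real (A j)"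
    by (simp add: weight_def)
  also have "card (blocks j) = A j"
    using True special_block_inj[OF True] by (simp add: blocks_def card_image inj_on_subset)
  finally show ?thesis using A[OF True] by simp
next
  case False
  then have "(\<Sum>u\<in>blocks j. weight j u) = (\<Sum>u\<in>blocks j. real (conv_den u) powr (- 2 * s) / small_sum s m M)"
    by (simp add: weight_def)
  also have "\<dots> = small_sum s m M / small_sum s m M"
    using False unfolding sum_divide_distrib[symmetric] by (simp add: small_sum_def blocks_def)
  finally show ?thesis using small_sum_pos[OF M, of s m] by simp
qed

lemma pmf_law: "pmf (law j) u = weight j u"
  unfolding law_def
proof (rule pmf_embed_pmf[OF weight_nonneg])
  have "(\<integral>\<^sup>+u. ennreal (weight j u) \<partial>count_space UNIV) = (\<Sum>u\<in>blocks j. ennreal (weight j u))"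
    by (rule nn_integral_count_space'[OF finite_blocks]) (auto simp: weight_def)
  also have "\<dots> = ennreal (\<Sum>u\<in>blocks j. weight j u)"
    by (rule sum_ennreal) (rule weight_nonneg)
  finally show "(\<integral>\<^sup>+u. ennreal (weight j u) \<partial>count_space UNIV) = 1"
    by (simp add: weight_sum)
qed

lemma set_pmf_law: "set_pmf (law j) \<subseteq> blocks j"
  by (auto simp: set_pmf_iff pmf_law weight_def split: if_splits)

sublocale PP: product_prob_space "\<lambda>j. measure_pmf (law j)" UNIV
  by unfold_locales

lemma space_Pr: "space Pr = UNIV"
  by (simp add: space_PiM)

lemma AE_good: "AE \<omega> in Pr. \<omega> \<in> good"
proof -
  have "AE \<omega> in Pr. \<omega> j \<in> blocks j" for j
  proof (rule AE_PiM_component)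
    show "AE u in measure_pmf (law j). u \<in> blocks j"
      using set_pmf_law by (auto simp: AE_measure_pmf_iff)
  qed (auto intro: prob_space_measure_pmf)
  then show ?thesis by (simp add: good_def AE_all_countable)
qed

text \<open>The last block is only confined to \<open>S\<close>: \<open>UNIV\<close> gives the event
  of agreeing with \<omega> on the first \<open>j\<close> blocks, and a range of special words gives
  the event that the large digit lies in an interval.\<close>

definition cylinder :: "(nat \<Rightarrow> nat list) \<Rightarrow> nat \<Rightarrow> nat list set \<Rightarrow> (nat \<Rightarrow> nat list) set" where
  "cylinder \<omega> j S = {\<eta>. (\<forall>i<j. \<eta> i = \<omega> i) \<and> \<eta> j \<in> S}"

lemma
  shows cylinder_sets: "cylinder \<omega> j S \<in> sets Pr"
    and emeasure_cylinder: "emeasure Pr (cylinder \<omega> j S) =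
      ennreal ((\<Prod>i<j. weight i (\<omega> i)) * measure (law j) S)"
proof -
  define X where "X i = (if i < j then {\<omega> i} else S)" for i
  have eq: "cylinder \<omega> j S = {\<eta> \<in> space Pr. \<forall>i\<in>{..j}. \<eta> i \<in> X i}"
    by (auto simp: cylinder_def X_def space_Pr split: if_splits)
  show "cylinder \<omega> j S \<in> sets Pr"
    unfolding eq
    by (intro sets.sets_Collect_finite_All sets_Collect_single') auto
  have "emeasure Pr (cylinder \<omega> j S) = (\<Prod>i\<in>{..j}. emeasure (measure_pmf (law i)) (X i))"
    unfolding eq by (rule PP.emeasure_PiM_Collect) auto
  also have "\<dots> = (\<Prod>i\<in>{..j}. ennreal (measure (law i) (X i)))"
    by (simp add: measure_pmf.emeasure_eq_measure)
  also have "\<dots> = ennreal (\<Prod>i\<in>{..j}. measure (law i) (X i))"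
    by (rule prod_ennreal) simp
  also have "(\<Prod>i\<in>{..j}. measure (law i) (X i)) = (\<Prod>i<j. weight i (\<omega> i)) * measure (law j) S"
  proof -
    have "(\<Prod>i<j. measure (law i) (X i)) = (\<Prod>i<j. weight i (\<omega> i))"
      by (rule prod.cong) (simp_all add: X_def pmf_law measure_pmf_single)
    then show ?thesis by (simp add: lessThan_Suc_atMost[symmetric] X_def)
  qed
  finally show "emeasure Pr (cylinder \<omega> j S) = ennreal ((\<Prod>i<j. weight i (\<omega> i)) * measure (law j) S)" .
qed

section \<open>Mass of prefixes and distance between points\<close>

lemma good_block:
  assumes "\<omega> \<in> good"
  shows "length (\<omega> j) = m" "pos_word (\<omega> j)"
  using assms blocks_words[of j] by (auto simp: good_def words_iff)

lemma good_special:
  assumes "\<omega> \<in> good" "sp j"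
  shows "A j \<le> \<omega> j ! r j" "\<omega> j ! r j < 2 * A j" "\<And>i. i < m \<Longrightarrow> i \<noteq> r j \<Longrightarrow> \<omega> j ! i = 1"
    "\<omega> j = special_block j (\<omega> j ! r j)"
proof -
  have "\<omega> j \<in> blocks j" using assms by (simp add: good_def)
  then obtain a where a: "\<omega> j = special_block j a" "A j \<le> a" "a < 2 * A j"
    using assms by (auto simp: blocks_def)
  then show "A j \<le> \<omega> j ! r j" "\<omega> j ! r j < 2 * A j" "\<And>i. i < m \<Longrightarrow> i \<noteq> r j \<Longrightarrow> \<omega> j ! i = 1"
    "\<omega> j = special_block j (\<omega> j ! r j)"
    using special_block_nth[OF assms(2)] r[OF assms(2)] by simp_all
qed

lemma good_small: "\<omega> \<in> good \<Longrightarrow> \<not> sp j \<Longrightarrow> \<omega> j \<in> small_words m M"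
  unfolding good_def blocks_def by (metis (no_types, lifting) mem_Collect_eq)

lemma digit_block: "t < m \<Longrightarrow> digit \<omega> (j * m + t) = \<omega> j ! t"
  by (simp add: digit_def)

lemma pos_seq_digit: "\<omega> \<in> good \<Longrightarrow> pos_seq (digit \<omega>)"
  unfolding pos_seq_def digit_def
  using good_block[of \<omega>] m by (metis mod_less_divisor nth_mem pos_word_def less_le_trans zero_less_one)

lemma pref_digit_Suc:
  assumes "\<omega> \<in> good"
  shows "pref (digit \<omega>) (Suc j * m) = pref (digit \<omega>) (j * m) @ \<omega> j"
proof -
  have "pref (\<lambda>i. digit \<omega> (j * m + i)) m = \<omega> j"
    by (rule nth_equalityI) (auto simp: good_block[OF assms] digit_block)
  then show ?thesis using pref_add[of "digit \<omega>" "j * m" m] by (simp add: add.commute)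
qed

lemma weight_den_le:
  assumes u: "u \<in> blocks j"
  shows "weight j u * (2 * real (conv_den u)) powr (2 * s) \<le> cantor_ratio s m M sp A j"
proof (cases "sp j")
  case True
  then obtain a where a: "u = special_block j a" "A j \<le> a" "a < 2 * A j"
    using u by (auto simp: blocks_def)
  have "conv_den u \<le> prod_list (map Suc u)"
    using u blocks_words[of j] by (intro conv_den_le_prod) (auto simp: words_iff)
  also have "\<dots> = 2 ^ (m - 1) * Suc a"
  proof -
    have "r j + (m - 1 - r j) = m - 1" using r[OF True] by simp
    then have "(2::nat) ^ (m - 1) = 2 ^ r j * 2 ^ (m - 1 - r j)" by (metis power_add)
    then show ?thesis by (simp add: a(1) special_block_def prod_list_replicate numeral_2_eq_2 algebra_simps)
  qed
  also have "\<dots> \<le> 2 ^ (m - 1) * (2 * A j)" using a by (intro mult_le_mono2) simp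
  also have "\<dots> = 2 ^ m * A j" using m by (cases m) auto
  finally have "real (conv_den u) \<le> real (2 ^ m * A j)" by (rule of_nat_mono)
  then have "2 * real (conv_den u) \<le> 2 powr (real m + 1) * real (A j)"
    by (simp add: powr_add powr_realpow)
  then have "(2 * real (conv_den u)) powr (2 * s) \<le> (2 powr (real m + 1) * real (A j)) powr (2 * s)"
    using s by (intro powr_mono2) auto
  also have "\<dots> = 4 powr (s * (real m + 1)) * real (A j) powr (2 * s)"
  proof -
    have "(2 powr (real m + 1)) powr (2 * s) = (2 powr 2) powr (s * (real m + 1))"
      by (simp only: powr_powr) (simp add: mult_ac)
    then show ?thesis by (simp add: powr_mult)
  qed
  finally have "weight j u * (2 * real (conv_den u)) powr (2 * s) \<le>
      1 / real (A j) * (4 powr (s * (real m + 1)) * real (A j) powr (2 * s))"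
    using u True by (simp add: weight_def divide_right_mono)
  also have "\<dots> = cantor_ratio s m M sp A j"
    using True A[OF True] by (simp add: cantor_ratio_def powr_diff)
  finally show ?thesis .
next
  case False
  then have "conv_den u \<ge> 1" using u blocks_words[of j] by (intro conv_den_pos) (auto simp: words_iff)
  then have pos: "real (conv_den u) > 0" by simp
  have "(2::real) powr (2 * s) = (2 powr 2) powr s" by (simp only: powr_powr)
  then have "weight j u * (2 * real (conv_den u)) powr (2 * s) =
     4 powr s / small_sum s m M * (real (conv_den u) powr (- 2 * s) * real (conv_den u) powr (2 * s))"
    using u False by (simp add: weight_def powr_mult)
  also have "real (conv_den u) powr (- 2 * s) * real (conv_den u) powr (2 * s) = 1"
    using pos by (simp add: powr_add[symmetric])
  finally show ?thesis using False by (simp add: cantor_ratio_def)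
qed

lemma cantor_ratio_nonneg: "cantor_ratio s m M sp A j \<ge> 0"
  using small_sum_pos[OF M, of s m] by (auto simp: cantor_ratio_def)

text \<open>Mass times q^(2s) gains at most one \<open>cantor_ratio\<close> per block, as the 2 in
  \<open>conv_den_append_le\<close> is counted with the new block.\<close>

lemma weight_prefix_le:
  assumes "\<omega> \<in> good"
  shows "(\<Prod>i<j. weight i (\<omega> i)) * real (conv_den (pref (digit \<omega>) (j * m))) powr (2 * s)
    \<le> (\<Prod>i<j. cantor_ratio s m M sp A i)"
proof (induction j)
  case (Suc j)
  define Q where "Q = real (conv_den (pref (digit \<omega>) (j * m)))"
  have "conv_den (pref (digit \<omega>) (Suc j * m)) \<le> 2 * conv_den (pref (digit \<omega>) (j * m)) * conv_den (\<omega> j)"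
    unfolding pref_digit_Suc[OF assms]
    by (intro conv_den_append_le pos_word_pref pos_seq_digit good_block assms)
  then have "real (conv_den (pref (digit \<omega>) (Suc j * m))) \<le>
      real (2 * conv_den (pref (digit \<omega>) (j * m)) * conv_den (\<omega> j))"
    by (rule of_nat_mono)
  then have "real (conv_den (pref (digit \<omega>) (Suc j * m))) powr (2 * s) \<le> (Q * (2 * real (conv_den (\<omega> j)))) powr (2 * s)"
    using s by (intro powr_mono2) (auto simp: Q_def mult_ac)
  then have "real (conv_den (pref (digit \<omega>) (Suc j * m))) powr (2 * s) \<le>
      Q powr (2 * s) * (2 * real (conv_den (\<omega> j))) powr (2 * s)"
    by (simp add: powr_mult)
  then have "(\<Prod>i<Suc j. weight i (\<omega> i)) * real (conv_den (pref (digit \<omega>) (Suc j * m))) powr (2 * s) \<le>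
     (\<Prod>i<Suc j. weight i (\<omega> i)) * (Q powr (2 * s) * (2 * real (conv_den (\<omega> j))) powr (2 * s))"
    by (intro mult_left_mono prod_nonneg weight_nonneg)
  also have "\<dots> = ((\<Prod>i<j. weight i (\<omega> i)) * Q powr (2 * s)) *
      (weight j (\<omega> j) * (2 * real (conv_den (\<omega> j))) powr (2 * s))"
    by (simp add: mult_ac)
  also have "\<dots> \<le> (\<Prod>i<j. cantor_ratio s m M sp A i) * cantor_ratio s m M sp A j"
    using Suc assms unfolding Q_def
    by (intro mult_mono weight_den_le mult_nonneg_nonneg weight_nonneg prod_nonneg cantor_ratio_nonneg)
       (auto simp: good_def)
  finally show ?case by simp
qed simp

lemma weight_prefix_le':
  assumes "\<omega> \<in> good"
  shows "(\<Prod>i<j. weight i (\<omega> i)) \<le> (\<Prod>i<j. cantor_ratio s m M sp A i) *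
     real (conv_den (pref (digit \<omega>) (j * m))) powr (- 2 * s)"
proof -
  define Q where "Q = real (conv_den (pref (digit \<omega>) (j * m)))"
  have "conv_den (pref (digit \<omega>) (j * m)) \<ge> 1"
    by (intro conv_den_pos pos_word_pref pos_seq_digit assms)
  then have Q: "Q > 0" by (simp add: Q_def)
  have "(\<Prod>i<j. weight i (\<omega> i)) = ((\<Prod>i<j. weight i (\<omega> i)) * Q powr (2 * s)) * Q powr (- 2 * s)"
    using Q by (simp add: mult.assoc powr_add[symmetric])
  also have "\<dots> \<le> (\<Prod>i<j. cantor_ratio s m M sp A i) * Q powr (- 2 * s)"
    using weight_prefix_le[OF assms, of j] by (intro mult_right_mono) (auto simp: Q_def)
  finally show ?thesis by (simp add: Q_def)
qed

text \<open>The alternative does not depend on the point, so any two good points satisfy the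
  hypothesis of \<open>cf_val_dist_ge\<close> on next quotients. The first case is used at the large
  digit of a special block, the second everywhere else.\<close>

lemma digit_cases:
  "(\<forall>\<omega>\<in>good. digit \<omega> p \<ge> 2) \<or> (\<forall>\<omega>\<in>good. digit \<omega> p \<le> M)"
proof -
  define q t where "q = p div m" "t = p mod m"
  have t: "t < m" using m by (simp add: q_t_def)
  have d: "digit \<omega> p = \<omega> q ! t" for \<omega> by (simp add: digit_def q_t_def)
  show ?thesis
  proof (cases "sp q")
    case True
    show ?thesis
    proof (cases "t = r q")
      case t_eq: True
      then have "digit \<omega> p \<ge> 2" if "\<omega> \<in> good" for \<omega>
        using good_special(1)[OF that True] A[OF True] by (simp add: d)
      then show ?thesis by blast
    next
      case False
      then have "digit \<omega> p \<le> M" if "\<omega> \<in> good" for \<omega>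
        using good_special(3)[OF that True t] M by (simp add: d)
      then show ?thesis by blast
    qed
  next
    case False
    have "digit \<omega> p \<le> M" if "\<omega> \<in> good" for \<omega>
    proof -
      have "\<omega> q \<in> small_words m M" using good_small that False by blast
      moreover have "\<omega> q ! t \<in> set (\<omega> q)" using good_block[OF that] t by simp
      ultimately show ?thesis by (auto simp: small_words_def d)
    qed
    then show ?thesis by blast
  qed
qed

text \<open>One constant for both kinds of blocks: 4 (M + 1)^(2m + 1) comes from
  \<open>dist_cf_val_ge_prefix\<close>, 9 from d + 2 <= 3 A for a large digit d, and (M + 2)^2 from
  d + 2 <= M + 2 for an ordinary one.\<close>

definition dist_const :: real where
  "dist_const = 36 * real (M + 1) ^ (2 * m + 1) * (real M + 2)\<^sup>2"

lemma dist_const_pos: "dist_const > 0"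
  by (simp add: dist_const_def add_pos_nonneg)

lemma point_dist_ge:
  assumes \<omega>: "\<omega> \<in> good" and \<eta>: "\<eta> \<in> good" and eq: "\<And>i. i < j \<Longrightarrow> \<omega> i = \<eta> i" and ne: "\<omega> j \<noteq> \<eta> j"
  defines "Q \<equiv> real (conv_den (pref (digit \<omega>) (j * m)))"
  shows "sp j \<Longrightarrow> \<bar>real (\<omega> j ! r j) - real (\<eta> j ! r j)\<bar> / (dist_const * Q\<^sup>2 * (real (A j))\<^sup>2)
      \<le> \<bar>point \<omega> - point \<eta>\<bar>"
    and "\<not> sp j \<Longrightarrow> 1 / (dist_const * Q\<^sup>2) \<le> \<bar>point \<omega> - point \<eta>\<bar>"
proof -
  \<comment> \<open>First disagreement inside the block. In a special block all digits but one are
    1, so there it is the large digit.\<close>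
  define t where "t = (LEAST t. \<omega> j ! t \<noteq> \<eta> j ! t)"
  have len: "length (\<omega> j) = m" "length (\<eta> j) = m" using good_block \<omega> \<eta> by auto
  then obtain t0 where t0: "t0 < m" "\<omega> j ! t0 \<noteq> \<eta> j ! t0"
    using ne by (metis nth_equalityI)
  have t_ne: "\<omega> j ! t \<noteq> \<eta> j ! t" unfolding t_def by (rule LeastI[of _ t0]) (rule t0)
  have "t \<le> t0" unfolding t_def by (rule Least_le) (rule t0)
  then have t: "t < m" using t0 by simp
  have t_eq: "\<omega> j ! i = \<eta> j ! i" if "i < t" for i
    using not_less_Least[of i "\<lambda>t. \<omega> j ! t \<noteq> \<eta> j ! t"] that by (auto simp: t_def)
  have sp_t: "t = r j" if "sp j"
  proof (rule ccontr)
    assume "t \<noteq> r j"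
    then have "\<omega> j ! t = 1" "\<eta> j ! t = 1"
      using good_special(3)[OF _ that t] \<omega> \<eta> by auto
    then show False using t_ne by simp
  qed
  have same: "digit \<omega> i = digit \<eta> i" if "i < j * m + t" for i
  proof (cases "i < j * m")
    case True
    then have "i div m < j" using m by (simp add: div_less_iff_less_mult)
    then show ?thesis by (simp add: digit_def eq)
  next
    case False
    then have "digit \<omega> (j * m + (i - j * m)) = digit \<eta> (j * m + (i - j * m))"
      using that t by (subst (1 2) digit_block) (auto intro: t_eq)
    then show ?thesis using False by simp
  qed
  have small: "digit \<omega> (j * m + i) \<le> M" if "i < t" for i
  proof (cases "sp j")
    case True
    then show ?thesis
      using good_special(3)[OF \<omega> True, of i] that t M sp_t by (simp add: digit_block)
  next
    case False
    then have "\<omega> j \<in> small_words m M" "\<omega> j ! i \<in> set (\<omega> j)"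
      using good_small[OF \<omega>] that t len by auto
    then show ?thesis using that t by (auto simp: digit_block small_words_def)
  qed
  have next_digit: "2 \<le> digit \<omega> (Suc (j * m + t)) \<and> 2 \<le> digit \<eta> (Suc (j * m + t)) \<or>
      digit \<omega> (Suc (j * m + t)) \<le> M \<and> digit \<eta> (Suc (j * m + t)) \<le> M"
    using digit_cases \<omega> \<eta> by blast
  define d d' where "d = real (\<omega> j ! t)" "d' = real (\<eta> j ! t)"
  define K where "K = 4 * real (M + 1) ^ (2 * m + 1)"
  have K: "K > 0" "dist_const = K * 9 * (real M + 2)\<^sup>2" by (auto simp: K_def dist_const_def)
  have "conv_den (pref (digit \<omega>) (j * m)) \<ge> 1"
    by (intro conv_den_pos pos_word_pref pos_seq_digit \<omega>)
  then have Q: "Q > 0" by (simp add: Q_def)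
  have main: "\<bar>d - d'\<bar> / (K * Q\<^sup>2 * ((d + 2) * (d' + 2))) \<le> \<bar>point \<omega> - point \<eta>\<bar>"
    using dist_cf_val_ge_prefix[OF pos_seq_digit[OF \<omega>] pos_seq_digit[OF \<eta>], of "j * m" t M m]
      same next_digit M t small t_ne
    by (simp add: digit_block d_d'_def Q_def K_def)
  have one: "\<bar>d - d'\<bar> \<ge> 1" using t_ne by (auto simp: d_d'_def)
  \<comment> \<open>Both claims follow from \<open>main\<close> by bounding (d + 2) (d' + 2), with E
    = A^2 in a special block and E = 1 in an ordinary one.\<close>
  have weaken: "e / (dist_const * Q\<^sup>2 * E) \<le> \<bar>point \<omega> - point \<eta>\<bar>"
    if "(d + 2) * (d' + 2) \<le> 9 * (real M + 2)\<^sup>2 * E" "0 \<le> e" "e \<le> \<bar>d - d'\<bar>" for e E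
  proof -
    have "K * Q\<^sup>2 * ((d + 2) * (d' + 2)) \<le> K * Q\<^sup>2 * (9 * (real M + 2)\<^sup>2 * E)"
      using that K by (intro mult_left_mono) auto
    moreover have "0 < K * Q\<^sup>2 * ((d + 2) * (d' + 2))"
      using K Q by (auto simp: d_d'_def intro!: mult_pos_pos add_nonneg_pos)
    ultimately have "e / (K * Q\<^sup>2 * (9 * (real M + 2)\<^sup>2 * E)) \<le> \<bar>d - d'\<bar> / (K * Q\<^sup>2 * ((d + 2) * (d' + 2)))"
      using that by (intro frac_le) auto
    then show ?thesis using main by (simp add: K(2) mult_ac)
  qed
  show "\<bar>real (\<omega> j ! r j) - real (\<eta> j ! r j)\<bar> / (dist_const * Q\<^sup>2 * (real (A j))\<^sup>2)
      \<le> \<bar>point \<omega> - point \<eta>\<bar>" if "sp j"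
  proof -
    have "\<omega> j ! t < 2 * A j" "\<eta> j ! t < 2 * A j"
      using good_special(2)[OF _ that] \<omega> \<eta> sp_t[OF that] by auto
    then have "d + 2 \<le> 3 * real (A j)" "d' + 2 \<le> 3 * real (A j)"
      using A[OF that] by (auto simp: d_d'_def)
    then have "(d + 2) * (d' + 2) \<le> (3 * real (A j)) * (3 * real (A j))"
      by (intro mult_mono) (auto simp: d_d'_def)
    also have "\<dots> = 9 * 1 * (real (A j))\<^sup>2" by (simp add: power2_eq_square)
    also have "\<dots> \<le> 9 * (real M + 2)\<^sup>2 * (real (A j))\<^sup>2"
      by (intro mult_right_mono mult_left_mono) (auto simp: one_le_power)
    finally show ?thesis using weaken[of "(real (A j))\<^sup>2" "\<bar>d - d'\<bar>"] sp_t[OF that]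
      by (simp add: d_d'_def)
  qed
  show "1 / (dist_const * Q\<^sup>2) \<le> \<bar>point \<omega> - point \<eta>\<bar>" if "\<not> sp j"
  proof -
    have "\<omega> j \<in> small_words m M" "\<omega> j ! t \<in> set (\<omega> j)" "\<eta> j \<in> small_words m M" "\<eta> j ! t \<in> set (\<eta> j)"
      using good_small[OF _ that] \<omega> \<eta> t len by auto
    then have "d + 2 \<le> real M + 2" "d' + 2 \<le> real M + 2"
      by (auto simp: d_d'_def small_words_def)
    then have "(d + 2) * (d' + 2) \<le> (real M + 2) * (real M + 2)"
      by (intro mult_mono) (auto simp: d_d'_def)
    also have "\<dots> \<le> 9 * (real M + 2)\<^sup>2 * 1" by (simp add: power2_eq_square)
    finally show ?thesis using weaken[of 1 1] one by simp
  qed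
qed

section \<open>Mass of a set in terms of its diameter\<close>

lemma C_pos: "C > 0"
  using bound[of 0] by simp

lemma conv_den_tendsto_0:
  assumes "\<omega> \<in> good"
  shows "(\<lambda>j. real (conv_den (pref (digit \<omega>) (j * m))) powr (- 2 * s)) \<longlonglongrightarrow> 0"
proof -
  have "(\<lambda>n. (1 / (real (conv_den (pref (digit \<omega>) n)))\<^sup>2) powr s) \<longlonglongrightarrow> 0"
    using s by (intro tendsto_zero_powrI[OF inverse_den_tendsto[OF pos_seq_digit[OF assms]] tendsto_const])
      auto
  moreover have "filterlim (\<lambda>j. j * m) sequentially sequentially"
    using m by (intro filterlim_subseq) (auto simp: strict_mono_def)
  ultimately have "(\<lambda>j. (1 / (real (conv_den (pref (digit \<omega>) (j * m))))\<^sup>2) powr s) \<longlonglongrightarrow> 0"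
    by (rule filterlim_compose)
  moreover have "(1 / (real (conv_den (pref (digit \<omega>) (j * m))))\<^sup>2) powr s =
      real (conv_den (pref (digit \<omega>) (j * m))) powr (- 2 * s)" for j
  proof -
    have "conv_den (pref (digit \<omega>) (j * m)) \<ge> 1"
      by (intro conv_den_pos pos_word_pref pos_seq_digit assms)
    then have q: "real (conv_den (pref (digit \<omega>) (j * m))) > 0" by simp
    show ?thesis
      using q by (simp add: powr_divide powr_minus_divide power2_powr)
  qed
  ultimately show ?thesis by simp
qed

text \<open>A covering set that contains a single point may have diameter 0, so the mass of a point
  has to vanish exactly. It is at most C q^(-2s) for every prefix, and q tends to infinity.\<close>

lemma point_mass_0:
  assumes "\<omega> \<in> good"
  shows "\<exists>Z\<in>sets Pr. \<omega> \<in> Z \<and> emeasure Pr Z = 0"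
proof (intro bexI conjI)
  define Z where "Z = (\<Inter>j. cylinder \<omega> j UNIV)"
  show "\<omega> \<in> Z" by (simp add: Z_def cylinder_def)
  show sets: "Z \<in> sets Pr" unfolding Z_def by (intro sets.countable_INT) (auto intro: cylinder_sets)
  have le: "emeasure Pr Z \<le> ennreal (C * real (conv_den (pref (digit \<omega>) (j * m))) powr (- 2 * s))" for j
  proof -
    have "emeasure Pr Z \<le> emeasure Pr (cylinder \<omega> j UNIV)"
      by (rule emeasure_mono[OF _ cylinder_sets]) (auto simp: Z_def)
    also have "\<dots> = ennreal (\<Prod>i<j. weight i (\<omega> i))"
      by (simp add: emeasure_cylinder measure_pmf.prob_space[simplified])
    also have "\<dots> \<le> ennreal (C * real (conv_den (pref (digit \<omega>) (j * m))) powr (- 2 * s))"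
      using weight_prefix_le'[OF assms, of j] mult_right_mono[OF bound[of j],
          of "real (conv_den (pref (digit \<omega>) (j * m))) powr (- 2 * s)"]
      by (intro ennreal_leI) auto
    finally show ?thesis .
  qed
  have "(\<lambda>j. ennreal (C * real (conv_den (pref (digit \<omega>) (j * m))) powr (- 2 * s))) \<longlonglongrightarrow> ennreal (C * 0)"
    by (intro tendsto_ennrealI tendsto_mult_left conv_den_tendsto_0 assms)
  then have "emeasure Pr Z \<le> ennreal (C * 0)"
    by (rule LIMSEQ_le_const) (use le in blast)
  then show "emeasure Pr Z = 0" by simp
qed

text \<open>Let \<open>j\<close> be the first block in which the points of \<open>U\<close> disagree. If it is special and their digits
  there spread over \<open>D\<close> then \<open>U\<close> has mass about \<open>D / A\<close> times that of the common cylinder, and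
  diameter about \<open>D / A\<^sup>2\<close> times that of the cylinder; \<open>D \<le> A\<close> and \<open>s \<le> 1\<close> give the estimate.\<close>

lemma special_estimate:
  fixes D Q a K :: real
  assumes "0 < D" "D \<le> a" "0 < Q" "0 < K"
  shows "C * a powr (- s) * Q powr (- 2 * s) * (2 * D / a) \<le>
    2 * C * K powr s * (D / (K * Q\<^sup>2 * a\<^sup>2)) powr s"
proof -
  have a: "a > 0" using assms by simp
  have "(D / (K * Q\<^sup>2 * a\<^sup>2)) powr s = D powr s / (K powr s * Q powr (2 * s) * a powr (2 * s))"
    using assms a by (simp add: powr_divide powr_mult power2_powr)
  then have rhs: "2 * C * K powr s * (D / (K * Q\<^sup>2 * a\<^sup>2)) powr s =
      2 * C * (D powr s * Q powr (- 2 * s) * a powr (- 2 * s))"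
    using assms by (simp add: powr_minus divide_inverse)
  have "D powr (1 - s) \<le> a powr (1 - s)" using assms s by (intro powr_mono2) auto
  then have "D powr s * D powr (1 - s) * (a powr (- s) * a powr (-1)) \<le>
      D powr s * a powr (1 - s) * (a powr (- s) * a powr (-1))"
    by (intro mult_right_mono mult_left_mono) auto
  also have "D powr s * D powr (1 - s) = D" using assms by (simp add: powr_add[symmetric])
  also have "D powr s * a powr (1 - s) * (a powr (- s) * a powr (-1)) = D powr s * a powr (- 2 * s)"
    by (simp only: mult.assoc powr_add[symmetric]) simp
  finally have "D * (a powr (- s) / a) \<le> D powr s * a powr (- 2 * s)"
    using a by (simp add: powr_minus_divide)
  then have "2 * C * Q powr (- 2 * s) * (D * (a powr (- s) / a)) \<le>
      2 * C * Q powr (- 2 * s) * (D powr s * a powr (- 2 * s))"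
    using C_pos by (intro mult_left_mono) auto
  then show ?thesis unfolding rhs by (simp add: mult_ac)
qed

text \<open>The points of \<open>U\<close> share all blocks before the first one in which some two
  of them disagree. If that block is ordinary, \<open>U\<close> has diameter at least of order
  q^(-2) and \<open>bound\<close> suffices; if it is special, \<open>bound_special\<close> is
  combined with the spread of the large digit.\<close>

lemma cover_by_cylinder:
  assumes U: "bounded U"
  shows "\<exists>Z\<in>sets Pr. (\<forall>\<omega>\<in>good. point \<omega> \<in> U \<longrightarrow> \<omega> \<in> Z) \<and>
    emeasure Pr Z \<le> ennreal (2 * C * dist_const powr s) * diam_pow s U"
proof -
  define V where "V = {\<omega> \<in> good. point \<omega> \<in> U}"
  define K where "K = dist_const"
  have K: "K > 0" by (simp add: K_def dist_const_pos)
  have diam: "\<bar>point \<omega> - point \<eta>\<bar> \<le> diameter U" if "\<omega> \<in> V" "\<eta> \<in> V" for \<omega> \<eta>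
    using diameter_bounded_bound[OF U, of "point \<omega>" "point \<eta>"] that by (simp add: V_def dist_real_def)
  consider "V = {}" | \<omega> where "V = {\<omega>}" | \<omega> \<eta> where "\<omega> \<in> V" "\<eta> \<in> V" "\<omega> \<noteq> \<eta>"
    by blast
  then show ?thesis
  proof cases
    case 1
    then show ?thesis by (intro bexI[of _ "{}"]) (auto simp: V_def)
  next
    case (2 \<omega>)
    then obtain Z where "Z \<in> sets Pr" "\<omega> \<in> Z" "emeasure Pr Z = 0"
      using point_mass_0[of \<omega>] by (auto simp: V_def)
    then show ?thesis using 2 by (intro bexI[of _ Z]) (auto simp: V_def)
  next
    case (3 \<omega>1 \<omega>2)
    define dis where "dis j \<longleftrightarrow> (\<exists>\<omega>\<in>V. \<exists>\<eta>\<in>V. \<omega> j \<noteq> \<eta> j)" for j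
    define j where "j = (LEAST j. dis j)"
    obtain j0 where "\<omega>1 j0 \<noteq> \<omega>2 j0" using 3(3) by blast
    then have "dis j0" using 3 by (auto simp: dis_def)
    then have "dis j" unfolding j_def by (rule LeastI)
    have agree: "\<omega> i = \<eta> i" if "\<omega> \<in> V" "\<eta> \<in> V" "i < j" for \<omega> \<eta> i
      using not_less_Least[of i dis] that by (auto simp: j_def dis_def)
    obtain \<omega> \<eta> where \<omega>: "\<omega> \<in> V" and \<eta>: "\<eta> \<in> V" and ne: "\<omega> j \<noteq> \<eta> j"
      using \<open>dis j\<close> by (auto simp: dis_def)
    have good: "\<omega> \<in> good" "\<eta> \<in> good" using \<omega> \<eta> by (auto simp: V_def)
    define Q where "Q = real (conv_den (pref (digit \<omega>) (j * m)))"
    have "conv_den (pref (digit \<omega>) (j * m)) \<ge> 1"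
      by (intro conv_den_pos pos_word_pref pos_seq_digit good)
    then have Q: "Q > 0" by (simp add: Q_def)
    note wt = weight_prefix_le'[OF good(1), of j, folded Q_def]
    have "U \<noteq> {}" using \<omega> by (auto simp: V_def)
    then have dp: "diam_pow s U = ennreal (diameter U powr s)" using s by (simp add: diam_pow_def)
    have dU: "diameter U \<ge> 0" by (rule diameter_ge_0[OF U])
    show ?thesis
    proof (cases "sp j")
      case False
      define Z where "Z = cylinder \<omega> j UNIV"
      have "1 / (K * Q\<^sup>2) \<le> diameter U"
        using point_dist_ge(2)[OF good agree[OF \<omega> \<eta>] ne False] diam[OF \<omega> \<eta>]
        by (simp add: K_def Q_def)
      then have "(1 / (K * Q\<^sup>2)) powr s \<le> diameter U powr s"
        using s K by (intro powr_mono2) auto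
      moreover have "(1 / (K * Q\<^sup>2)) powr s = Q powr (- 2 * s) / K powr s"
        using K Q by (simp add: powr_divide powr_mult powr_minus_divide power2_powr)
      ultimately have le: "Q powr (- 2 * s) \<le> K powr s * diameter U powr s"
        using K by (simp add: divide_le_eq mult.commute)
      have "(\<Prod>i<j. weight i (\<omega> i)) \<le> C * Q powr (- 2 * s)"
        using wt mult_right_mono[OF bound[of j], of "Q powr (- 2 * s)"] by simp
      also have "\<dots> \<le> C * (K powr s * diameter U powr s)"
        using C_pos le by (intro mult_left_mono) auto
      also have "\<dots> \<le> 2 * C * K powr s * diameter U powr s" using C_pos by simp
      finally have "emeasure Pr Z \<le> ennreal (2 * C * K powr s * diameter U powr s)"
        unfolding Z_def emeasure_cylinder by (intro ennreal_leI) (simp add: measure_pmf.prob_space[simplified])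
      also have "\<dots> = ennreal (2 * C * K powr s) * diam_pow s U"
        using C_pos by (simp add: dp ennreal_mult)
      finally have em: "emeasure Pr Z \<le> ennreal (2 * C * K powr s) * diam_pow s U" .
      have "\<zeta> \<in> Z" if "\<zeta> \<in> good" "point \<zeta> \<in> U" for \<zeta>
        using agree[of \<zeta> \<omega>] that \<omega> by (simp add: V_def Z_def cylinder_def)
      then show ?thesis using em cylinder_sets unfolding K_def Z_def by blast
    next
      case True
      define S where "S = (\<lambda>\<omega>. \<omega> j ! r j) ` V"
      have S: "A j \<le> a \<and> a < 2 * A j" if "a \<in> S" for a
        using that good_special(1,2)[OF _ True] by (auto simp: S_def V_def)
      then have "S \<subseteq> {..<2 * A j}" by auto
      then have fin: "finite S" by (rule finite_subset) simp
      have "S \<noteq> {}" using \<omega> by (auto simp: S_def)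
      \<comment> \<open>Both extremes are attained, so the distance of two actual points bounds the
        diameter from below, while the large digits of all points of \<open>U\<close> lie between
        them.\<close>
      define lo hi where "lo = Min S" "hi = Max S"
      have "lo \<in> S" "hi \<in> S" using fin \<open>S \<noteq> {}\<close> by (auto simp: lo_hi_def)
      then obtain \<omega>l \<omega>h where l: "\<omega>l \<in> V" "lo = \<omega>l j ! r j" and h: "\<omega>h \<in> V" "hi = \<omega>h j ! r j"
        by (auto simp: S_def)
      have range: "lo \<le> a \<and> a \<le> hi" if "a \<in> S" for a using fin that by (auto simp: lo_hi_def)
      have "lo < hi"
      proof (rule ccontr)
        assume "\<not> lo < hi"
        then have "\<omega> j ! r j = \<eta> j ! r j"
          using range[of "\<omega> j ! r j"] range[of "\<eta> j ! r j"] \<omega> \<eta> by (auto simp: S_def)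
        then show False using ne good_special(4)[OF good(1) True] good_special(4)[OF good(2) True] by metis
      qed
      define D where "D = real hi - real lo"
      have D: "D \<ge> 1" "D \<le> real (A j)"
        using \<open>lo < hi\<close> S[OF \<open>lo \<in> S\<close>] S[OF \<open>hi \<in> S\<close>] by (auto simp: D_def)
      have goodlh: "\<omega>l \<in> good" "\<omega>h \<in> good" using l h by (auto simp: V_def)
      have ne': "\<omega>h j \<noteq> \<omega>l j" using l h \<open>lo < hi\<close> by auto
      have "pref (digit \<omega>h) (j * m) = pref (digit \<omega>) (j * m)"
        using agree[OF h(1) \<omega>] m by (auto simp: digit_def div_less_iff_less_mult)
      then have Qh: "real (conv_den (pref (digit \<omega>h) (j * m))) = Q" unfolding Q_def by (rule arg_cong)
      have "D / (K * Q\<^sup>2 * (real (A j))\<^sup>2) \<le> diameter U"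
        using point_dist_ge(1)[OF goodlh(2,1) agree[OF h(1) l(1)] ne' True] diam[OF h(1) l(1)]
          \<open>lo < hi\<close> l h
        by (simp add: K_def Qh D_def)
      then have powD: "(D / (K * Q\<^sup>2 * (real (A j))\<^sup>2)) powr s \<le> diameter U powr s"
        using s K D by (intro powr_mono2) auto
      define T where "T = special_block j ` {lo..hi}"
      define Z where "Z = cylinder \<omega> j T"
      have "measure (law j) T = (\<Sum>u\<in>T. weight j u)"
        by (subst measure_measure_pmf_finite) (auto simp: T_def pmf_law)
      also have "\<dots> \<le> (\<Sum>u\<in>T. 1 / real (A j))"
        using True by (intro sum_mono) (auto simp: weight_def)
      also have "\<dots> = real (card T) / real (A j)" by simp
      also have "\<dots> \<le> real (card {lo..hi}) / real (A j)"
        unfolding T_def by (intro divide_right_mono of_nat_mono card_image_le) auto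
      also have "real (card {lo..hi}) = D + 1" using \<open>lo < hi\<close> by (simp add: D_def)
      also have "(D + 1) / real (A j) \<le> 2 * D / real (A j)" using D by (intro divide_right_mono) auto
      finally have meas: "measure (law j) T \<le> 2 * D / real (A j)" .
      have "(\<Prod>i<j. weight i (\<omega> i)) \<le> C * real (A j) powr (- s) * Q powr (- 2 * s)"
        using wt mult_right_mono[OF bound_special[OF True], of "Q powr (- 2 * s)"] by simp
      then have "(\<Prod>i<j. weight i (\<omega> i)) * measure (law j) T \<le>
          C * real (A j) powr (- s) * Q powr (- 2 * s) * (2 * D / real (A j))"
        using meas C_pos by (intro mult_mono) auto
      also have "\<dots> \<le> 2 * C * K powr s * (D / (K * Q\<^sup>2 * (real (A j))\<^sup>2)) powr s"
        using D Q K by (intro special_estimate) auto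
      also have "\<dots> \<le> 2 * C * K powr s * diameter U powr s"
        using powD C_pos by (intro mult_left_mono) auto
      finally have "emeasure Pr Z \<le> ennreal (2 * C * K powr s * diameter U powr s)"
        unfolding Z_def emeasure_cylinder by (rule ennreal_leI)
      also have "\<dots> = ennreal (2 * C * K powr s) * diam_pow s U"
        using C_pos by (simp add: dp ennreal_mult)
      finally have em: "emeasure Pr Z \<le> ennreal (2 * C * K powr s) * diam_pow s U" .
      have "\<zeta> \<in> Z" if "\<zeta> \<in> good" "point \<zeta> \<in> U" for \<zeta>
      proof -
        have \<zeta>: "\<zeta> \<in> V" using that by (simp add: V_def)
        then have "\<zeta> j ! r j \<in> {lo..hi}" using range by (auto simp: S_def)
        then have "\<zeta> j \<in> T" using good_special(4)[OF that(1) True] unfolding T_def by blast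
        then show ?thesis using agree[OF \<zeta> \<omega>] by (simp add: Z_def cylinder_def)
      qed
      then show ?thesis using em cylinder_sets unfolding K_def Z_def by blast
    qed
  qed
qed

lemma hausdorff_measure_pos:
  assumes E: "\<And>a. pos_seq a \<Longrightarrow> (\<And>j. sp j \<Longrightarrow> A j \<le> a (j * m + r j)) \<Longrightarrow> cf_val a \<in> E"
  shows "hausdorff_measure s E \<noteq> 0"
proof (rule mass_distribution[where Pr = Pr and X = point])
  show "prob_space Pr" by (rule PP.P.prob_space_axioms)
  show "AE \<omega> in Pr. \<omega> \<in> good" by (rule AE_good)
  show "0 < 2 * C * dist_const powr s" using C_pos dist_const_pos by simp
  show "point \<omega> \<in> E" if "\<omega> \<in> good" for \<omega>
    using good_special(1)[OF that] r by (intro E pos_seq_digit that) (simp add: digit_block)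
qed (rule cover_by_cylinder)

end

section \<open>Lower bounds\<close>

lemma eventually_decreasing_bounded:
  fixes f :: "nat \<Rightarrow> real"
  assumes "\<And>j. j \<ge> J \<Longrightarrow> f (Suc j) \<le> f j"
  shows "\<exists>C. \<forall>j. f j \<le> C"
proof -
  define C where "C = Max (f ` {..J})"
  have C: "f j \<le> C" if "j \<le> J" for j unfolding C_def using that by (intro Max_ge) auto
  have "f (J + k) \<le> C" for k
  proof (induction k)
    case (Suc k)
    then show ?case using assms[of "J + k"] by simp
  qed (simp add: C)
  then have "f j \<le> C" for j using C[of j] by (cases "j \<le> J") (metis le_add_diff_inverse nat_le_linear)+
  then show ?thesis by blast
qed

lemma filterlim_power_at_top: "1 < x \<Longrightarrow> filterlim (\<lambda>n. x ^ n) at_top sequentially" for x :: real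
  by (rule filterlim_at_infinity_imp_filterlim_at_top)
     (auto intro: filterlim_realpow_sequentially_gt1)

text \<open>Blocks have length 1 and are all special: each quotient is prescribed up to a factor 2.
  As \<open>A (Suc j)\<close> is about the c-th power of \<open>A j\<close>, one step multiplies
  \<open>R j * A j powr s\<close> by about A^(2s - 1) A^(cs) / A^s = A^(s (c + 1) - 1), which tends
  to 0.\<close>

lemma hausdorff_measure_doubly_exponential:
  assumes c: "c > 1" and s: "s > 0" "s * (c + 1) < 1"
    and E: "\<And>a. pos_seq a \<Longrightarrow> (\<And>j. exp (c ^ Suc j) \<le> real (a j)) \<Longrightarrow> cf_val a \<in> E"
  shows "hausdorff_measure s E \<noteq> 0"
proof -
  define A where "A j = nat \<lceil>exp (c ^ Suc j)\<rceil>" for j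
  have e1: "exp (c ^ Suc j) \<ge> 2" for j
  proof -
    have "c ^ Suc j \<ge> 1" using c by (intro one_le_power) simp
    then show ?thesis using exp_ge_add_one_self[of "c ^ Suc j"] by linarith
  qed
  have A_ge: "exp (c ^ Suc j) \<le> real (A j)" for j unfolding A_def by linarith
  have A_le: "real (A j) \<le> 2 * exp (c ^ Suc j)" for j
    using e1[of j] unfolding A_def by linarith
  have A2: "real (A j) \<ge> 2" for j using A_ge[of j] e1[of j] by linarith
  have s1: "s < 1" using s c by (smt (verit) mult_less_cancel_left2)
  define \<eta> where "\<eta> = 1 - s * (c + 1)"
  have \<eta>: "\<eta> > 0" using s by (simp add: \<eta>_def)
  define R where "R j = (\<Prod>i<j. cantor_ratio s 1 1 (\<lambda>_. True) A i)" for j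
  have R0: "R j \<ge> 0" for j unfolding R_def by (intro prod_nonneg) (simp add: cantor_ratio_def)
  \<comment> \<open>32 = 16 * 2 collects the constants: \<open>4 powr (2 * s)\<close> from
    \<open>cantor_ratio\<close> with m = 1, and \<open>2 powr s\<close> from rounding
    \<open>A (Suc j)\<close> up.\<close>
  have "\<forall>\<^sub>F j in sequentially. 32 powr s \<le> real (A j) powr \<eta>"
  proof -
    have "filterlim (\<lambda>j. real (A j)) at_top sequentially"
    proof (rule filterlim_at_top_mono)
      have "filterlim (\<lambda>j. c ^ Suc j) at_top sequentially"
        using filterlim_compose[OF filterlim_power_at_top[OF c] filterlim_Suc] by simp
      then show "filterlim (\<lambda>j. exp (c ^ Suc j)) at_top sequentially"
        by (rule filterlim_compose[OF exp_at_top])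
    qed (use A_ge in auto)
    then have "\<forall>\<^sub>F j in sequentially. (32 powr s) powr (1 / \<eta>) \<le> real (A j)"
      unfolding filterlim_at_top by blast
    then show ?thesis
    proof eventually_elim
      case (elim j)
      then have "((32 powr s) powr (1 / \<eta>)) powr \<eta> \<le> real (A j) powr \<eta>"
        using \<eta> by (intro powr_mono2) auto
      then show ?case using \<eta> by (simp add: powr_powr)
    qed
  qed
  then obtain J where J: "\<And>j. j \<ge> J \<Longrightarrow> 32 powr s \<le> real (A j) powr \<eta>"
    by (auto simp: eventually_sequentially)
  have "R (Suc j) * real (A (Suc j)) powr s \<le> R j * real (A j) powr s" if "j \<ge> J" for j
  proof -
    have "exp (c ^ Suc (Suc j)) = exp (c ^ Suc j) powr c" by (simp add: powr_def)
    also have "\<dots> \<le> real (A j) powr c" using c A_ge by (intro powr_mono2) auto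
    finally have "real (A (Suc j)) \<le> 2 * real (A j) powr c" using A_le[of "Suc j"] by linarith
    then have "real (A (Suc j)) powr s \<le> (2 * real (A j) powr c) powr s"
      using s by (intro powr_mono2) auto
    also have "\<dots> = 2 powr s * real (A j) powr (c * s)" by (simp add: powr_mult powr_powr)
    finally have "R (Suc j) * real (A (Suc j)) powr s \<le> R (Suc j) * (2 powr s * real (A j) powr (c * s))"
      using R0 by (intro mult_left_mono) auto
    also have "\<dots> = R j * (4 powr (s * 2) * 2 powr s) * (real (A j) powr (2 * s - 1) * real (A j) powr (c * s))"
      by (simp add: R_def cantor_ratio_def)
    also have "real (A j) powr (2 * s - 1) * real (A j) powr (c * s) = real (A j) powr s * real (A j) powr (- \<eta>)"
      unfolding powr_add[symmetric] by (rule arg_cong) (simp add: \<eta>_def algebra_simps)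
    also have "4 powr (s * 2) * 2 powr s = (32::real) powr s"
    proof -
      have "(4::real) powr (s * 2) = 16 powr s" using powr_powr[of "4::real" 2 s] by (simp add: mult.commute)
      then show ?thesis by (simp add: powr_mult[symmetric])
    qed
    also have "R j * 32 powr s * (real (A j) powr s * real (A j) powr (- \<eta>)) \<le>
        R j * real (A j) powr \<eta> * (real (A j) powr s * real (A j) powr (- \<eta>))"
      using J[OF that] R0 by (intro mult_right_mono mult_left_mono) auto
    also have "\<dots> = R j * real (A j) powr s"
      using A2[of j] by (simp add: powr_minus)
    finally show ?thesis .
  qed
  then obtain C where C: "\<And>j. R j * real (A j) powr s \<le> C"
    using eventually_decreasing_bounded[of J "\<lambda>j. R j * real (A j) powr s"] by blast
  have Rs: "R j \<le> C * real (A j) powr (- s)" for j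
  proof -
    have "R j = (R j * real (A j) powr s) * real (A j) powr (- s)" using A2[of j] by (simp add: powr_minus)
    also have "\<dots> \<le> C * real (A j) powr (- s)" by (intro mult_right_mono C) simp
    finally show ?thesis .
  qed
  have "0 \<le> C" using C[of 0] R0[of 0] by (smt (verit) mult_nonneg_nonneg powr_ge_zero)
  have R: "R j \<le> C" for j
  proof -
    have "real (A j) powr (- s) \<le> real (A j) powr 0" using A2[of j] s by (intro powr_mono) auto
    also have "\<dots> = 1" using A2[of j] by simp
    finally have "C * real (A j) powr (- s) \<le> C * 1" using \<open>0 \<le> C\<close> by (intro mult_left_mono)
    then show ?thesis using Rs[of j] by simp
  qed
  interpret cf_cantor s C 1 1 "\<lambda>_. True" "\<lambda>_. 0" A
  proof
    show "A j \<ge> 2" for j using A2[of j] by simp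
  qed (use s s1 R Rs in \<open>simp_all add: R_def\<close>)
  show ?thesis
  proof (rule hausdorff_measure_pos)
    fix a assume a: "pos_seq a" "\<And>j. True \<Longrightarrow> A j \<le> a (j * 1 + 0)"
    have "exp (c ^ Suc j) \<le> real (a j)" for j
      using A_ge[of j] a(2)[of j] by (simp del: power_Suc)
    then show "cf_val a \<in> E" using a(1) by (rule E[rotated])
  qed
qed

text \<open>Finitely many words come close to the full sum, and they use finitely many
  letters.\<close>

lemma ex_small_sum_gt:
  assumes "s > 1/2" "x < part_fun m s"
  shows "\<exists>M\<ge>1. x < small_sum s m M"
proof -
  define e where "e = (part_fun m s - x) / 2"
  have e: "e > 0" using assms by (simp add: e_def)
  obtain F where F: "finite F" "F \<subseteq> words m"
    "dist (\<Sum>u\<in>F. real (conv_den u) powr (- 2 * s)) (part_fun m s) \<le> e"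
    using infsum_finite_approximation[OF part_fun_summable[OF assms(1), of m] e]
    unfolding part_fun_def by blast
  define M where "M = Max (insert 1 (\<Union>u\<in>F. set u))"
  have fin: "finite (insert 1 (\<Union>u\<in>F. set u))" using F by simp
  have "M \<ge> 1" unfolding M_def by (rule Max_ge[OF fin]) simp
  have "F \<subseteq> small_words m M"
  proof
    fix u assume u: "u \<in> F"
    have "d \<le> M" if "d \<in> set u" for d
      unfolding M_def by (rule Max_ge[OF fin]) (use that u in blast)
    then show "u \<in> small_words m M" using F u by (auto simp: small_words_def)
  qed
  then have "(\<Sum>u\<in>F. real (conv_den u) powr (- 2 * s)) \<le> small_sum s m M"
    unfolding small_sum_def by (intro sum_mono2 finite_small_words) auto
  moreover have "x < S" if "dist S (part_fun m s) \<le> e" for S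
    using that e abs_ge_minus_self[of "S - part_fun m s"] by (simp add: e_def dist_real_def)
  from this[OF F(3)] have "x < (\<Sum>u\<in>F. real (conv_den u) powr (- 2 * s))" .
  ultimately show ?thesis using \<open>M \<ge> 1\<close> by (intro exI[of _ M]) auto
qed

text \<open>The left side is what an ordinary block must beat: 4^s for concatenation and B^(s m) for
  the growth of the threshold over \<open>m\<close> indices. The pressure exceeds s ln B by a fixed
  amount per letter, so a long block also absorbs the error in \<open>pressure_le\<close>.\<close>

lemma ex_block_length:
  assumes s: "s > 1/2" and B: "B > 1" and P: "pressure s > s * ln B"
  shows "\<exists>m\<ge>1. 4 powr s * B powr (s * real m) < part_fun m s"
proof -
  obtain k :: nat where k: "real k * (pressure s - s * ln B) > 2 * (s * ln 4)"
  proof -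
    have "0 < pressure s - s * ln B" using P by simp
    from reals_Archimedean3[OF this] show thesis using that by blast
  qed
  have "s * ln 4 > 0" using s by simp
  then have "k \<ge> 1" using k by (cases k) auto
  have "s * ln 4 + s * real k * ln B < real k * pressure s - s * ln 4"
    using k by (simp add: algebra_simps)
  also have "\<dots> \<le> ln (part_fun k s)" using pressure_le[OF s \<open>k \<ge> 1\<close>] by simp
  finally have "exp (s * ln 4 + s * real k * ln B) < exp (ln (part_fun k s))" by simp
  also have "\<dots> = part_fun k s" using part_fun_pos[OF s] by simp
  also have "exp (s * ln 4 + s * real k * ln B) = 4 powr s * B powr (s * real k)"
    using B by (simp add: powr_def exp_add)
  finally show ?thesis using \<open>k \<ge> 1\<close> by blast
qed

text \<open>The special blocks are selected greedily: \<open>R j\<close> is the ratio of mass to expected mass after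
  \<open>j\<close> blocks, which decays geometrically along ordinary blocks, and a candidate block becomes
  special as soon as this ratio has compensated for the size of the large digit.\<close>

lemma hausdorff_measure_exponential:
  assumes s: "s > 1/2" "s < 1" and B: "B > 1" and P: "pressure s > s * ln B" and N: "infinite N"
    and E: "\<And>a. pos_seq a \<Longrightarrow> infinite {n \<in> N. n \<ge> 1 \<and> B ^ n \<le> real (a (n - 1))} \<Longrightarrow> cf_val a \<in> E"
  shows "hausdorff_measure s E \<noteq> 0"
proof -
  obtain m where m: "m \<ge> 1" "4 powr s * B powr (s * real m) < part_fun m s"
    using ex_block_length[OF s(1) B P] by blast
  obtain M where M: "M \<ge> 1" "4 powr s * B powr (s * real m) < small_sum s m M"
    using ex_small_sum_gt[OF s(1) m(2)] by blast
  define h where "h = 4 powr s / small_sum s m M"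
  define K where "K = 4 powr (s * (real m + 1))"
  have Zpos: "small_sum s m M > 0" by (rule small_sum_pos[OF M(1)])
  have h0: "h > 0" using Zpos by (simp add: h_def)
  \<comment> \<open>Factor gained by \<open>R j * (2 * B ^ (Suc j * m)) powr s\<close> along an
    ordinary block; it is below 1 by the choice of \<open>m\<close> and \<open>M\<close>.\<close>
  define l where "l = h * B powr (s * real m)"
  have l: "0 \<le> l" "l < 1" using M(2) Zpos h0 by (auto simp: l_def h_def field_simps)
  have "1 \<le> B powr (s * real m)" using B s by (intro ge_one_powr_ge_zero) auto
  then have "h * 1 \<le> l" unfolding l_def using h0 by (intro mult_left_mono) auto
  then have h1: "h < 1" using l by simp
  have K1: "K \<ge> 1" unfolding K_def using s by (intro ge_one_powr_ge_zero) auto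
  \<comment> \<open>Elements of \<open>N\<close> are 1-based indices and digits are 0-based, so
    \<open>n\<close> belongs to block (n - 1) div m.\<close>
  define cand where "cand j \<longleftrightarrow> (\<exists>n\<in>N. n \<ge> 1 \<and> (n - 1) div m = j)" for j
  define nn where "nn j = (SOME n. n \<in> N \<and> n \<ge> 1 \<and> (n - 1) div m = j)" for j
  have nn: "nn j \<in> N \<and> nn j \<ge> 1 \<and> (nn j - 1) div m = j" if "cand j" for j
    unfolding nn_def by (rule someI_ex) (use that in \<open>auto simp: cand_def\<close>)
  define r where "r j = (nn j - 1) mod m" for j
  define A where "A j = nat \<lceil>B ^ nn j\<rceil>" for j
  \<comment> \<open>The test for a special block is inlined because \<open>sp\<close> is defined
    from \<open>R\<close>. It uses 2 B^(Suc j * m), which bounds \<open>A j\<close> wherever in the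
    block the candidate index lies.\<close>
  define R where "R = rec_nat (1::real) (\<lambda>j x. x *
    (if cand j \<and> x * (2 * B ^ (Suc j * m)) powr s \<le> 1 then real (A j) powr (2 * s - 1) * K else h))"
  define sp where "sp j \<longleftrightarrow> cand j \<and> R j * (2 * B ^ (Suc j * m)) powr s \<le> 1" for j
  have R_0: "R 0 = 1" and R_Suc: "R (Suc j) = R j * (if sp j then real (A j) powr (2 * s - 1) * K else h)" for j
    by (simp_all add: R_def sp_def)
  have prod: "(\<Prod>i<j. cantor_ratio s m M sp A i) = R j" for j
    by (induction j) (simp_all add: R_0 R_Suc cantor_ratio_def h_def K_def)
  have R_nonneg: "R j \<ge> 0" for j
    by (induction j) (use h0 in \<open>auto simp: R_0 R_Suc K_def\<close>)
  have pos: "j * m + r j = nn j - 1" if "cand j" for j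
    using nn[OF that] unfolding r_def by (metis div_mult_mod_eq)
  have A_ge: "B ^ nn j \<le> real (A j)" for j unfolding A_def by linarith
  have A2: "A j \<ge> 2" if "cand j" for j
  proof -
    have "B ^ nn j > 1" using nn[OF that] B by (intro one_less_power) auto
    then have "real (A j) > 1" using A_ge[of j] by linarith
    then show ?thesis by simp
  qed
  have A_le: "real (A j) \<le> 2 * B ^ (Suc j * m)" if "cand j" for j
  proof -
    have "r j < m" using m by (simp add: r_def)
    then have "nn j - 1 < Suc j * m" using pos[OF that] by simp
    then have "nn j \<le> Suc j * m" by linarith
    then have le: "B ^ nn j \<le> B ^ (Suc j * m)" using B by (intro power_increasing) auto
    have "B ^ nn j \<ge> 1" using B by (intro one_le_power) auto
    then have "real (A j) \<le> 2 * B ^ nn j" unfolding A_def by linarith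
    then show ?thesis using le by linarith
  qed
  have RA: "R j * real (A j) powr s \<le> 1" if "sp j" for j
  proof -
    have "real (A j) powr s \<le> (2 * B ^ (Suc j * m)) powr s"
      using A_le[of j] that s by (intro powr_mono2) (auto simp: sp_def)
    then have "R j * real (A j) powr s \<le> R j * (2 * B ^ (Suc j * m)) powr s"
      using R_nonneg by (intro mult_left_mono)
    then show ?thesis using that by (simp add: sp_def)
  qed
  \<comment> \<open>After a special block \<open>R\<close> is at most A^(s - 1) K <= K, by
    \<open>RA\<close> and s < 1; ordinary blocks do not increase it since h < 1.\<close>
  have RK: "R j \<le> K" for j
  proof (induction j)
    case (Suc j)
    show ?case
    proof (cases "sp j")
      case True
      then have A1: "real (A j) \<ge> 1" using A2[of j] by (simp add: sp_def)
      have "R (Suc j) = (R j * real (A j) powr s) * real (A j) powr (s - 1) * K"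
        using True by (simp add: R_Suc mult.assoc powr_add[symmetric])
      also have "\<dots> \<le> 1 * 1 * K"
      proof (intro mult_right_mono mult_mono RA True)
        show "real (A j) powr (s - 1) \<le> 1"
          using powr_mono[of "s - 1" 0 "real (A j)"] A1 s by simp
      qed (use K1 in auto)
      finally show ?thesis by simp
    next
      case False
      have "R j * h \<le> K * 1" using Suc h0 h1 R_nonneg K1 by (intro mult_mono) auto
      then show ?thesis using False by (simp add: R_Suc)
    qed
  qed (simp add: R_0 K1)
  interpret cf_cantor s K m M sp r A
  proof
    show "0 < s" "s \<le> 1" "1 \<le> m" "1 \<le> M" using s m M by auto
    show "r j < m" for j using m by (simp add: r_def)
    show "2 \<le> A j" if "sp j" for j using A2 that by (simp add: sp_def)
    show "(\<Prod>i<j. cantor_ratio s m M sp A i) \<le> K" for j unfolding prod by (rule RK)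
    show "(\<Prod>i<j. cantor_ratio s m M sp A i) \<le> K * real (A j) powr (- s)" if "sp j" for j
    proof -
      have "real (A j) > 0" using A2[of j] that by (simp add: sp_def)
      then have "R j = (R j * real (A j) powr s) * real (A j) powr (- s)" by (simp add: powr_minus)
      also have "\<dots> \<le> K * real (A j) powr (- s)"
        using RA[OF that] K1 by (intro mult_right_mono) auto
      finally show ?thesis unfolding prod .
    qed
  qed
  \<comment> \<open>Without special blocks from \<open>J\<close> on, the tested quantity would decay
    like \<open>l ^ k\<close> and all late candidates would pass the test; but \<open>N\<close>
    provides candidates arbitrarily late.\<close>
  have inf: "infinite {j. sp j}"
  proof
    assume "finite {j. sp j}"
    then obtain J where J: "\<And>j. sp j \<Longrightarrow> j < J"
      by (auto simp: finite_nat_set_iff_bounded)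
    have RJ: "R (J + k) = R J * h ^ k" for k
    proof (induction k)
      case (Suc k)
      have "\<not> sp (J + k)" using J[of "J + k"] by auto
      then show ?case using Suc by (simp add: R_Suc)
    qed simp
    have Bpow: "(2 * B ^ (Suc (J + k) * m)) powr s = (2 * B ^ (Suc J * m)) powr s * (B powr (s * real m)) ^ k" for k
    proof -
      have "B ^ (Suc (J + k) * m) = B ^ (Suc J * m) * B ^ (k * m)"
        by (simp add: power_add[symmetric] algebra_simps)
      moreover have "(B ^ (k * m)) powr s = (B powr (s * real m)) ^ k"
        using B by (simp add: powr_realpow[symmetric] powr_powr powr_power mult_ac)
      ultimately show ?thesis by (simp add: powr_mult mult.assoc[symmetric])
    qed
    have "(\<lambda>k. R J * (2 * B ^ (Suc J * m)) powr s * l ^ k) \<longlonglongrightarrow> R J * (2 * B ^ (Suc J * m)) powr s * 0"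
      using l by (intro tendsto_mult_left LIMSEQ_realpow_zero)
    then have "\<forall>\<^sub>F k in sequentially. R J * (2 * B ^ (Suc J * m)) powr s * l ^ k < 1"
      by (rule order_tendstoD(2)) simp
    then obtain k0 where k0: "\<And>k. k \<ge> k0 \<Longrightarrow> R J * (2 * B ^ (Suc J * m)) powr s * l ^ k < 1"
      by (auto simp: eventually_sequentially)
    have not_cand: "\<not> cand (J + k)" if "k \<ge> k0" for k
    proof
      assume "cand (J + k)"
      moreover have "R (J + k) * (2 * B ^ (Suc (J + k) * m)) powr s \<le> 1"
        using k0[OF that] unfolding RJ Bpow by (simp add: l_def power_mult_distrib mult_ac)
      ultimately have "sp (J + k)" by (simp add: sp_def)
      then show False using J by fastforce
    qed
    obtain n where n: "n \<in> N" "n \<ge> (J + k0) * m + 1"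
      using N unfolding infinite_nat_iff_unbounded_le by blast
    define j where "j = (n - 1) div m"
    have "(J + k0) * m div m \<le> j" unfolding j_def using n by (intro div_le_mono) linarith
    then have "j \<ge> J + k0" using m by simp
    then have "\<not> cand (J + (j - J))" by (intro not_cand) linarith
    then have "\<not> cand j" using \<open>j \<ge> J + k0\<close> by simp
    then show False using n by (auto simp: cand_def j_def)
  qed
  show ?thesis
  proof (rule hausdorff_measure_pos)
    fix a assume a: "pos_seq a" "\<And>j. sp j \<Longrightarrow> A j \<le> a (j * m + r j)"
    have "inj_on nn {j. sp j}"
      by (rule inj_on_inverseI[where g = "\<lambda>n. (n - 1) div m"]) (use nn in \<open>auto simp: sp_def\<close>)
    then have "infinite (nn ` {j. sp j})" using inf finite_imageD by blast
    moreover have "nn ` {j. sp j} \<subseteq> {n \<in> N. n \<ge> 1 \<and> B ^ n \<le> real (a (n - 1))}"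
    proof safe
      fix j assume j: "sp j"
      then have c: "cand j" by (simp add: sp_def)
      show "nn j \<in> N" "nn j \<ge> 1" using nn[OF c] by auto
      have "real (A j) \<le> real (a (nn j - 1))" using a(2)[OF j] pos[OF c] by simp
      then show "B ^ nn j \<le> real (a (nn j - 1))" using A_ge[of j] by linarith
    qed
    ultimately show "cf_val a \<in> E" using a(1) by (intro E) (auto dest: finite_subset)
  qed
qed

section \<open>Upper bounds\<close>

lemma summable_on_pos_words:
  assumes \<theta>: "\<theta> > 1/2" and c: "\<And>n. c n \<ge> 0" and sum: "summable (\<lambda>n. part_fun n \<theta> * c n)"
  shows "(\<lambda>u. real (conv_den u) powr (- 2 * \<theta>) * c (length u)) summable_on {u. pos_word u}"
proof -
  let ?f = "\<lambda>u. real (conv_den u) powr (- 2 * \<theta>) * c (length u)"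
  have bij: "bij_betw snd (Sigma UNIV words) {u. pos_word u}"
    by (rule bij_betw_byWitness[where f' = "\<lambda>u. (length u, u)"]) (auto simp: words_iff)
  have "(\<lambda>p. ?f (snd p)) summable_on Sigma UNIV words"
  proof (rule summable_on_SigmaI[where g = "\<lambda>n. part_fun n \<theta> * c n"])
    show "(\<lambda>n. part_fun n \<theta> * c n) summable_on UNIV"
      using sum c part_fun_pos[OF \<theta>]
      by (intro norm_summable_imp_summable_on) (simp add: abs_mult less_imp_le)
    fix n
    have "((\<lambda>u. real (conv_den u) powr (- 2 * \<theta>) * c n) has_sum part_fun n \<theta> * c n) (words n)"
      by (rule has_sum_cmult_left[OF part_fun_has_sum[OF \<theta>]])
    then show "((\<lambda>u. ?f (snd (n, u))) has_sum part_fun n \<theta> * c n) (words n)"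
      by (rule has_sum_cong[THEN iffD1, rotated]) (simp add: words_iff)
  qed (use c in auto)
  then show ?thesis using summable_on_reindex_bij_betw[OF bij, of ?f] by simp
qed

lemma hausdorff_measure_limsup_0:
  assumes s: "s > 0" and A: "\<And>u. pos_word u \<Longrightarrow> A u > 0"
    and sum: "(\<lambda>u. (1 / ((real (conv_den u))\<^sup>2 * A u)) powr s) summable_on {u. pos_word u}"
    and E: "E \<subseteq> irrationals01"
    and inf: "\<And>a. pos_seq a \<Longrightarrow> cf_val a \<in> E \<Longrightarrow> infinite {n. A (pref a n) \<le> real (a n)}"
  shows "hausdorff_measure s E = 0"
proof (rule hausdorff_cantelli_countable[OF _ _ s _ _ sum, of "\<lambda>u. cf_map u ` {0..1 / A u}"])
  show "countable {u. pos_word u}" by simp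
  have "inj (\<lambda>n. replicate n (1::nat))" by (auto simp: inj_def)
  then have "infinite (range (\<lambda>n. replicate n (1::nat)))" by (rule range_inj_infinite)
  moreover have "range (\<lambda>n. replicate n (1::nat)) \<subseteq> {u. pos_word u}" by (auto simp: pos_word_def)
  ultimately show "infinite {u. pos_word u}" by (rule infinite_super[rotated])
  have diff: "\<bar>cf_map u x - cf_map u y\<bar> \<le> 1 / ((real (conv_den u))\<^sup>2 * A u)"
    if u: "pos_word u" and "x \<in> {0..1 / A u}" "y \<in> {0..1 / A u}" for u x y
  proof -
    have "\<bar>cf_map u x - cf_map u y\<bar> \<le> \<bar>x - y\<bar> / (real (conv_den u))\<^sup>2"
      using that by (intro cf_map_diff_le) auto
    also have "\<dots> \<le> (1 / A u) / (real (conv_den u))\<^sup>2"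
      using that by (intro divide_right_mono) auto
    finally show ?thesis by (simp add: mult.commute)
  qed
  fix u assume "u \<in> {u. pos_word u}"
  then have u: "pos_word u" by simp
  have "dist x y \<le> 1 / ((real (conv_den u))\<^sup>2 * A u)"
    if "x \<in> cf_map u ` {0..1 / A u}" "y \<in> cf_map u ` {0..1 / A u}" for x y
    using that diff[OF u] by (auto simp: dist_real_def)
  note d = this
  have "cf_map u 0 \<in> cf_map u ` {0..1 / A u}" using A[OF u] by auto
  then show "bounded (cf_map u ` {0..1 / A u})"
    using d unfolding bounded_def by blast
  have "diameter (cf_map u ` {0..1 / A u}) \<le> 1 / ((real (conv_den u))\<^sup>2 * A u)"
    using A[OF u] by (intro diameter_le d[unfolded dist_norm]) auto
  moreover have "diameter (cf_map u ` {0..1 / A u}) \<ge> 0"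
    by (rule diameter_ge_0) fact
  ultimately show "diameter (cf_map u ` {0..1 / A u}) powr s \<le> (1 / ((real (conv_den u))\<^sup>2 * A u)) powr s"
    using s by (intro powr_mono2) auto
next
  fix x assume x: "x \<in> E"
  then obtain a where a: "pos_seq a" "x = cf_val a" using ex_cf_val E by blast
  \<comment> \<open>Prefixes of different lengths are different words, so infinitely many indices
    yield infinitely many members of the cover that contain \<open>x\<close>.\<close>
  have inj: "inj_on (pref a) X" for X by (rule inj_on_inverseI[where g = length]) simp
  then have "infinite (pref a ` {n. A (pref a n) \<le> real (a n)})"
    using inf[OF a(1)] x a(2) by (simp add: finite_image_iff[OF inj])
  moreover have "pref a ` {n. A (pref a n) \<le> real (a n)} \<subseteq> {u \<in> {u. pos_word u}. x \<in> cf_map u ` {0..1 / A u}}"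
  proof safe
    fix n assume n: "A (pref a n) \<le> real (a n)"
    show pw: "pos_word (pref a n)" by (rule pos_word_pref[OF a(1)])
    define t where "t = cf_val (\<lambda>i. a (n + i))"
    have sh: "pos_seq (\<lambda>i. a (n + i))" by (rule pos_seq_shift[OF a(1)])
    have "t \<le> 1 / real (a n)" using cf_val_bounds(2)[OF sh] by (simp add: t_def)
    also have "\<dots> \<le> 1 / A (pref a n)"
      using n A[OF pw] by (intro divide_left_mono mult_pos_pos) auto
    finally have "t \<in> {0..1 / A (pref a n)}" using cf_val_range[OF sh] by (simp add: t_def)
    moreover have "x = cf_map (pref a n) t" using cf_val_split[OF a(1), of n] a(2) by (simp add: t_def)
    ultimately show "x \<in> cf_map (pref a n) ` {0..1 / A (pref a n)}" by blast
  qed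
  ultimately show "infinite {u \<in> {u. pos_word u}. x \<in> cf_map u ` {0..1 / A u}}"
    by (rule infinite_super[rotated])
qed

lemma hausdorff_measure_exponential_0:
  assumes s: "s > 1/2" and b: "b > 1" and P: "pressure s < s * ln b" and E: "E \<subseteq> irrationals01"
    and inf: "\<And>a. pos_seq a \<Longrightarrow> cf_val a \<in> E \<Longrightarrow> infinite {n. b ^ Suc n \<le> real (a n)}"
  shows "hausdorff_measure s E = 0"
proof (rule hausdorff_measure_limsup_0[where A = "\<lambda>u. b ^ Suc (length u)"])
  define c where "c n = (b ^ Suc n) powr (- s)" for n
  have summand: "(1 / ((real (conv_den u))\<^sup>2 * b ^ Suc (length u))) powr s =
      real (conv_den u) powr (- 2 * s) * c (length u)" if "pos_word u" for u
  proof -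
    have q: "real (conv_den u) > 0" using conv_den_pos[OF that] by simp
    have "0 < b ^ Suc (length u)" using b by simp
    then show ?thesis using q
      by (simp add: c_def powr_divide powr_mult power2_powr powr_minus_divide)
  qed
  \<comment> \<open>Ratio of the dominating geometric series: words of length n contribute at most
    4^s exp(n P(s)), and the threshold contributes at most exp(- n s ln b).\<close>
  define x where "x = exp (pressure s - s * ln b)"
  have x: "0 < x" "x < 1" using P by (auto simp: x_def)
  have le: "part_fun n s * c n \<le> 4 powr s * x ^ n" if "n \<ge> 1" for n
  proof -
    have "ln (part_fun n s) / real n \<le> pressure s + s * ln 4 / real n"
      using pressure_approx[OF s that] by linarith
    then have "ln (part_fun n s) \<le> (pressure s + s * ln 4 / real n) * real n"
      using that by (simp add: pos_divide_le_eq)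
    also have "\<dots> = real n * pressure s + s * ln 4" using that by (simp add: algebra_simps)
    finally have "exp (ln (part_fun n s)) \<le> exp (real n * pressure s + s * ln 4)" by simp
    then have 1: "part_fun n s \<le> exp (real n * pressure s + s * ln 4)"
      using part_fun_pos[OF s, of n] by simp
    have "c n \<le> (b ^ n) powr (- s)"
      unfolding c_def using b s by (intro powr_mono2') auto
    also have "\<dots> = exp (- (real n * (s * ln b)))"
      using b by (simp add: powr_def ln_realpow)
    finally have "part_fun n s * c n \<le> exp (real n * pressure s + s * ln 4) * exp (- (real n * (s * ln b)))"
      using 1 by (intro mult_mono) (auto simp: c_def)
    also have "\<dots> = exp (s * ln 4) * exp (real n * (pressure s - s * ln b))"
      unfolding exp_add[symmetric] by (rule arg_cong) (simp add: algebra_simps)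
    also have "\<dots> = 4 powr s * x ^ n"
      by (simp add: powr_def x_def exp_of_nat_mult)
    finally show ?thesis .
  qed
  have "summable (\<lambda>n. 4 powr s * x ^ n)" using x by (intro summable_mult summable_geometric) auto
  then have "summable (\<lambda>n. part_fun n s * c n)"
    by (rule summable_comparison_test'[where N = 1])
       (use le part_fun_pos[OF s] in \<open>auto simp: abs_mult c_def less_imp_le\<close>)
  then have "(\<lambda>u. real (conv_den u) powr (- 2 * s) * c (length u)) summable_on {u. pos_word u}"
    by (intro summable_on_pos_words s) (auto simp: c_def)
  then show "(\<lambda>u. (1 / ((real (conv_den u))\<^sup>2 * b ^ Suc (length u))) powr s) summable_on {u. pos_word u}"
    by (rule summable_on_cong[THEN iffD1, rotated]) (use summand in simp)
  show "infinite {n. b ^ Suc (length (pref a n)) \<le> real (a n)}" if "pos_seq a" "cf_val a \<in> E" for a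
    using inf[OF that] by simp
qed (use s b E in auto)

text \<open>Since q' <= q <= a q, a new quotient a multiplies the denominator by at most 2a. Hence
  the 2 inside the logarithm of the record quantity.\<close>

lemma ln_conv_den_le_sum:
  assumes "pos_seq a"
  shows "ln (real (conv_den (pref a n))) \<le> (\<Sum>i<n. ln (2 * real (a i)))"
proof (induction n)
  case (Suc n)
  have pos: "conv_den (pref a k) \<ge> 1" for k by (intro conv_den_pos pos_word_pref assms)
  have a: "a n \<ge> 1" using assms by (simp add: pos_seq_def)
  have "conv_den (pref a (Suc n)) = conv_den (pref a n) * a n + prev_den (pref a n)"
    by (simp add: conv_den_append)
  also have "\<dots> \<le> conv_den (pref a n) * a n + conv_den (pref a n) * a n"
    using prev_den_le[OF pos_word_pref[OF assms, of n]] order_trans[OF _ mult_le_mono2[OF a, of "conv_den (pref a n)"]]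
    by (intro add_left_mono) simp
  also have "\<dots> = conv_den (pref a n) * (2 * a n)" by simp
  finally have "real (conv_den (pref a (Suc n))) \<le> real (conv_den (pref a n) * (2 * a n))"
    by (rule of_nat_mono)
  then have "ln (real (conv_den (pref a (Suc n)))) \<le> ln (real (conv_den (pref a n)) * (2 * real (a n)))"
    using pos[of "Suc n"] by (intro ln_mono) auto
  also have "\<dots> = ln (real (conv_den (pref a n))) + ln (2 * real (a n))"
    using pos[of n] a by (intro ln_mult_pos) auto
  finally show ?case using Suc by simp
qed simp

text \<open>Record times of \<open>ln (2 * a n) / d ^ Suc n\<close>: there \<open>a n\<close> dominates a power of the product
  of all earlier quotients.\<close>

lemma infinite_record_times:
  assumes a: "pos_seq a" and d: "1 < d" "d < c" and inf: "infinite {n. exp (c ^ Suc n) \<le> real (a n)}"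
  shows "infinite {n. (d - 1) * ln (real (conv_den (pref a n))) \<le> ln (2 * real (a n)) \<and>
    d ^ Suc n \<le> ln (2 * real (a n))}"
  unfolding infinite_nat_iff_unbounded_le
proof
  fix K
  define v where "v n = ln (2 * real (a n)) / d ^ Suc n" for n
  \<comment> \<open>An index with \<open>v n > V\<close> lies beyond \<open>K\<close>, and the first
    such index is a record. V >= 1 yields the second conjunct there.\<close>
  define V where "V = Max (insert 1 (v ` {..K}))"
  have V: "1 \<le> V" "\<And>n. n \<le> K \<Longrightarrow> v n \<le> V"
    unfolding V_def by (rule Max_ge; simp)+
  have dpos: "d ^ k > 0" for k using d by simp
  \<comment> \<open>As c > d, \<open>v\<close> is unbounded along the indices from
    \<open>inf\<close>, where it is at least (c / d)^(n + 1).\<close>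
  have "filterlim (\<lambda>n. (c / d) ^ n) at_top sequentially"
    using d by (intro filterlim_power_at_top) auto
  then have "\<forall>\<^sub>F n in sequentially. V < (c / d) ^ n"
    by (auto simp: filterlim_at_top_dense)
  then obtain n0 where n0: "\<And>n. n \<ge> n0 \<Longrightarrow> V < (c / d) ^ n" by (auto simp: eventually_sequentially)
  obtain n1 where n1: "n1 \<ge> n0" "exp (c ^ Suc n1) \<le> real (a n1)"
    using inf unfolding infinite_nat_iff_unbounded_le by blast
  have "V < (c / d) ^ Suc n1" using n1 by (intro n0) auto
  also have "\<dots> = c ^ Suc n1 / d ^ Suc n1" by (rule power_divide)
  also have "\<dots> \<le> v n1"
  proof -
    have "c ^ Suc n1 = ln (exp (c ^ Suc n1))" by simp
    also have "\<dots> \<le> ln (2 * real (a n1))"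
      using n1(2) by (intro ln_mono) (auto intro: order_trans)
    finally show ?thesis unfolding v_def by (intro divide_right_mono less_imp_le[OF dpos])
  qed
  finally have ex: "V < v n1" .
  define n where "n = (LEAST n. V < v n)"
  have n: "V < v n" unfolding n_def by (rule LeastI[of _ n1]) (rule ex)
  have less: "v i \<le> v n" if "i < n" for i
    using not_less_Least[of i "\<lambda>n. V < v n"] that n by (simp add: n_def)
  have "K < n" using V(2)[of n] n by (cases "n \<le> K") auto
  have ln_eq: "ln (2 * real (a i)) = v i * d ^ Suc i" for i
    using d by (simp add: v_def)
  have "ln (real (conv_den (pref a n))) \<le> (\<Sum>i<n. ln (2 * real (a i)))" by (rule ln_conv_den_le_sum[OF a])
  also have "\<dots> \<le> (\<Sum>i<n. v n * d ^ Suc i)"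
    unfolding ln_eq using less by (intro sum_mono mult_right_mono less_imp_le[OF dpos]) auto
  also have "\<dots> = v n * d * (\<Sum>i<n. d ^ i)" by (simp add: sum_distrib_left mult_ac)
  \<comment> \<open>Summing the bound at the record over all earlier indices is what produces the
    exponent d - 1.\<close>
  also have "(\<Sum>i<n. d ^ i) = (d ^ n - 1) / (d - 1)" using d by (intro geometric_sum) auto
  also have "v n * d * ((d ^ n - 1) / (d - 1)) \<le> v n * d * (d ^ n / (d - 1))"
    using d n V(1) by (intro mult_left_mono divide_right_mono) auto
  also have "\<dots> = ln (2 * real (a n)) / (d - 1)" unfolding ln_eq by simp
  finally have "(d - 1) * ln (real (conv_den (pref a n))) \<le> ln (2 * real (a n))"
    using d by (simp add: field_simps)
  moreover have "1 * d ^ Suc n \<le> v n * d ^ Suc n"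
    using n V(1) by (intro mult_right_mono less_imp_le[OF dpos]) auto
  ultimately show "\<exists>n\<ge>K. n \<in> {n. (d - 1) * ln (real (conv_den (pref a n))) \<le> ln (2 * real (a n)) \<and>
    d ^ Suc n \<le> ln (2 * real (a n))}"
    using \<open>K < n\<close> ln_eq[of n] by (intro exI[of _ n]) auto
qed

lemma summable_power_exp_minus_power:
  assumes "x > 0" "d > 1" "k > (0::real)"
  shows "summable (\<lambda>n. x ^ n * exp (- (k * d ^ Suc n)))"
proof -
  have "(\<lambda>n. of_nat n / d ^ n) \<longlonglongrightarrow> 0" using assms by (intro lim_n_over_pown) auto
  then have "(\<lambda>n. real n / d ^ n * ln (2 * x)) \<longlonglongrightarrow> 0 * ln (2 * x)" by (rule tendsto_mult_right)
  then have "\<forall>\<^sub>F n in sequentially. real n / d ^ n * ln (2 * x) < k * d"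
    using assms by (intro order_tendstoD(2)) auto
  then have ev: "\<forall>\<^sub>F n in sequentially. norm (x ^ n * exp (- (k * d ^ Suc n))) \<le> (1/2) ^ n"
  proof eventually_elim
    case (elim n)
    have dn: "d ^ n > 0" using assms by simp
    have "real n * ln (2 * x) = real n / d ^ n * ln (2 * x) * d ^ n" using dn assms by simp
    also have "\<dots> \<le> k * d * d ^ n" using elim dn by (intro mult_right_mono) auto
    finally have "exp (real n * ln (2 * x)) \<le> exp (k * d ^ Suc n)" by (simp add: mult.assoc)
    then have "(2 * x) ^ n \<le> exp (k * d ^ Suc n)" using assms by (simp add: exp_of_nat_mult)
    then have "(2 * x) ^ n * ((1/2) ^ n * exp (- (k * d ^ Suc n))) \<le>
        exp (k * d ^ Suc n) * ((1/2) ^ n * exp (- (k * d ^ Suc n)))"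
      by (intro mult_right_mono) auto
    also have "(2 * x) ^ n * ((1/2) ^ n * exp (- (k * d ^ Suc n))) = x ^ n * exp (- (k * d ^ Suc n))"
    proof -
      have "(2 * x) ^ n * (1/2) ^ n = x ^ n" unfolding power_mult_distrib[symmetric] by simp
      then show ?thesis by (simp only: mult.assoc[symmetric])
    qed
    also have "exp (k * d ^ Suc n) * ((1/2) ^ n * exp (- (k * d ^ Suc n))) = (1/2) ^ n"
      by (simp add: exp_minus)
    finally show ?case using assms by simp
  qed
  show ?thesis
    by (rule summable_comparison_test_ev[OF ev]) simp
qed

text \<open>At a record time, ln (2 a_n) has the lower bounds (d - 1) ln q and d^(n + 1), which are
  combined with weights 1 - \<eta> and \<eta>. The first share turns q^(-2s) into q^(-2\<theta>)
  with \<theta> > 1/2, so the sum over words of a given length is finite; the second makes the sum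
  over all lengths converge.\<close>

lemma hausdorff_measure_doubly_exponential_0:
  assumes s: "s > 0" and d: "1 < d" "d < c" and sd: "s * (d + 1) > 1" and E: "E \<subseteq> irrationals01"
    and inf: "\<And>a. pos_seq a \<Longrightarrow> cf_val a \<in> E \<Longrightarrow> infinite {n. exp (c ^ Suc n) \<le> real (a n)}"
  shows "hausdorff_measure s E = 0"
proof -
  \<comment> \<open>Chosen so that 2\<theta> = s (d + 1) - \<eta> s (d - 1) loses at most half of
    the excess of s (d + 1) over 1.\<close>
  define \<eta> where "\<eta> = min (1/2) ((s * (d + 1) - 1) / (2 * s * (d - 1)))"
  have \<eta>: "0 < \<eta>" "\<eta> < 1" using s d sd by (auto simp: \<eta>_def)
  have "\<eta> \<le> (s * (d + 1) - 1) / (2 * s * (d - 1))" by (simp add: \<eta>_def)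
  then have \<eta>': "\<eta> * (2 * s * (d - 1)) \<le> s * (d + 1) - 1" using s d by (simp add: pos_le_divide_eq)
  define e where "e = (d - 1) * (1 - \<eta>)"
  define \<theta> where "\<theta> = s * (2 + e) / 2"
  have \<theta>: "\<theta> > 1/2"
  proof -
    define X Y where "X = \<eta> * (2 * s * (d - 1))" "Y = s * (d + 1)"
    have "s * (2 + e) = Y - X / 2" by (simp add: e_def X_Y_def field_simps)
    then have "s * (2 + e) > 1" using \<eta>' sd unfolding X_Y_def[symmetric] by linarith
    then show ?thesis by (simp add: \<theta>_def)
  qed
  define A where "A u = real (conv_den u) powr e * exp (\<eta> * d ^ Suc (length u)) / 2" for u
  define k where "k n = 2 powr s * exp (- (s * \<eta> * d ^ Suc n))" for n
  show ?thesis
  proof (rule hausdorff_measure_limsup_0[where A = A])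
    show "A u > 0" if "pos_word u" for u using conv_den_pos[OF that] by (simp add: A_def)
    have "summable (\<lambda>n. 2 powr s * (part_fun 1 \<theta> ^ n * exp (- (s * \<eta> * d ^ Suc n))))"
      using part_fun_pos[OF \<theta>] s d \<eta> by (intro summable_mult summable_power_exp_minus_power) auto
    then have "summable (\<lambda>n. part_fun n \<theta> * k n)"
    proof (rule summable_comparison_test'[where N = 0])
      fix n
      have "part_fun n \<theta> * k n \<le> part_fun 1 \<theta> ^ n * k n"
        by (intro mult_right_mono part_fun_le_power \<theta>) (simp add: k_def)
      then show "norm (part_fun n \<theta> * k n) \<le> 2 powr s * (part_fun 1 \<theta> ^ n * exp (- (s * \<eta> * d ^ Suc n)))"
        using part_fun_pos[OF \<theta>, of n] by (simp add: k_def abs_mult mult_ac)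
    qed
    then have "(\<lambda>u. real (conv_den u) powr (- 2 * \<theta>) * k (length u)) summable_on {u. pos_word u}"
      by (intro summable_on_pos_words \<theta>) (auto simp: k_def)
    moreover have "(1 / ((real (conv_den u))\<^sup>2 * A u)) powr s = real (conv_den u) powr (- 2 * \<theta>) * k (length u)"
      if "pos_word u" for u
    proof -
      define q where "q = real (conv_den u)"
      define y where "y = exp (\<eta> * d ^ Suc (length u))"
      have q: "q > 0" using conv_den_pos[OF that] by (simp add: q_def)
      have y: "y > 0" "y powr (- s) = exp (- (s * \<eta> * d ^ Suc (length u)))"
        by (simp_all add: y_def powr_def)
      have "q powr (- (2 + e)) = inverse (q\<^sup>2 * q powr e)"
        using q by (subst powr_minus) (simp add: powr_add)
      moreover have "1 / (q\<^sup>2 * (z * y / 2)) = 2 * (inverse (q\<^sup>2 * z) * inverse y)" if "z > 0" for z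
        using q y(1) that by (simp add: field_simps)
      ultimately have "1 / (q\<^sup>2 * (q powr e * y / 2)) = 2 * (q powr (- (2 + e)) * inverse y)"
        using q by simp
      then have "(1 / (q\<^sup>2 * (q powr e * y / 2))) powr s = 2 powr s * (q powr (- (2 + e) * s) * y powr (- s))"
        using y by (simp add: powr_mult powr_powr inverse_powr powr_minus)
      also have "- (2 + e) * s = - 2 * \<theta>" by (simp add: \<theta>_def algebra_simps)
      finally show ?thesis
        unfolding A_def k_def q_def[symmetric] y_def[symmetric] y(2)[symmetric] by (simp only: mult_ac)
    qed
    ultimately show "(\<lambda>u. (1 / ((real (conv_den u))\<^sup>2 * A u)) powr s) summable_on {u. pos_word u}"
      by (subst summable_on_cong) auto
    show "infinite {n. A (pref a n) \<le> real (a n)}" if a: "pos_seq a" "cf_val a \<in> E" for a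
    proof (rule infinite_super[OF _ infinite_record_times[OF a(1) d inf[OF a]]], safe)
      fix n assume n: "(d - 1) * ln (real (conv_den (pref a n))) \<le> ln (2 * real (a n))"
        "d ^ Suc n \<le> ln (2 * real (a n))"
      have q: "real (conv_den (pref a n)) > 0"
        using conv_den_pos[OF pos_word_pref[OF a(1), of n]] by simp
      have an: "real (a n) > 0" using a(1) by (auto simp: pos_seq_def Suc_le_eq)
      have "(1 - \<eta>) * ((d - 1) * ln (real (conv_den (pref a n)))) + \<eta> * d ^ Suc n \<le>
          (1 - \<eta>) * ln (2 * real (a n)) + \<eta> * ln (2 * real (a n))"
        using n \<eta> by (intro add_mono mult_left_mono) auto
      also have "\<dots> = ln (2 * real (a n))" by (simp add: algebra_simps)
      finally have "exp (e * ln (real (conv_den (pref a n))) + \<eta> * d ^ Suc n) \<le> exp (ln (2 * real (a n)))"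
        by (simp add: e_def mult_ac)
      then have "real (conv_den (pref a n)) powr e * exp (\<eta> * d ^ Suc n) \<le> 2 * real (a n)"
        using q an by (simp add: powr_def exp_add)
      then show "A (pref a n) \<le> real (a n)" by (simp add: A_def)
    qed
  qed (use s E in auto)
qed

section \<open>The dimension formula\<close>

lemma hausdorff_dim_le_real:
  assumes "t \<ge> 0" "\<And>s. s > t \<Longrightarrow> hausdorff_measure s A = 0"
  shows "hausdorff_dim A \<le> ereal t"
proof (rule dense_ge)
  fix y assume "ereal t < y"
  then obtain s where s: "ereal t < ereal s" "ereal s < y" using ereal_dense2 by blast
  then have "hausdorff_dim A \<le> ereal s" using assms by (intro hausdorff_dim_leI) auto
  then show "hausdorff_dim A \<le> y" using s by simp
qed

text \<open>The bound \<open>r\<close> restricts the test exponents to a range below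
  \<open>t\<close>, such as s > 1/2, where the pressure is finite.\<close>

lemma hausdorff_dim_ge_real:
  assumes "r < t" "\<And>s. r < s \<Longrightarrow> s < t \<Longrightarrow> hausdorff_measure s A \<noteq> 0"
  shows "ereal t \<le> hausdorff_dim A"
proof (rule dense_le)
  fix y assume "y < ereal t"
  then have "max y (ereal r) < ereal t" using assms by simp
  then obtain s where s: "max y (ereal r) < ereal s" "ereal s < ereal t" using ereal_dense2 by blast
  then have "ereal s \<le> hausdorff_dim A" by (intro hausdorff_dim_geI assms) auto
  then show "y \<le> hausdorff_dim A" using s by (meson le_less_trans less_imp_le max.strict_boundedE order_trans)
qed

lemma frequently_less_of_liminf_less:
  fixes f :: "nat \<Rightarrow> ereal"
  assumes "liminf f < c"
  shows "infinite {n. f n < c}"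
proof
  assume "finite {n. f n < c}"
  then obtain N where "\<And>n. f n < c \<Longrightarrow> n < N" by (auto simp: finite_nat_set_iff_bounded)
  then have "\<forall>\<^sub>F n in sequentially. c \<le> f n"
    unfolding eventually_sequentially by (intro exI[of _ N]) (meson not_le)
  then have "c \<le> liminf f" by (rule Liminf_bounded)
  then show False using assms by simp
qed

lemma M_setI:
  assumes a: "pos_seq a" and N: "\<And>n. n \<in> N \<Longrightarrow> \<psi> (real n) \<le> \<phi> n"
    and inf: "infinite {n \<in> N. n \<ge> 1 \<and> \<phi> n \<le> real (a (n - 1))}"
  shows "cf_val a \<in> M_set \<psi>"
  unfolding M_set_iff[OF a]
proof (rule infinite_super[OF _ inf], safe)
  fix n :: nat assume n: "n \<in> N" "n \<ge> 1" "\<phi> n \<le> real (a (n - 1))"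
  then show "\<exists>i<n. \<psi> (real n) \<le> real (a i)"
    using N[OF n(1)] by (intro exI[of _ "n - 1"]) auto
qed

text \<open>The quotient that reaches \<psi>(n) may have an index \<open>i\<close> far below n;
  monotonicity still gives \<phi>(i + 1) <= \<phi>(n) <= a_i. As \<phi> is unbounded, such quotients
  exceed any finite set of earlier ones, so \<open>i\<close> tends to infinity as well.\<close>

lemma M_setD:
  assumes a: "pos_seq a" and M: "cf_val a \<in> M_set \<psi>" and mono: "mono \<phi>"
    and lim: "filterlim \<phi> at_top sequentially" and le: "\<forall>\<^sub>F n in sequentially. \<phi> n \<le> \<psi> (real n)"
  shows "infinite {k. \<phi> (Suc k) \<le> real (a k)}"
  unfolding infinite_nat_iff_unbounded_le
proof
  fix K
  define V where "V = Max (a ` {..K})"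
  have V: "a i \<le> V" if "i \<le> K" for i unfolding V_def using that by (intro Max_ge) auto
  have "\<forall>\<^sub>F n in sequentially. real V < \<phi> n" using lim by (simp add: filterlim_at_top_dense)
  then have "\<forall>\<^sub>F n in sequentially. real V < \<phi> n \<and> \<phi> n \<le> \<psi> (real n)" using le by (rule eventually_conj)
  then obtain n0 where n0: "\<And>n. n \<ge> n0 \<Longrightarrow> real V < \<phi> n \<and> \<phi> n \<le> \<psi> (real n)"
    by (auto simp: eventually_sequentially)
  obtain n where n: "n \<ge> n0" "\<exists>i<n. \<psi> (real n) \<le> real (a i)"
    using M unfolding M_set_iff[OF a] infinite_nat_iff_unbounded_le by blast
  then obtain i where i: "i < n" "\<psi> (real n) \<le> real (a i)" by blast
  have "real V < real (a i)" using n0[OF n(1)] i by linarith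
  then have "K < i" using V[of i] by (cases "i \<le> K") auto
  moreover have "\<phi> (Suc i) \<le> \<phi> n" using mono i(1) by (intro monoD[OF mono]) auto
  ultimately show "\<exists>n\<ge>K. n \<in> {k. \<phi> (Suc k) \<le> real (a k)}"
    using n0[OF n(1)] i by (intro exI[of _ i]) auto
qed

section \<open>From the growth rates of \<psi> to the dimension\<close>

lemma power_less_iff_nonneg:
  fixes x y :: real
  assumes "0 \<le> x" "0 \<le> y" "n > 0"
  shows "x ^ n < y ^ n \<longleftrightarrow> x < y"
  using power_mono_iff[OF assms(2,1,3)] by linarith

context
  fixes \<psi> :: "real \<Rightarrow> real"
  assumes \<psi>_pos: "\<And>t. t > 0 \<Longrightarrow> \<psi> t > 0"
begin

lemma M_set_subset: "M_set \<psi> \<subseteq> irrationals01" "M_set \<psi> \<subseteq> {0..1}"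
  by (auto simp: M_set_def irrationals01_def)

lemma exp_ln_div_less_iff:
  assumes "n \<ge> 1" "b > 0"
  shows "exp (ln (\<psi> (real n)) / real n) < b \<longleftrightarrow> \<psi> (real n) < b ^ n"
    and "b < exp (ln (\<psi> (real n)) / real n) \<longleftrightarrow> b ^ n < \<psi> (real n)"
proof -
  have p: "\<psi> (real n) > 0" using assms by (intro \<psi>_pos) auto
  have e: "exp (ln (\<psi> (real n)) / real n) ^ n = \<psi> (real n)"
    using assms p by (simp add: exp_of_nat_mult[symmetric])
  have n: "n > 0" using assms by simp
  show "exp (ln (\<psi> (real n)) / real n) < b \<longleftrightarrow> \<psi> (real n) < b ^ n"
    using power_less_iff_nonneg[OF _ _ n, of "exp (ln (\<psi> (real n)) / real n)" b] assms e by simp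
  show "b < exp (ln (\<psi> (real n)) / real n) \<longleftrightarrow> b ^ n < \<psi> (real n)"
    using power_less_iff_nonneg[OF _ _ n, of b "exp (ln (\<psi> (real n)) / real n)"] assms e by simp
qed

lemma eventually_ge_power:
  assumes "b > 0" "ereal b < B_lim \<psi>"
  shows "\<forall>\<^sub>F n in sequentially. b ^ n < \<psi> (real n)"
  using less_LiminfD[OF assms(2)[unfolded B_lim_def]] eventually_ge_at_top[of 1]
  by eventually_elim (use assms exp_ln_div_less_iff(2) in auto)

lemma hausdorff_measure_M_set_lower:
  assumes s: "1/2 < s" "s < 1" and b: "b \<ge> 1" "B_lim \<psi> = ereal b" and P: "s * ln b < pressure s"
  shows "hausdorff_measure s (M_set \<psi>) \<noteq> 0"
proof -
  \<comment> \<open>Strict room above b: the lower limit is below exp(l), so \<psi>(n) < exp(l)^n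
    infinitely often, and the pressure inequality survives at l.\<close>
  have "ln b < pressure s / s" using P s by (simp add: pos_less_divide_eq mult.commute)
  then obtain l where l: "ln b < l" "l < pressure s / s" using dense by blast
  then have sl: "s * l < pressure s" using s by (simp add: pos_less_divide_eq mult.commute)
  have "l > 0" using l b by (smt (verit) ln_ge_zero)
  then have el: "exp l > 1" by simp
  have "exp (ln b) < exp l" using l by simp
  then have "b < exp l" using b by simp
  then have "B_lim \<psi> < ereal (exp l)" using b(2) by simp
  then have "infinite {n. ereal (exp (ln (\<psi> (real n)) / real n)) < ereal (exp l)}"
    unfolding B_lim_def by (rule frequently_less_of_liminf_less)
  \<comment> \<open>At n = 0 the division by zero gives 0 and \<psi>(0) may have any sign, so this
    index is dropped.\<close>
  then have inf: "infinite ({n. ereal (exp (ln (\<psi> (real n)) / real n)) < ereal (exp l)} - {0})"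
    by simp
  have N: "infinite {n. \<psi> (real n) \<le> exp l ^ n}"
    by (rule infinite_super[OF _ inf]) (use exp_ln_div_less_iff(1)[of _ "exp l"] in \<open>force simp: Suc_le_eq\<close>)
  show ?thesis
    by (rule hausdorff_measure_exponential[OF s el _ N])
       (use sl in \<open>auto intro: M_setI[where \<phi> = "\<lambda>n. exp l ^ n"]\<close>)
qed

lemma hausdorff_measure_M_set_upper:
  assumes s: "1/2 < s" and b: "b > 1" "ereal b < B_lim \<psi>" and P: "pressure s < s * ln b"
  shows "hausdorff_measure s (M_set \<psi>) = 0"
proof (rule hausdorff_measure_exponential_0[OF s b(1) P M_set_subset(1)])
  fix a assume a: "pos_seq a" "cf_val a \<in> M_set \<psi>"
  show "infinite {n. b ^ Suc n \<le> real (a n)}"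
  proof (rule M_setD[OF a, of "\<lambda>n. b ^ n"])
    show "mono ((^) b)" using b by (intro monoI power_increasing) auto
    show "filterlim ((^) b) at_top sequentially" by (rule filterlim_power_at_top[OF b(1)])
    have "\<forall>\<^sub>F n in sequentially. b ^ n < \<psi> (real n)" using b by (intro eventually_ge_power) auto
    then show "\<forall>\<^sub>F n in sequentially. b ^ n \<le> \<psi> (real n)" by eventually_elim simp
  qed
qed

lemma dim_M_set_B_1:
  assumes "B_lim \<psi> = 1"
  shows "hausdorff_dim (M_set \<psi>) = 1"
proof (rule antisym)
  have "hausdorff_dim (M_set \<psi>) \<le> ereal 1"
    by (rule hausdorff_dim_le_real) (auto intro: hausdorff_measure_unit_interval[OF _ M_set_subset(2)])
  then show "hausdorff_dim (M_set \<psi>) \<le> 1" by (simp add: one_ereal_def)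
  have "ereal 1 \<le> hausdorff_dim (M_set \<psi>)"
  proof (rule hausdorff_dim_ge_real[of "1/2"])
    fix s :: real assume s: "1/2 < s" "s < 1"
    then show "hausdorff_measure s (M_set \<psi>) \<noteq> 0"
      using assms pressure_pos[OF s] by (intro hausdorff_measure_M_set_lower[of _ 1]) (auto simp: one_ereal_def)
  qed simp
  then show "1 \<le> hausdorff_dim (M_set \<psi>)" by (simp add: one_ereal_def)
qed

lemma dim_M_set_B_finite:
  assumes b: "b > 1" "B_lim \<psi> = ereal b"
  shows "hausdorff_dim (M_set \<psi>) = ereal (pressure_root (ln b))"
proof (rule antisym)
  note root = pressure_root[OF b(1)]
  show "hausdorff_dim (M_set \<psi>) \<le> ereal (pressure_root (ln b))"
  proof (rule hausdorff_dim_le_real)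
    show "0 \<le> pressure_root (ln b)" using root(1) by simp
    fix s assume "pressure_root (ln b) < s"
    then have s: "1/2 < s" "pressure s < s * ln b" using root(1) pressure_root_less[OF b(1)] by auto
    \<comment> \<open>The maximum with 0 keeps exp(l) above 1 even when the pressure at s is not
      positive.\<close>
    have "max 0 (pressure s / s) < ln b" using s b by (simp add: pos_divide_less_eq mult.commute)
    then obtain l where "max 0 (pressure s / s) < l" "l < ln b" using dense by blast
    then have l: "0 < l" "pressure s / s < l" "l < ln b" by auto
    have "exp l < exp (ln b)" using l by simp
    then have "exp l < b" using b by simp
    moreover have "pressure s < s * ln (exp l)" using l s by (simp add: pos_divide_less_eq mult.commute)
    ultimately show "hausdorff_measure s (M_set \<psi>) = 0"
      using l s b by (intro hausdorff_measure_M_set_upper[of s "exp l"]) auto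
  qed
  show "ereal (pressure_root (ln b)) \<le> hausdorff_dim (M_set \<psi>)"
  proof (rule hausdorff_dim_ge_real[OF root(1)])
    fix s assume s: "1/2 < s" "s < pressure_root (ln b)"
    then show "hausdorff_measure s (M_set \<psi>) \<noteq> 0"
      using pressure_root_greater[OF b(1) s] root(2) b by (intro hausdorff_measure_M_set_lower) auto
  qed
qed

text \<open>Every exponential rate is eventually exceeded, so one above P(s) / s may be chosen. This
  bounds the dimension by 1/2, the exact value when \<open>b_lim\<close> is 1.\<close>

lemma hausdorff_measure_M_set_B_infinite:
  assumes B: "B_lim \<psi> = \<infinity>" and s: "s > 1/2"
  shows "hausdorff_measure s (M_set \<psi>) = 0"
proof -
  define l where "l = max 1 (pressure s / s + 1)"
  have "l > 0" "pressure s / s < l" by (auto simp: l_def)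
  then show ?thesis
    using s B by (intro hausdorff_measure_M_set_upper[of s "exp l"])
      (auto simp: pos_divide_less_eq mult.commute)
qed

text \<open>Gives the iterated logarithm in \<open>b_lim\<close> its usual meaning and makes it
  nonnegative.\<close>

lemma ln_psi_ge_1:
  assumes B: "B_lim \<psi> = \<infinity>"
  shows "\<forall>\<^sub>F n in sequentially. 1 \<le> ln (\<psi> (real n)) \<and> n \<ge> 1"
proof -
  have "\<forall>\<^sub>F n in sequentially. exp 1 ^ n < \<psi> (real n)" using B by (intro eventually_ge_power) auto
  then show ?thesis using eventually_ge_at_top[of 1]
  proof eventually_elim
    case (elim n)
    have "exp 1 ^ 1 \<le> (exp 1 :: real) ^ n" using elim by (intro power_increasing) auto
    then have "exp 1 \<le> \<psi> (real n)" using elim by simp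
    then have "ln (exp 1) \<le> ln (\<psi> (real n))" by (intro ln_mono) auto
    then show ?case using elim by simp
  qed
qed

lemma exp_ln_ln_div_less_iff:
  assumes "n \<ge> 1" "c > 0" "1 \<le> ln (\<psi> (real n))"
  shows "exp (ln (ln (\<psi> (real n))) / real n) < c \<longleftrightarrow> \<psi> (real n) < exp (c ^ n)"
    and "c < exp (ln (ln (\<psi> (real n))) / real n) \<longleftrightarrow> exp (c ^ n) < \<psi> (real n)"
proof -
  have p: "\<psi> (real n) > 0" using assms by (intro \<psi>_pos) auto
  have e: "exp (ln (ln (\<psi> (real n))) / real n) ^ n = ln (\<psi> (real n))"
    using assms by (simp add: exp_of_nat_mult[symmetric])
  have n: "n > 0" using assms by simp
  have "exp (ln (ln (\<psi> (real n))) / real n) < c \<longleftrightarrow> ln (\<psi> (real n)) < c ^ n"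
    using power_less_iff_nonneg[OF _ _ n, of "exp (ln (ln (\<psi> (real n))) / real n)" c] assms e by simp
  also have "\<dots> \<longleftrightarrow> exp (ln (\<psi> (real n))) < exp (c ^ n)" by simp
  finally show "exp (ln (ln (\<psi> (real n))) / real n) < c \<longleftrightarrow> \<psi> (real n) < exp (c ^ n)" using p by simp
  have "c < exp (ln (ln (\<psi> (real n))) / real n) \<longleftrightarrow> c ^ n < ln (\<psi> (real n))"
    using power_less_iff_nonneg[OF _ _ n, of c "exp (ln (ln (\<psi> (real n))) / real n)"] assms e by simp
  also have "\<dots> \<longleftrightarrow> exp (c ^ n) < exp (ln (\<psi> (real n)))" by simp
  finally show "c < exp (ln (ln (\<psi> (real n))) / real n) \<longleftrightarrow> exp (c ^ n) < \<psi> (real n)" using p by simp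
qed

lemma b_lim_ge_1:
  assumes B: "B_lim \<psi> = \<infinity>"
  shows "1 \<le> b_lim \<psi>"
  unfolding b_lim_def
proof (rule Liminf_bounded)
  show "\<forall>\<^sub>F n in sequentially. 1 \<le> ereal (exp (ln (ln (\<psi> (real n))) / real n))"
    using ln_psi_ge_1[OF B] by eventually_elim (simp add: one_ereal_def)
qed

lemma hausdorff_measure_M_set_b_upper:
  assumes B: "B_lim \<psi> = \<infinity>" and c: "c > 1" "ereal c < b_lim \<psi>" and s: "s > 0" "s * (c + 1) > 1"
  shows "hausdorff_measure s (M_set \<psi>) = 0"
proof (cases "s > 1/2")
  case True
  then show ?thesis by (rule hausdorff_measure_M_set_B_infinite[OF B])
next
  case False
  have "1 / s - 1 < c" using s by (simp add: field_simps)
  then obtain d where d: "max 1 (1 / s - 1) < d" "d < c" using c dense[of "max 1 (1 / s - 1)" c] by auto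
  then have sd: "s * (d + 1) > 1" using s by (simp add: field_simps)
  show ?thesis
  proof (rule hausdorff_measure_doubly_exponential_0[OF s(1) _ d(2) sd M_set_subset(1)])
    show "1 < d" using d by simp
    fix a assume a: "pos_seq a" "cf_val a \<in> M_set \<psi>"
    show "infinite {n. exp (c ^ Suc n) \<le> real (a n)}"
    proof (rule M_setD[OF a, of "\<lambda>n. exp (c ^ n)"])
      show "mono (\<lambda>n. exp (c ^ n))" using c by (intro monoI) (auto intro: power_increasing)
      show "filterlim (\<lambda>n. exp (c ^ n)) at_top sequentially"
        by (rule filterlim_compose[OF exp_at_top filterlim_power_at_top[OF c(1)]])
      have "\<forall>\<^sub>F n in sequentially. ereal c < ereal (exp (ln (ln (\<psi> (real n))) / real n))"
        using c(2) unfolding b_lim_def by (rule less_LiminfD)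
      then show "\<forall>\<^sub>F n in sequentially. exp (c ^ n) \<le> \<psi> (real n)"
        using ln_psi_ge_1[OF B]
        by eventually_elim (use exp_ln_ln_div_less_iff(2) c in \<open>auto simp: less_imp_le\<close>)
    qed
  qed
qed

text \<open>Quotients are made large at every index and not only at those where \<psi> is small;
  this already yields the sharp exponent.\<close>

lemma hausdorff_measure_M_set_b_lower:
  assumes B: "B_lim \<psi> = \<infinity>" and c: "c > 1" "b_lim \<psi> < ereal c" and s: "s > 0" "s * (c + 1) < 1"
  shows "hausdorff_measure s (M_set \<psi>) \<noteq> 0"
proof (rule hausdorff_measure_doubly_exponential[OF c(1) s])
  define N where "N = {n. ereal (exp (ln (ln (\<psi> (real n))) / real n)) < ereal c}"
  have inf: "infinite N"
    using c(2) unfolding N_def b_lim_def by (rule frequently_less_of_liminf_less)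
  obtain n0 where n0: "\<And>n. n \<ge> n0 \<Longrightarrow> 1 \<le> ln (\<psi> (real n)) \<and> n \<ge> 1"
    using ln_psi_ge_1[OF B] by (auto simp: eventually_sequentially)
  have N: "\<psi> (real n) \<le> exp (c ^ n)" if "n \<in> N - {..<n0}" for n
    using that n0[of n] exp_ln_ln_div_less_iff(1)[of n c] c by (auto simp: N_def)
  fix a assume a: "pos_seq a" "\<And>j. exp (c ^ Suc j) \<le> real (a j)"
  show "cf_val a \<in> M_set \<psi>"
  proof (rule M_setI[where N = "N - {..<n0}" and \<phi> = "\<lambda>n. exp (c ^ n)", OF a(1) N])
    have "exp (c ^ n) \<le> real (a (n - 1))" if "n \<ge> n0" for n
      using a(2)[of "n - 1"] n0[OF that] by (cases n) auto
    then have "N - {..<n0} \<subseteq> {n \<in> N - {..<n0}. 1 \<le> n \<and> exp (c ^ n) \<le> real (a (n - 1))}"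
      using n0 by auto
    moreover have "infinite (N - {..<n0})" using inf by simp
    ultimately show "infinite {n \<in> N - {..<n0}. 1 \<le> n \<and> exp (c ^ n) \<le> real (a (n - 1))}"
      by (rule infinite_super)
  qed
qed

lemma dim_M_set_B_infinite:
  assumes B: "B_lim \<psi> = \<infinity>"
  shows "hausdorff_dim (M_set \<psi>) = 1 / (b_lim \<psi> + 1)"
proof (cases "b_lim \<psi>")
  case PInf
  have "hausdorff_dim (M_set \<psi>) \<le> ereal 0"
  proof (rule hausdorff_dim_le_real)
    fix s :: real assume s: "s > 0"
    \<comment> \<open>Any rate c is available here; with c >= 1 / s one has s (c + 1) >= 1 +
      s.\<close>
    have "1 < s * (max 2 (1 / s) + 1)"
      using s mult_left_mono[of "1 / s" "max 2 (1 / s)" s] by (simp add: algebra_simps)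
    then show "hausdorff_measure s (M_set \<psi>) = 0"
      using s PInf
      by (intro hausdorff_measure_M_set_b_upper[OF B, of "max 2 (1 / s)"]) (simp_all del: ereal_max)
  qed simp
  then have "hausdorff_dim (M_set \<psi>) = 0"
    using hausdorff_dim_nonneg[of "M_set \<psi>"] by (simp add: zero_ereal_def[symmetric])
  then show ?thesis using PInf by simp
next
  case MInf
  then show ?thesis using b_lim_ge_1[OF B] by simp
next
  case (real \<beta>)
  then have \<beta>: "\<beta> \<ge> 1" using b_lim_ge_1[OF B] by (simp add: one_ereal_def)
  have "hausdorff_dim (M_set \<psi>) = ereal (1 / (\<beta> + 1))"
  proof (rule antisym)
    show "hausdorff_dim (M_set \<psi>) \<le> ereal (1 / (\<beta> + 1))"
    proof (rule hausdorff_dim_le_real)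
      fix s assume s: "1 / (\<beta> + 1) < s"
      have "0 < 1 / (\<beta> + 1)" using \<beta> by simp
      then have s0: "s > 0" using s by linarith
      show "hausdorff_measure s (M_set \<psi>) = 0"
      \<comment> \<open>For \<beta> = 1 no rate lies strictly between 1 and \<beta>; the threshold
        1/2 then comes from B being infinite.\<close>
      proof (cases "\<beta> = 1")
        case True
        then show ?thesis using s by (intro hausdorff_measure_M_set_B_infinite[OF B]) simp
      next
        case False
        have "1 / s - 1 < \<beta>" using s s0 \<beta> by (simp add: field_simps)
        then obtain c where c: "max 1 (1 / s - 1) < c" "c < \<beta>"
          using False \<beta> dense[of "max 1 (1 / s - 1)" \<beta>] by auto
        then have "s * (c + 1) > 1" using s0 by (simp add: field_simps)
        then show ?thesis using c s0 real by (intro hausdorff_measure_M_set_b_upper[OF B, of c]) auto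
      qed
    qed (use \<beta> in simp)
    show "ereal (1 / (\<beta> + 1)) \<le> hausdorff_dim (M_set \<psi>)"
    proof (rule hausdorff_dim_ge_real[of 0])
      fix s :: real assume s: "0 < s" "s < 1 / (\<beta> + 1)"
      then have "\<beta> < 1 / s - 1" using \<beta> by (simp add: field_simps)
      then obtain c where c: "\<beta> < c" "c < 1 / s - 1" using dense by blast
      then have "s * (c + 1) < 1" using s by (simp add: field_simps)
      then show "hausdorff_measure s (M_set \<psi>) \<noteq> 0"
        using c s \<beta> real by (intro hausdorff_measure_M_set_b_lower[OF B, of c]) auto
    qed (use \<beta> in simp)
  qed
  moreover have "1 / (ereal \<beta> + 1) = ereal (1 / (\<beta> + 1))"
    using \<beta> by (simp add: one_ereal_def)
  ultimately show ?thesis using real by simp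
qed

end

text \<open>\<open>pressure_root\<close> is a definite description, and the first conjunct certifies
  that it denotes the root.\<close>

theorem theorem7:
  fixes \<psi> :: "real \<Rightarrow> real"
  assumes "\<And>t. t > 0 \<Longrightarrow> \<psi> t > 0"
  shows "(\<forall>B::real. B > 1 \<longrightarrow> (\<exists>!\<theta>. \<theta> > 1/2 \<and> pressure \<theta> = \<theta> * ln B)) \<and>
         (B_lim \<psi> = 1 \<longrightarrow> hausdorff_dim (M_set \<psi>) = 1) \<and>
         (1 < B_lim \<psi> \<and> B_lim \<psi> < \<infinity> \<longrightarrow>
            hausdorff_dim (M_set \<psi>) = ereal (pressure_root (ln (real_of_ereal (B_lim \<psi>))))) \<and>
         (B_lim \<psi> = \<infinity> \<longrightarrow> hausdorff_dim (M_set \<psi>) = 1 / (b_lim \<psi> + 1))"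
proof (intro conjI impI allI)
  show "\<exists>!\<theta>. \<theta> > 1/2 \<and> pressure \<theta> = \<theta> * ln B" if "B > 1" for B :: real
    by (rule pressure_root_exists[OF that])
  show "hausdorff_dim (M_set \<psi>) = 1" if "B_lim \<psi> = 1"
    by (rule dim_M_set_B_1[OF assms that])
  show "hausdorff_dim (M_set \<psi>) = ereal (pressure_root (ln (real_of_ereal (B_lim \<psi>))))"
    if B: "1 < B_lim \<psi> \<and> B_lim \<psi> < \<infinity>"
  proof -
    obtain b where b: "B_lim \<psi> = ereal b" using B by (cases "B_lim \<psi>") auto
    then have "b > 1" using B by (simp add: one_ereal_def)
    then show ?thesis using dim_M_set_B_finite[OF assms _ b] b by simp
  qed
  show "hausdorff_dim (M_set \<psi>) = 1 / (b_lim \<psi> + 1)" if "B_lim \<psi> = \<infinity>"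
    by (rule dim_M_set_B_infinite[OF assms that])
qed

end
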